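(* Let $p,q\ge 1$ be integers, let $f=x^p+y^q$ on the ordinary double point $X\colon xy=0$ in $(\mathbb{C}^2,0)$, and let $\Delta$ be the discriminant of the miniversal deformation of $f$. The sheaf $\Theta(-\log\Delta)$ is naturally endowed with a multiplication $\star$ and a flat bilinear pairing $\langle\,,\rangle$ (those described in the context) satisfying $$\langle u\star v,w\rangle=\langle u,v\star w\rangle\quad\text{for any }u,v,w\in\Theta(-\log\Delta).$$ There exists a conformal Euler vector field $E$, that is, $$\mathrm{Lie}_E(\star)=\star\quad\text{and}\quad \mathrm{Lie}_E(\langle\,,\rangle)=\langle\,,\rangle.$$
   Context: **Miniversal deformation.** The miniversal deformation of $f$ (as a function on the deforming curve, with the target line $\mathbb{C}$ fixed) is given by $F=c+\sum_{i=1}^{p-1}a_ix^i+x^p+\sum_{i=1}^{q-1}b_iy^i+y^q$ on the fibration $\pi(x,y,a,b,c)=(xy,a,b,c)$, from $(\mathcal{X},0)=(\mathbb{C}^2\times\mathbb{C}^{p+q-1},0)$ to the base $(B,0)=(\mathbb{C}^{p+q},0)$ with coordinates $(\epsilon,a,b,c)$, $a=(a_{p-1},\dots,a_1)$, $b=(b_{q-1},\dots,b_1)$. Its discriminant is $\Delta=\{\epsilon=0\}$. $\Theta(-\log\Delta)$ denotes the sheaf of vector fields on $B$ tangent to $\Delta$; it is free with basis $\epsilon\,\partial/\partial\epsilon$ and the remaining coordinate vector fields. **Multiplication.** Put $H=x\,\partial F/\partial x-y\,\partial F/\partial y$. For $u\in\Theta(-\log\Delta)$ choose a vector field $\tilde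 u$ on $\mathcal{X}$ with $t\pi(\tilde u)=u\circ\pi$, and let $t'F(u)$ be the class of $\tilde u(F)$ in $\mathcal{O}_{\mathcal{X}}/(H)$. The map $t'F$ is an isomorphism of free $\mathcal{O}_B$-modules of rank $p+q$ from $\Theta(-\log\Delta)$ to (the direct image of) $\mathcal{O}_{\mathcal{X}}/(H)$, and $\star$ is the pull-back under $t'F$ of the algebra structure on $\mathcal{O}_{\mathcal{X}}/(H)$. **Pairing.** Let $\alpha=dx\wedge dy/d\pi_1$, with $\pi_1=xy$, be the relative dualising form. The pairing is the Grothendieck residue pairing pulled back via $t'F$: for $\beta\in B$ and $u,v\in\Theta(-\log\Delta)_\beta$, $$\langle u,v\rangle=\int_{\partial X_\beta}\frac{t'F(u)\,t'F(v)}{H}\,\alpha,$$ where $\partial X_\beta$ is the boundary of an appropriate representative of the fibre $\pi^{-1}(\beta)$. Flat means that on $B\setminus\Delta$ (where $\Theta(-\log\Delta)=\Theta_B$) the pairing is a non-degenerate symmetric holomorphic metric admitting local coordinates in which its matrix is constant. **Lie derivatives.** $\mathrm{Lie}_E(\star)(u,v)=[E,u\star v]-[E,u]\star v-u\star[E,v]$ and $\mathrm{Lie}_E(\langle\,,\rangle)(u,v)=E\langle u,v\rangle-\langle[E,u],v\rangle-\langle u,[E,v]\rangle$. *)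

theory Defs
  imports "HOL-Complex_Analysis.Complex_Analysis" "HOL-Algebra.QuotRing"
begin

section \<open>Holomorphic maps of several variables\<close>

text \<open>Products and \<open>complex ^ 'm\<close> are only real vector spaces in the library, so complex scaling
  is supplied by a class. A map is holomorphic if it is real Frechet differentiable with
  complex linear differential.\<close>

class cscale =
  fixes cscale :: "complex \<Rightarrow> 'a \<Rightarrow> 'a"

instantiation complex :: cscale
begin
definition cscale_complex :: "complex \<Rightarrow> complex \<Rightarrow> complex" where
  "cscale_complex c z = c * z"
instance ..
end

instantiation prod :: (cscale, cscale) cscale
begin
definition cscale_prod :: "complex \<Rightarrow> 'a \<times> 'b \<Rightarrow> 'a \<times> 'b" where
  "cscale_prod c v = (cscale c (fst v), cscale c (snd v))"
instance ..
end

instantiation vec :: (cscale, finite) cscale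
begin
definition cscale_vec :: "complex \<Rightarrow> ('a, 'b) vec \<Rightarrow> ('a, 'b) vec" where
  "cscale_vec c v = (\<chi> i. cscale c (v $ i))"
instance ..
end

definition cholo_on ::
  "('a::{real_normed_vector, cscale} \<Rightarrow> 'b::{real_normed_vector, cscale}) \<Rightarrow> 'a set \<Rightarrow> bool"
  (infixl "cholo'_on" 50) where
  "f cholo_on U \<longleftrightarrow>
     (\<forall>z\<in>U. \<exists>D. (f has_derivative D) (at z) \<and> (\<forall>c v. D (cscale c v) = cscale c (D v)))"

text \<open>The derivative \<open>u(g)\<close> of a function (or map) along a vector field, and the Lie bracket
  \<open>[u,v] = u(v) - v(u)\<close>, componentwise in linear coordinates.\<close>

definition vderiv :: "('a::real_normed_vector \<Rightarrow> 'a) \<Rightarrow> ('a \<Rightarrow> 'b::real_normed_vector) \<Rightarrow> 'a \<Rightarrow> 'b" where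
  "vderiv u g z = frechet_derivative g (at z) (u z)"

definition bracket :: "('a::real_normed_vector \<Rightarrow> 'a) \<Rightarrow> ('a \<Rightarrow> 'a) \<Rightarrow> 'a \<Rightarrow> 'a" where
  "bracket u v z = vderiv u v z - vderiv v u z"

text \<open>The ring of holomorphic functions on \<open>S\<close>, as functions that are \<open>undefined\<close> off \<open>S\<close>.\<close>

definition holo_ring :: "'a::{real_normed_vector, cscale} set \<Rightarrow> ('a \<Rightarrow> complex) ring" where
  "holo_ring S =
    \<lparr>carrier = {f \<in> extensional S. f cholo_on S},
     mult = (\<lambda>f g. restrict (\<lambda>z. f z * g z) S),
     one = restrict (\<lambda>z. 1) S,
     zero = restrict (\<lambda>z. 0) S,
     add = (\<lambda>f g. restrict (\<lambda>z. f z + g z) S)\<rparr>"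

section \<open>The miniversal deformation\<close>

text \<open>The coordinates on the base are \<open>\<epsilon>\<close> and the \<open>p + q - 1\<close> parameters
  \<open>a_1, \<dots>, a_(p-1), b_1, \<dots>, b_(q-1), c\<close>. The parameters are the components of a vector
  \<open>s :: complex ^ 'm\<close>, where the labels are matched with the index type by a bijection
  \<open>ix\<close> from \<open>params p q\<close> onto the type \<open>'m\<close>.\<close>

datatype param = PA nat | PB nat | PC

definition params :: "nat \<Rightarrow> nat \<Rightarrow> param set" where
  "params p q = PA ` {1..<p} \<union> PB ` {1..<q} \<union> {PC}"

type_synonym 'm base = "complex \<times> (complex ^ 'm)"
type_synonym 'm total = "complex \<times> complex \<times> (complex ^ 'm)"

definition proj :: "'m::finite total \<Rightarrow> 'm base" where
  "proj = (\<lambda>(x, y, s). (x * y, s))"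

definition Fdef :: "nat \<Rightarrow> nat \<Rightarrow> (param \<Rightarrow> 'm::finite) \<Rightarrow> 'm total \<Rightarrow> complex" where
  "Fdef p q ix = (\<lambda>(x, y, s).
     s $ ix PC + (\<Sum>i\<in>{1..<p}. s $ ix (PA i) * x ^ i) + x ^ p
               + (\<Sum>i\<in>{1..<q}. s $ ix (PB i) * y ^ i) + y ^ q)"

definition Hdef :: "nat \<Rightarrow> nat \<Rightarrow> (param \<Rightarrow> 'm::finite) \<Rightarrow> 'm total \<Rightarrow> complex" where
  "Hdef p q ix = (\<lambda>(x, y, s).
     x * deriv (\<lambda>t. Fdef p q ix (t, y, s)) x - y * deriv (\<lambda>t. Fdef p q ix (x, t, s)) y)"

definition discr :: "'m::finite base set" where
  "discr = {\<beta>. fst \<beta> = 0}"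

text \<open>\<open>tube r U\<close> is the inverse image of \<open>U\<close> in the representative \<open>|x| < r, |y| < r\<close> of the germ
  of the total space.\<close>

definition tube :: "real \<Rightarrow> 'm::finite base set \<Rightarrow> 'm total set" where
  "tube r U = {(x, y, s). norm x < r \<and> norm y < r \<and> proj (x, y, s) \<in> U}"

text \<open>Sections over \<open>U\<close> of the sheaf of vector fields tangent to the discriminant. Vector fields are
  total functions; only their values on \<open>U\<close> matter.\<close>

definition log_fields :: "'m::finite base set \<Rightarrow> ('m base \<Rightarrow> 'm base) set" where
  "log_fields U = {u. u cholo_on U \<and> (\<forall>\<beta>\<in>U \<inter> discr. fst (u \<beta>) = 0)}"

section \<open>The multiplication\<close>

definition jac_ideal ::
  "nat \<Rightarrow> nat \<Rightarrow> (param \<Rightarrow> 'm::finite) \<Rightarrow> real \<Rightarrow> 'm base set \<Rightarrow> ('m total \<Rightarrow> complex) set" where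
  "jac_ideal p q ix r U =
     cgenideal (holo_ring (tube r U)) (restrict (Hdef p q ix) (tube r U))"

definition jac_ring ::
  "nat \<Rightarrow> nat \<Rightarrow> (param \<Rightarrow> 'm::finite) \<Rightarrow> real \<Rightarrow> 'm base set \<Rightarrow> ('m total \<Rightarrow> complex) set ring" where
  "jac_ring p q ix r U = holo_ring (tube r U) Quot jac_ideal p q ix r U"

text \<open>For a lift \<open>ut\<close> of \<open>u\<close> along \<open>proj\<close>, \<open>t'F(u)\<close> is the class of \<open>ut(F)\<close> modulo \<open>H\<close>. It is
  defined through a chosen lift; independence of the choice is \<open>tF_well_defined\<close> below.\<close>

definition is_lift ::
  "real \<Rightarrow> 'm::finite base set \<Rightarrow> ('m base \<Rightarrow> 'm base) \<Rightarrow> ('m total \<Rightarrow> 'm total) \<Rightarrow> bool" where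
  "is_lift r U u ut \<longleftrightarrow>
     ut cholo_on tube r U \<and> (\<forall>z\<in>tube r U. frechet_derivative proj (at z) (ut z) = u (proj z))"

definition lift_class ::
  "nat \<Rightarrow> nat \<Rightarrow> (param \<Rightarrow> 'm::finite) \<Rightarrow> real \<Rightarrow> 'm base set \<Rightarrow> ('m total \<Rightarrow> 'm total)
     \<Rightarrow> ('m total \<Rightarrow> complex) set" where
  "lift_class p q ix r U ut =
     a_r_coset (holo_ring (tube r U)) (jac_ideal p q ix r U)
       (restrict (vderiv ut (Fdef p q ix)) (tube r U))"

definition tF ::
  "nat \<Rightarrow> nat \<Rightarrow> (param \<Rightarrow> 'm::finite) \<Rightarrow> real \<Rightarrow> 'm base set \<Rightarrow> ('m base \<Rightarrow> 'm base)
     \<Rightarrow> ('m total \<Rightarrow> complex) set" where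
  "tF p q ix r U u = lift_class p q ix r U (SOME ut. is_lift r U u ut)"

text \<open>\<open>is_star p q ix r U u v w\<close> says that \<open>w\<close> is a section over \<open>U\<close> with
  \<open>t'F(w) = t'F(u) t'F(v)\<close>. Such \<open>w\<close> is determined only on \<open>U\<close>, whence the choice
  operator in \<open>star\<close>.\<close>

definition is_star ::
  "nat \<Rightarrow> nat \<Rightarrow> (param \<Rightarrow> 'm::finite) \<Rightarrow> real \<Rightarrow> 'm base set
     \<Rightarrow> ('m base \<Rightarrow> 'm base) \<Rightarrow> ('m base \<Rightarrow> 'm base) \<Rightarrow> ('m base \<Rightarrow> 'm base) \<Rightarrow> bool" where
  "is_star p q ix r U u v w \<longleftrightarrow>
     w \<in> log_fields U \<and>
     tF p q ix r U w = tF p q ix r U u \<otimes>\<^bsub>jac_ring p q ix r U\<^esub> tF p q ix r U v"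

definition star ::
  "nat \<Rightarrow> nat \<Rightarrow> (param \<Rightarrow> 'm::finite) \<Rightarrow> real \<Rightarrow> 'm base set
     \<Rightarrow> ('m base \<Rightarrow> 'm base) \<Rightarrow> ('m base \<Rightarrow> 'm base) \<Rightarrow> 'm base \<Rightarrow> 'm base" where
  "star p q ix r U u v = (SOME w. is_star p q ix r U u v w)"

section \<open>The residue pairing\<close>

text \<open>\<open>appropriate p q ix r \<beta> \<rho>\<close> says that \<open>|x| \<le> \<rho>, |y| \<le> \<rho>\<close> cuts out a representative of the
  fibre over \<open>\<beta>\<close> that contains all zeros of \<open>H\<close> on the fibre in its interior.\<close>

definition appropriate ::
  "nat \<Rightarrow> nat \<Rightarrow> (param \<Rightarrow> 'm::finite) \<Rightarrow> real \<Rightarrow> 'm base \<Rightarrow> real \<Rightarrow> bool" where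
  "appropriate p q ix r \<beta> \<rho> \<longleftrightarrow>
     0 < \<rho> \<and> \<rho> < r \<and> norm (fst \<beta>) < \<rho>\<^sup>2 \<and>
     (\<forall>x y s. (x, y, s) \<in> tube r {\<beta>} \<and> Hdef p q ix (x, y, s) = 0 \<longrightarrow> norm x < \<rho> \<and> norm y < \<rho>)"

text \<open>The integral of \<open>(G / H) \<alpha>\<close> over the boundary of the fibre \<open>x y = \<epsilon>\<close>, cut at radius \<open>\<rho>\<close>.
  The relative form, determined by \<open>\<alpha> \<and> d(x y) = dx \<and> dy\<close>, is \<open>dx / x = - dy / y\<close>
  on the fibre. The boundary has the two components \<open>|x| = \<rho>\<close> and \<open>|y| = \<rho>\<close>, each
  positively oriented in the coordinate \<open>x\<close> or \<open>y\<close>, respectively: for \<open>\<epsilon> \<noteq> 0\<close>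
  the fibre is an annulus, for \<open>\<epsilon> = 0\<close> two discs. There is no factor \<open>1 / (2 \<pi> i)\<close>.\<close>

definition residue_integral ::
  "nat \<Rightarrow> nat \<Rightarrow> (param \<Rightarrow> 'm::finite) \<Rightarrow> real \<Rightarrow> ('m total \<Rightarrow> complex) \<Rightarrow> 'm base \<Rightarrow> complex" where
  "residue_integral p q ix \<rho> G = (\<lambda>(\<epsilon>, s).
     contour_integral (circlepath 0 \<rho>)
       (\<lambda>x. G (x, \<epsilon> / x, s) / Hdef p q ix (x, \<epsilon> / x, s) * (1 / x))
   + contour_integral (circlepath 0 \<rho>)
       (\<lambda>y. G (\<epsilon> / y, y, s) / Hdef p q ix (\<epsilon> / y, y, s) * (- 1 / y)))"

definition pairing ::
  "nat \<Rightarrow> nat \<Rightarrow> (param \<Rightarrow> 'm::finite) \<Rightarrow> real \<Rightarrow> 'm base set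
     \<Rightarrow> ('m base \<Rightarrow> 'm base) \<Rightarrow> ('m base \<Rightarrow> 'm base) \<Rightarrow> 'm base \<Rightarrow> complex" where
  "pairing p q ix r U u v \<beta> =
     residue_integral p q ix (SOME \<rho>. appropriate p q ix r \<beta> \<rho>)
       (SOME G. G \<in> tF p q ix r U u \<otimes>\<^bsub>jac_ring p q ix r U\<^esub> tF p q ix r U v) \<beta>"

section \<open>Properties of multiplications and pairings\<close>

definition comm_algebra_over ::
  "'m::finite base set \<Rightarrow> (('m base \<Rightarrow> 'm base) \<Rightarrow> ('m base \<Rightarrow> 'm base) \<Rightarrow> 'm base \<Rightarrow> 'm base)
     \<Rightarrow> bool" where
  "comm_algebra_over U m \<longleftrightarrow>
     (\<forall>u\<in>log_fields U. \<forall>v\<in>log_fields U. m u v \<in> log_fields U \<and> (\<forall>\<beta>\<in>U. m u v \<beta> = m v u \<beta>)) \<and>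
     (\<forall>u\<in>log_fields U. \<forall>v\<in>log_fields U. \<forall>w\<in>log_fields U. \<forall>\<beta>\<in>U.
        m (m u v) w \<beta> = m u (m v w) \<beta>) \<and>
     (\<exists>e\<in>log_fields U. \<forall>u\<in>log_fields U. \<forall>\<beta>\<in>U. m e u \<beta> = u \<beta>) \<and>
     (\<forall>f g. \<forall>u\<in>log_fields U. \<forall>v\<in>log_fields U. \<forall>w\<in>log_fields U.
        f cholo_on U \<and> g cholo_on U \<longrightarrow>
        (\<forall>\<beta>\<in>U. m (\<lambda>\<gamma>. cscale (f \<gamma>) (u \<gamma>) + cscale (g \<gamma>) (v \<gamma>)) w \<beta> =
                 cscale (f \<beta>) (m u w \<beta>) + cscale (g \<beta>) (m v w \<beta>)))"

definition symmetric_form_over ::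
  "'m::finite base set \<Rightarrow> (('m base \<Rightarrow> 'm base) \<Rightarrow> ('m base \<Rightarrow> 'm base) \<Rightarrow> 'm base \<Rightarrow> complex)
     \<Rightarrow> bool" where
  "symmetric_form_over U g \<longleftrightarrow>
     (\<forall>u\<in>log_fields U. \<forall>v\<in>log_fields U. g u v cholo_on U \<and> (\<forall>\<beta>\<in>U. g u v \<beta> = g v u \<beta>)) \<and>
     (\<forall>f h. \<forall>u\<in>log_fields U. \<forall>v\<in>log_fields U. \<forall>w\<in>log_fields U.
        f cholo_on U \<and> h cholo_on U \<longrightarrow>
        (\<forall>\<beta>\<in>U. g (\<lambda>\<gamma>. cscale (f \<gamma>) (u \<gamma>) + cscale (h \<gamma>) (v \<gamma>)) w \<beta> =
                 f \<beta> * g u w \<beta> + h \<beta> * g v w \<beta>))"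

definition coord_vectors :: "'m::finite base set" where
  "coord_vectors = insert (1, 0) (range (\<lambda>k. (0, axis k 1)))"

definition holo_chart ::
  "'m::finite base set \<Rightarrow> 'm base set \<Rightarrow> ('m base \<Rightarrow> 'm base) \<Rightarrow> ('m base \<Rightarrow> 'm base) \<Rightarrow> bool" where
  "holo_chart U V \<phi> \<psi> \<longleftrightarrow>
     open U \<and> open V \<and> \<phi> cholo_on U \<and> \<psi> cholo_on V \<and>
     (\<forall>\<beta>\<in>U. \<phi> \<beta> \<in> V \<and> \<psi> (\<phi> \<beta>) = \<beta>) \<and> (\<forall>t\<in>V. \<psi> t \<in> U \<and> \<phi> (\<psi> t) = t)"

text \<open>The coordinate vector field in direction \<open>e\<close> of the chart \<open>\<phi>\<close> with inverse \<open>\<psi>\<close>.\<close>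

definition coord_field ::
  "('m::finite base \<Rightarrow> 'm base) \<Rightarrow> ('m base \<Rightarrow> 'm base) \<Rightarrow> 'm base \<Rightarrow> 'm base \<Rightarrow> 'm base" where
  "coord_field \<phi> \<psi> e \<beta> = frechet_derivative \<psi> (at (\<phi> \<beta>)) e"

text \<open>The form \<open>g\<close> is given on the sections over each open set \<open>U\<close>.\<close>

definition flat_metric_on ::
  "'m::finite base set \<Rightarrow>
   ('m base set \<Rightarrow> ('m base \<Rightarrow> 'm base) \<Rightarrow> ('m base \<Rightarrow> 'm base) \<Rightarrow> 'm base \<Rightarrow> complex) \<Rightarrow> bool" where
  "flat_metric_on W g \<longleftrightarrow>
     (\<forall>U. open U \<and> U \<subseteq> W \<longrightarrow> symmetric_form_over U (g U)) \<and>
     (\<forall>U. open U \<and> U \<subseteq> W \<longrightarrow>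
        (\<forall>u\<in>log_fields U. \<forall>\<beta>\<in>U. u \<beta> \<noteq> 0 \<longrightarrow> (\<exists>v\<in>log_fields U. g U u v \<beta> \<noteq> 0))) \<and>
     (\<forall>\<beta>0\<in>W. \<exists>U V \<phi> \<psi>. \<beta>0 \<in> U \<and> U \<subseteq> W \<and> holo_chart U V \<phi> \<psi> \<and>
        (\<forall>e\<in>coord_vectors. \<forall>e'\<in>coord_vectors. \<exists>k. \<forall>\<beta>\<in>U.
           g U (coord_field \<phi> \<psi> e) (coord_field \<phi> \<psi> e') \<beta> = k))"

definition Lie_mult ::
  "('m::finite base \<Rightarrow> 'm base) \<Rightarrow> (('m base \<Rightarrow> 'm base) \<Rightarrow> ('m base \<Rightarrow> 'm base) \<Rightarrow> 'm base \<Rightarrow> 'm base)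
     \<Rightarrow> ('m base \<Rightarrow> 'm base) \<Rightarrow> ('m base \<Rightarrow> 'm base) \<Rightarrow> 'm base \<Rightarrow> 'm base" where
  "Lie_mult E m u v \<beta> = bracket E (m u v) \<beta> - m (bracket E u) v \<beta> - m u (bracket E v) \<beta>"

definition Lie_form ::
  "('m::finite base \<Rightarrow> 'm base) \<Rightarrow> (('m base \<Rightarrow> 'm base) \<Rightarrow> ('m base \<Rightarrow> 'm base) \<Rightarrow> 'm base \<Rightarrow> complex)
     \<Rightarrow> ('m base \<Rightarrow> 'm base) \<Rightarrow> ('m base \<Rightarrow> 'm base) \<Rightarrow> 'm base \<Rightarrow> complex" where
  "Lie_form E g u v \<beta> = vderiv E (g u v) \<beta> - g (bracket E u) v \<beta> - g u (bracket E v) \<beta>"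

section \<open>Well-definedness\<close>

definition tF_well_defined ::
  "nat \<Rightarrow> nat \<Rightarrow> (param \<Rightarrow> 'm::finite) \<Rightarrow> real \<Rightarrow> 'm base set \<Rightarrow> bool" where
  "tF_well_defined p q ix r U \<longleftrightarrow>
     (\<forall>u\<in>log_fields U. (\<exists>ut. is_lift r U u ut) \<and>
        (\<forall>ut. is_lift r U u ut \<longrightarrow>
           lift_class p q ix r U ut \<in> carrier (jac_ring p q ix r U) \<and>
           lift_class p q ix r U ut = tF p q ix r U u))"

definition star_well_defined ::
  "nat \<Rightarrow> nat \<Rightarrow> (param \<Rightarrow> 'm::finite) \<Rightarrow> real \<Rightarrow> 'm base set \<Rightarrow> bool" where
  "star_well_defined p q ix r U \<longleftrightarrow>
     (\<exists>e\<in>log_fields U. tF p q ix r U e = \<one>\<^bsub>jac_ring p q ix r U\<^esub>) \<and>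
     (\<forall>u\<in>log_fields U. \<forall>v\<in>log_fields U.
        (\<exists>w. is_star p q ix r U u v w) \<and>
        (\<forall>w w'. is_star p q ix r U u v w \<and> is_star p q ix r U u v w' \<longrightarrow> (\<forall>\<beta>\<in>U. w \<beta> = w' \<beta>)))"

definition pairing_well_defined ::
  "nat \<Rightarrow> nat \<Rightarrow> (param \<Rightarrow> 'm::finite) \<Rightarrow> real \<Rightarrow> 'm base set \<Rightarrow> bool" where
  "pairing_well_defined p q ix r U \<longleftrightarrow>
     (\<forall>\<beta>\<in>U. \<exists>\<rho>. appropriate p q ix r \<beta> \<rho>) \<and>
     (\<forall>u\<in>log_fields U. \<forall>v\<in>log_fields U. \<forall>\<beta>\<in>U. \<forall>\<rho> G.
        appropriate p q ix r \<beta> \<rho> \<and>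
        G \<in> tF p q ix r U u \<otimes>\<^bsub>jac_ring p q ix r U\<^esub> tF p q ix r U v \<longrightarrow>
        residue_integral p q ix \<rho> G \<beta> = pairing p q ix r U u v \<beta>)"

text \<open>Compatibility with restriction to smaller open sets.\<close>

definition restriction_compatible ::
  "'m::finite base set \<Rightarrow>
   ('m base set \<Rightarrow> ('m base \<Rightarrow> 'm base) \<Rightarrow> ('m base \<Rightarrow> 'm base) \<Rightarrow> 'm base \<Rightarrow> 'b) \<Rightarrow> bool" where
  "restriction_compatible U m \<longleftrightarrow>
     (\<forall>V. open V \<and> V \<subseteq> U \<longrightarrow>
        (\<forall>u\<in>log_fields U. \<forall>v\<in>log_fields U. \<forall>\<beta>\<in>V. m V u v \<beta> = m U u v \<beta>))"

end

theory Submission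
  imports Defs
begin

text \<open>
  A logarithmic field \<open>u\<close> with \<open>d\<epsilon>(u) = \<epsilon> h\<close> is recorded by its normal form
  \<open>h x \<partial>F/\<partial>x + u(F)\<close>, the value on \<open>F\<close> of a lift, which is a polynomial in \<open>x\<close> and \<open>y\<close> of bounded
  degree over the functions on the base. Products of normal forms reduce to normal forms modulo \<open>H\<close> because
  multiplication by \<open>x\<close> and \<open>y\<close> does not leave their span modulo \<open>H\<close>. On a fixed fibre the residue
  functional kills the multiples of \<open>H\<close>, and pushing the contours to infinity computes it on monomials: in
  the frame \<open>\<epsilon> \<partial>/\<partial>\<epsilon>, \<partial>/\<partial>a, \<partial>/\<partial>b, \<partial>/\<partial>c\<close> the pairing is
  block triangular, hence nondegenerate, and this gives the uniqueness of products. The \<open>a\<close>-block is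
  the residue at infinity of \<open>x ^ (i + j) / (x f'(x)) dx / x\<close> with \<open>f = x ^ p + \<Sum> a_i x ^ i\<close>, and it becomes
  constant in the coefficients \<open>t_k\<close> of \<open>log x = log w - \<Sum> t_k w ^ (- k)\<close>, where \<open>w ^ p = f\<close>;
  Lagrange inversion turns this into a polynomial change of coordinates. Together with the same for \<open>b\<close>,
  with \<open>c\<close> and with \<open>log \<epsilon>\<close>, these are flat coordinates. The Euler field is the one for
  which \<open>F\<close> has weight one.
\<close>

text \<open>That normal forms represent each class modulo \<open>H\<close> exactly once is not taken
  from general theory. Spanning is elementary: \<open>x y\<close> is a function on the base, and
  \<open>pol p a x\<close> and \<open>pol q b y\<close> agree modulo \<open>H\<close>. Independence
  is the delicate half, since it has to hold at every point of the base, the discriminant included.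
  It comes from the pairing itself: a normal form divisible by \<open>H\<close> pairs to zero with
  everything, while the Gram matrix is invertible. The residues must therefore be computed uniformly
  for annuli and for nodal fibres. Expansion at the two infinities does this: over small base points
  \<open>H\<close> has no zeros with \<open>x\<close> or \<open>y\<close> large, however large, so
  each boundary circle can move out to infinity and no zero has to be located or counted. In the
  logarithmic frame the result does not involve \<epsilon>, so the pairing extends over the
  discriminant and \<open>log \<epsilon>\<close> is a flat coordinate. The Euler identities are a
  count of weights: \<open>H\<close> has weight one, \<open>dx / x\<close> has weight zero, and each
  \<open>t'F\<close> costs one unit, so that one unit is left over both in the product and in the
  pairing.\<close>

unbundle no fps_syntax

section \<open>Complex vector spaces\<close>

text \<open>Ties the bare operation \<open>cscale\<close> to the real structure, so that real
  Frechet calculus carries over. Finite dimension makes bilinear maps bounded and allows derivatives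
  to be expanded along \<open>Basis\<close>.\<close>

class cvec = euclidean_space + cscale +
  assumes cscale_add_right: "cscale c (v + w) = cscale c v + cscale c w"
    and cscale_add_left: "cscale (c + d) v = cscale c v + cscale d v"
    and cscale_cscale: "cscale c (cscale d v) = cscale (c * d) v"
    and cscale_of_real: "cscale (complex_of_real r) v = r *\<^sub>R v"

instance complex :: cvec
  by standard (auto simp: cscale_complex_def algebra_simps scaleR_conv_of_real)

instance prod :: (cvec, cvec) cvec
  by standard (auto simp: cscale_prod_def cscale_add_right cscale_add_left cscale_cscale
      cscale_of_real prod_eq_iff)

instance vec :: (cvec, finite) cvec
  by standard (auto simp: cscale_vec_def cscale_add_right cscale_add_left cscale_cscale
      cscale_of_real vec_eq_iff)

lemma cscale_complex [simp]: "cscale c (z :: complex) = c * z"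
  by (simp add: cscale_complex_def)

lemma fst_cscale [simp]: "fst (cscale c v) = cscale c (fst v)"
  and snd_cscale [simp]: "snd (cscale c v) = cscale c (snd v)"
  by (simp_all add: cscale_prod_def)

lemma cscale_Pair [simp]: "cscale c (a, b) = (cscale c a, cscale c b)"
  by (simp add: cscale_prod_def)

lemma cscale_nth [simp]: "cscale c v $ i = cscale c (v $ i)"
  by (simp add: cscale_vec_def)

lemma cscale_1 [simp]: "cscale 1 (v :: 'a::cvec) = v"
  using cscale_of_real[of 1 v] by simp

lemma cscale_minus_1 [simp]: "cscale (- 1) (v :: 'a::cvec) = - v"
  using cscale_of_real[of "- 1" v] by simp

lemma cscale_scaleR: "cscale c (r *\<^sub>R v :: 'a::cvec) = r *\<^sub>R cscale c v"
  by (simp add: cscale_of_real[symmetric] cscale_cscale mult.commute)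

lemma scaleR_cscale: "cscale (r *\<^sub>R c) (v :: 'a::cvec) = r *\<^sub>R cscale c v"
  by (simp add: cscale_of_real[symmetric] cscale_cscale scaleR_conv_of_real)

lemma bounded_bilinear_cscale: "bounded_bilinear (cscale :: complex \<Rightarrow> 'a \<Rightarrow> 'a::cvec)"
  unfolding bilinear_conv_bounded_bilinear[symmetric] bilinear_def
  by (auto intro!: linearI simp: cscale_add_left cscale_add_right cscale_scaleR scaleR_cscale)

lemma cscale_0_left [simp]: "cscale 0 (v :: 'a::cvec) = 0"
  and cscale_0_right [simp]: "cscale c (0 :: 'a::cvec) = 0"
  by (simp_all add: bounded_bilinear.zero_left[OF bounded_bilinear_cscale]
      bounded_bilinear.zero_right[OF bounded_bilinear_cscale])

lemma cscale_minus_right: "cscale c (- v) = - cscale c (v :: 'a::cvec)"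
  and cscale_diff_right: "cscale c (v - w) = cscale c v - cscale c (w :: 'a::cvec)"
  and cscale_sum_right: "cscale c (\<Sum>i\<in>A. g i) = (\<Sum>i\<in>A. cscale c (g i :: 'a::cvec))"
  by (simp_all add: bounded_bilinear.minus_right[OF bounded_bilinear_cscale]
      bounded_bilinear.diff_right[OF bounded_bilinear_cscale]
      bounded_bilinear.sum_right[OF bounded_bilinear_cscale])

lemmas continuous_on_cscale [continuous_intros] =
  bounded_bilinear.continuous_on[OF bounded_bilinear_cscale]

section \<open>Calculus of holomorphic maps\<close>

text \<open>Keeps the differential explicit, so that derivatives are composed by rules and compared
  with \<open>frechet_derivative\<close> only at the end.\<close>

definition has_cderiv :: "('a::cvec \<Rightarrow> 'b::cvec) \<Rightarrow> ('a \<Rightarrow> 'b) \<Rightarrow> 'a \<Rightarrow> bool" where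
  "has_cderiv f D z \<longleftrightarrow> (f has_derivative D) (at z) \<and> (\<forall>c v. D (cscale c v) = cscale c (D v))"

lemma cholo_on_iff: "f cholo_on S \<longleftrightarrow> (\<forall>z\<in>S. \<exists>D. has_cderiv f D z)"
  by (simp add: cholo_on_def has_cderiv_def)

lemma cholo_onI: "(\<And>z. z \<in> S \<Longrightarrow> has_cderiv f (D z) z) \<Longrightarrow> f cholo_on S"
  unfolding cholo_on_iff by blast

lemma has_cderivD: "has_cderiv f D z \<Longrightarrow> (f has_derivative D) (at z)"
  "has_cderiv f D z \<Longrightarrow> D (cscale c v) = cscale c (D v)"
  by (auto simp: has_cderiv_def)

lemma has_cderiv_frechet: "has_cderiv f D z \<Longrightarrow> frechet_derivative f (at z) = D"
  using frechet_derivative_at has_cderivD(1) by metis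

lemma cholo_on_has_cderiv:
  "f cholo_on S \<Longrightarrow> z \<in> S \<Longrightarrow> has_cderiv f (frechet_derivative f (at z)) z"
  unfolding cholo_on_iff using has_cderiv_frechet by metis

lemma cholo_on_has_derivative:
  fixes f :: "'a::cvec \<Rightarrow> 'b::cvec"
  shows "f cholo_on S \<Longrightarrow> z \<in> S \<Longrightarrow> (f has_derivative frechet_derivative f (at z)) (at z)"
  using cholo_on_has_cderiv has_cderivD by blast

lemma cholo_on_subset: "f cholo_on S \<Longrightarrow> T \<subseteq> S \<Longrightarrow> f cholo_on T"
  unfolding cholo_on_def by blast

lemma has_cderiv_transform:
  "has_cderiv f D z \<Longrightarrow> open S \<Longrightarrow> z \<in> S \<Longrightarrow> (\<And>x. x \<in> S \<Longrightarrow> f x = g x) \<Longrightarrow> has_cderiv g D z"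
  unfolding has_cderiv_def using has_derivative_transform_within_open by blast

lemma cholo_on_cong:
  fixes f g :: "'a::cvec \<Rightarrow> 'b::cvec"
  shows "f cholo_on S \<Longrightarrow> open S \<Longrightarrow> (\<And>x. x \<in> S \<Longrightarrow> f x = g x) \<Longrightarrow> g cholo_on S"
  unfolding cholo_on_iff using has_cderiv_transform by metis

lemma cholo_on_continuous_on:
  fixes f :: "'a::cvec \<Rightarrow> 'b::cvec"
  assumes "f cholo_on S"
  shows "continuous_on S f"
proof (rule continuous_at_imp_continuous_on, rule ballI)
  fix z assume "z \<in> S"
  from has_derivative_continuous[OF cholo_on_has_derivative[OF assms this]] show "isCont f z" .
qed

lemma has_cderiv_clinear:
  assumes "bounded_linear L" "\<And>c v. L (cscale c v) = cscale c (L v)"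
  shows "has_cderiv L L z"
  using assms bounded_linear_imp_has_derivative unfolding has_cderiv_def by blast

lemma has_cderiv_const: "has_cderiv (\<lambda>z. k) (\<lambda>v. 0) z"
  by (simp add: has_cderiv_def)

lemma has_cderiv_compose:
  assumes "has_cderiv f D z" "has_cderiv g D' (f z)"
  shows "has_cderiv (\<lambda>z. g (f z)) (\<lambda>v. D' (D v)) z"
  unfolding has_cderiv_def
  using has_derivative_compose[OF has_cderivD(1)[OF assms(1)] has_cderivD(1)[OF assms(2)]]
    has_cderivD(2)[OF assms(1)] has_cderivD(2)[OF assms(2)] by simp

lemma has_cderiv_Pair:
  assumes "has_cderiv f D z" "has_cderiv g D' z"
  shows "has_cderiv (\<lambda>z. (f z, g z)) (\<lambda>v. (D v, D' v)) z"
  using assms unfolding has_cderiv_def by (auto intro!: derivative_eq_intros)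

lemma has_cderiv_add:
  assumes "has_cderiv f D z" "has_cderiv g D' z"
  shows "has_cderiv (\<lambda>z. f z + g z) (\<lambda>v. D v + D' v) z"
  using assms unfolding has_cderiv_def by (auto intro!: derivative_eq_intros simp: cscale_add_right)

lemma has_cderiv_diff:
  assumes "has_cderiv f D z" "has_cderiv g D' z"
  shows "has_cderiv (\<lambda>z. f z - g z) (\<lambda>v. D v - D' v) z"
  using assms unfolding has_cderiv_def by (auto intro!: derivative_eq_intros simp: cscale_diff_right)

lemma has_cderiv_minus:
  assumes "has_cderiv f D z"
  shows "has_cderiv (\<lambda>z. - f z) (\<lambda>v. - D v) z"
  using assms unfolding has_cderiv_def by (auto intro!: derivative_eq_intros simp: cscale_minus_right)

lemma has_cderiv_sum:
  assumes "\<And>i. i \<in> A \<Longrightarrow> has_cderiv (f i) (D i) z"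
  shows "has_cderiv (\<lambda>z. \<Sum>i\<in>A. f i z) (\<lambda>v. \<Sum>i\<in>A. D i v) z"
  using assms unfolding has_cderiv_def
  by (auto intro!: has_derivative_sum sum.cong simp: cscale_sum_right)

lemma has_cderiv_cscale:
  assumes "has_cderiv f D z" "has_cderiv g D' z"
  shows "has_cderiv (\<lambda>z. cscale (f z) (g z)) (\<lambda>v. cscale (f z) (D' v) + cscale (D v) (g z)) z"
  using assms bounded_bilinear.FDERIV[OF bounded_bilinear_cscale] unfolding has_cderiv_def
  by (auto simp: cscale_add_right cscale_cscale mult.commute)

lemma has_cderiv_mult:
  fixes f g :: "'a::cvec \<Rightarrow> complex"
  assumes "has_cderiv f D z" "has_cderiv g D' z"
  shows "has_cderiv (\<lambda>z. f z * g z) (\<lambda>v. f z * D' v + D v * g z) z"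
  using has_cderiv_cscale[OF assms] by simp

lemma has_cderiv_field:
  fixes f :: "'a::cvec \<Rightarrow> complex"
  assumes "has_cderiv f D z" "(g has_field_derivative g') (at (f z))"
  shows "has_cderiv (\<lambda>z. g (f z)) (\<lambda>v. g' * D v) z"
proof -
  have "has_cderiv g (\<lambda>v. g' * v) (f z)"
    using assms(2) unfolding has_field_derivative_def has_cderiv_def by simp
  from has_cderiv_compose[OF assms(1) this] show ?thesis .
qed

lemma has_cderiv_fst: "has_cderiv fst fst (z :: 'a::cvec \<times> 'b::cvec)"
  and has_cderiv_snd: "has_cderiv snd snd (z :: 'a::cvec \<times> 'b::cvec)"
  by (rule has_cderiv_clinear; simp add: bounded_linear_fst bounded_linear_snd)+

lemma has_cderiv_nth: "has_cderiv (\<lambda>v :: 'a::cvec ^ 'n. v $ i) (\<lambda>v. v $ i) z"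
  by (rule has_cderiv_clinear) (auto simp: bounded_linear_vec_nth)

lemma has_cderiv_vec:
  fixes f :: "'a::cvec \<Rightarrow> 'b::cvec ^ 'n"
  assumes "\<And>i. has_cderiv (\<lambda>z. f z $ i) (\<lambda>v. D v $ i) z"
  shows "has_cderiv f D z"
proof -
  have "(f has_derivative D) (at z)"
    unfolding has_derivative_componentwise_within[of f]
  proof
    fix b :: "'b ^ 'n" assume "b \<in> Basis"
    then obtain i u where b: "b = axis i u" by (auto simp: Basis_vec_def)
    have "((\<lambda>x. f x $ i) has_derivative (\<lambda>v. D v $ i)) (at z)" using assms has_cderivD by blast
    then show "((\<lambda>x. f x \<bullet> b) has_derivative (\<lambda>x. D x \<bullet> b)) (at z)"
      unfolding b inner_axis by (rule has_derivative_inner_left)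
  qed
  moreover have "D (cscale c v) = cscale c (D v)" for c v
    using assms has_cderivD(2) by (fastforce simp: vec_eq_iff)
  ultimately show ?thesis by (simp add: has_cderiv_def)
qed

section \<open>Closure properties of holomorphic maps\<close>

named_theorems cholo_intros

lemma cholo_const [cholo_intros]: "(\<lambda>z::'a::cvec. k :: 'b::cvec) cholo_on S"
  using has_cderiv_const unfolding cholo_on_iff by blast

lemma cholo_compose:
  fixes f :: "'a::cvec \<Rightarrow> 'b::cvec" and g :: "'b \<Rightarrow> 'c::cvec"
  assumes "g cholo_on T" "f cholo_on S" "\<And>z. z \<in> S \<Longrightarrow> f z \<in> T"
  shows "(\<lambda>z. g (f z)) cholo_on S"
  using assms has_cderiv_compose unfolding cholo_on_iff by metis

lemma cholo_clinear:
  fixes L :: "'a::cvec \<Rightarrow> 'b::cvec"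
  assumes "bounded_linear L" "\<And>c v. L (cscale c v) = cscale c (L v)"
  shows "L cholo_on S"
  using has_cderiv_clinear[OF assms] unfolding cholo_on_iff by blast

lemma cholo_id [cholo_intros]: "(\<lambda>z::'a::cvec. z) cholo_on S"
  by (rule cholo_clinear) (auto simp: bounded_linear_ident)

lemma cholo_fst [cholo_intros]:
  fixes f :: "'a::cvec \<Rightarrow> 'b::cvec \<times> 'c::cvec"
  shows "f cholo_on S \<Longrightarrow> (\<lambda>z. fst (f z)) cholo_on S"
  unfolding cholo_on_iff using has_cderiv_compose[OF _ has_cderiv_fst] by blast

lemma cholo_snd [cholo_intros]:
  fixes f :: "'a::cvec \<Rightarrow> 'b::cvec \<times> 'c::cvec"
  shows "f cholo_on S \<Longrightarrow> (\<lambda>z. snd (f z)) cholo_on S"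
  unfolding cholo_on_iff using has_cderiv_compose[OF _ has_cderiv_snd] by blast

lemma cholo_nth [cholo_intros]:
  fixes f :: "'a::cvec \<Rightarrow> 'b::cvec ^ 'n"
  shows "f cholo_on S \<Longrightarrow> (\<lambda>z. f z $ i) cholo_on S"
  unfolding cholo_on_iff using has_cderiv_compose[OF _ has_cderiv_nth] by blast

lemma cholo_Pair [cholo_intros]:
  fixes f :: "'a::cvec \<Rightarrow> 'b::cvec" and g :: "'a \<Rightarrow> 'c::cvec"
  shows "f cholo_on S \<Longrightarrow> g cholo_on S \<Longrightarrow> (\<lambda>z. (f z, g z)) cholo_on S"
  unfolding cholo_on_iff using has_cderiv_Pair by blast

lemma cholo_vec [cholo_intros]:
  fixes f :: "'n::finite \<Rightarrow> 'a::cvec \<Rightarrow> 'b::cvec"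
  assumes "\<And>i. f i cholo_on S"
  shows "(\<lambda>z. \<chi> i. f i z) cholo_on S"
proof (rule cholo_onI)
  fix z assume "z \<in> S"
  then show "has_cderiv (\<lambda>z. \<chi> i. f i z) (\<lambda>v. \<chi> i. frechet_derivative (f i) (at z) v) z"
    by (intro has_cderiv_vec) (simp add: cholo_on_has_cderiv[OF assms] eta_contract_eq)
qed

lemma cholo_add [cholo_intros]:
  fixes f g :: "'a::cvec \<Rightarrow> 'b::cvec"
  shows "f cholo_on S \<Longrightarrow> g cholo_on S \<Longrightarrow> (\<lambda>z. f z + g z) cholo_on S"
  unfolding cholo_on_iff using has_cderiv_add by blast

lemma cholo_diff [cholo_intros]:
  fixes f g :: "'a::cvec \<Rightarrow> 'b::cvec"
  shows "f cholo_on S \<Longrightarrow> g cholo_on S \<Longrightarrow> (\<lambda>z. f z - g z) cholo_on S"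
  unfolding cholo_on_iff using has_cderiv_diff by blast

lemma cholo_minus [cholo_intros]:
  fixes f :: "'a::cvec \<Rightarrow> 'b::cvec"
  shows "f cholo_on S \<Longrightarrow> (\<lambda>z. - f z) cholo_on S"
  unfolding cholo_on_iff using has_cderiv_minus by blast

lemma cholo_cscale [cholo_intros]:
  fixes g :: "'a::cvec \<Rightarrow> 'b::cvec"
  shows "f cholo_on S \<Longrightarrow> g cholo_on S \<Longrightarrow> (\<lambda>z. cscale (f z) (g z)) cholo_on S"
  unfolding cholo_on_iff using has_cderiv_cscale by blast

lemma cholo_mult [cholo_intros]:
  fixes f g :: "'a::cvec \<Rightarrow> complex"
  shows "f cholo_on S \<Longrightarrow> g cholo_on S \<Longrightarrow> (\<lambda>z. f z * g z) cholo_on S"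
  unfolding cholo_on_iff using has_cderiv_mult by blast

lemma cholo_sum [cholo_intros]:
  fixes f :: "'i \<Rightarrow> 'a::cvec \<Rightarrow> 'b::cvec"
  assumes "\<And>i. i \<in> A \<Longrightarrow> f i cholo_on S"
  shows "(\<lambda>z. \<Sum>i\<in>A. f i z) cholo_on S"
proof (rule cholo_onI)
  fix z assume "z \<in> S"
  then show "has_cderiv (\<lambda>z. \<Sum>i\<in>A. f i z) (\<lambda>v. \<Sum>i\<in>A. frechet_derivative (f i) (at z) v) z"
    using assms by (intro has_cderiv_sum cholo_on_has_cderiv)
qed

lemma cholo_power [cholo_intros]:
  fixes f :: "'a::cvec \<Rightarrow> complex"
  shows "f cholo_on S \<Longrightarrow> (\<lambda>z. f z ^ n) cholo_on S"
  by (induction n) (auto intro!: cholo_intros)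

lemma cholo_field:
  fixes f :: "'a::cvec \<Rightarrow> complex"
  assumes "f cholo_on S" "\<And>z. z \<in> S \<Longrightarrow> (g has_field_derivative g' z) (at (f z))"
  shows "(\<lambda>z. g (f z)) cholo_on S"
  using assms has_cderiv_field unfolding cholo_on_iff by metis

lemma cholo_divide [cholo_intros]:
  fixes f g :: "'a::cvec \<Rightarrow> complex"
  assumes "f cholo_on S" "g cholo_on S" "\<And>z. z \<in> S \<Longrightarrow> g z \<noteq> 0"
  shows "(\<lambda>z. f z / g z) cholo_on S"
proof -
  have "(\<lambda>z. inverse (g z)) cholo_on S"
    by (rule cholo_field[OF assms(2)]) (rule derivative_eq_intros refl | use assms(3) in blast)+
  from cholo_mult[OF assms(1) this] show ?thesis by (simp add: divide_inverse)
qed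

lemma cholo_local:
  fixes f :: "'a::cvec \<Rightarrow> 'b::cvec"
  assumes "\<And>z. z \<in> S \<Longrightarrow> \<exists>T g. open T \<and> z \<in> T \<and> g cholo_on T \<and> (\<forall>x\<in>T. g x = f x)"
  shows "f cholo_on S"
  unfolding cholo_on_iff
proof
  fix z assume "z \<in> S"
  then obtain T g where "open T" "z \<in> T" "g cholo_on T" "\<forall>x\<in>T. g x = f x" using assms by blast
  then show "\<exists>D. has_cderiv f D z"
    using cholo_on_has_cderiv has_cderiv_transform by blast
qed

lemma clinear_frechet:
  fixes f :: "'a::cvec \<Rightarrow> complex"
  assumes "f cholo_on S" "z \<in> S"
  shows "frechet_derivative f (at z) (cscale c v) = c * frechet_derivative f (at z) v"
  using has_cderivD(2)[OF cholo_on_has_cderiv[OF assms]] by simp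

lemma bounded_linear_frechet:
  fixes f :: "'a::cvec \<Rightarrow> 'b::cvec"
  shows "f cholo_on S \<Longrightarrow> z \<in> S \<Longrightarrow> bounded_linear (frechet_derivative f (at z))"
  using cholo_on_has_derivative has_derivative_bounded_linear by blast

text \<open>Restriction to a complex line is the bridge from several variables to one-variable
  complex analysis.\<close>

lemma has_field_derivative_line:
  fixes f :: "'a::cvec \<Rightarrow> complex"
  assumes "f cholo_on S" "z + cscale \<zeta> v \<in> S"
  shows "((\<lambda>\<zeta>. f (z + cscale \<zeta> v)) has_field_derivative
     frechet_derivative f (at (z + cscale \<zeta> v)) v) (at \<zeta>)"
proof -
  let ?D = "frechet_derivative f (at (z + cscale \<zeta> v))"
  have l: "has_cderiv (\<lambda>\<zeta>. cscale \<zeta> v) (\<lambda>\<zeta>. cscale \<zeta> v) \<zeta>"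
    using has_cderiv_cscale[OF has_cderiv_clinear[OF bounded_linear_ident] has_cderiv_const[of v], of \<zeta>]
    by simp
  have "has_cderiv (\<lambda>\<zeta>. z + cscale \<zeta> v) (\<lambda>\<zeta>. cscale \<zeta> v) \<zeta>"
    using has_cderiv_add[OF has_cderiv_const[of z] l] by simp
  from has_cderiv_compose[OF this cholo_on_has_cderiv[OF assms]]
  have "((\<lambda>\<zeta>. f (z + cscale \<zeta> v)) has_derivative (\<lambda>\<zeta>. ?D (cscale \<zeta> v))) (at \<zeta>)"
    using has_cderivD by blast
  moreover have "(\<lambda>\<zeta>. ?D (cscale \<zeta> v)) = (\<lambda>\<zeta>. ?D v * \<zeta>)"
    using clinear_frechet[OF assms] by (simp add: mult.commute fun_eq_iff)
  ultimately show ?thesis unfolding has_field_derivative_def by simp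
qed

section \<open>Cauchy's formula for directional derivatives\<close>

text \<open>Cauchy's formula for the first derivative, on a circle in the complex line through
  \<open>z\<close> in direction \<open>v\<close>. The derivative becomes an integral of values of
  \<open>f\<close>, so its regularity in \<open>z\<close> follows from that of
  \<open>f\<close>.\<close>

lemma Cauchy_directional:
  fixes f :: "'a::cvec \<Rightarrow> complex"
  assumes f: "f cholo_on S" and \<rho>: "\<rho> > 0"
    and S: "\<And>\<zeta>. norm \<zeta> \<le> \<rho> \<Longrightarrow> z + cscale \<zeta> v \<in> S"
  shows "frechet_derivative f (at z) v =
    integral {0..1} (\<lambda>\<theta>. exp (- (2 * of_real pi * \<i> * of_real \<theta>)) / of_real \<rho> *
       f (z + cscale (of_real \<rho> * exp (2 * of_real pi * \<i> * of_real \<theta>)) v))"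
proof -
  let ?\<phi> = "\<lambda>\<zeta>. f (z + cscale \<zeta> v)"
  let ?e = "\<lambda>\<theta>. exp (2 * of_real pi * \<i> * of_real \<theta>) :: complex"
  have d: "(?\<phi> has_field_derivative frechet_derivative f (at (z + cscale \<zeta> v)) v) (at \<zeta>)"
    if "norm \<zeta> \<le> \<rho>" for \<zeta>
    by (rule has_field_derivative_line[OF f S[OF that]])
  have c: "continuous_on (cball 0 \<rho>) ?\<phi>"
    by (intro continuous_at_imp_continuous_on ballI DERIV_isCont[OF d]) simp
  have h: "?\<phi> holomorphic_on ball 0 \<rho>"
    unfolding holomorphic_on_def field_differentiable_def
  proof
    fix \<zeta> :: complex assume "\<zeta> \<in> ball 0 \<rho>"
    then have "norm \<zeta> \<le> \<rho>" by simp
    from has_field_derivative_at_within[OF d[OF this]]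
    show "\<exists>f'. (?\<phi> has_field_derivative f') (at \<zeta> within ball 0 \<rho>)" by blast
  qed
  have "(?\<phi> has_field_derivative 1 / (2 * of_real pi * \<i>) *
      contour_integral (circlepath 0 \<rho>) (\<lambda>u. ?\<phi> u / (u - 0)\<^sup>2)) (at 0)"
    using Cauchy_derivative_integral_circlepath(2)[OF c h, of 0] \<rho> by simp
  moreover have "(?\<phi> has_field_derivative frechet_derivative f (at z) v) (at 0)"
    using d[of 0] \<rho> by simp
  ultimately have "frechet_derivative f (at z) v = 1 / (2 * of_real pi * \<i>) *
      contour_integral (circlepath 0 \<rho>) (\<lambda>u. ?\<phi> u / (u - 0)\<^sup>2)"
    using DERIV_unique by blast
  also have "\<dots> = 1 / (2 * of_real pi * \<i>) * integral {0..1} (\<lambda>\<theta>. (2 * of_real pi * \<i>) *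
      (exp (- (2 * of_real pi * \<i> * of_real \<theta>)) / of_real \<rho> * ?\<phi> (of_real \<rho> * ?e \<theta>)))"
    unfolding contour_integral_integral
    using \<rho> by (intro arg_cong[where f = "\<lambda>x. _ * x"] integral_cong)
      (simp only: vector_derivative_circlepath, simp add: circlepath exp_minus field_simps power2_eq_square)
  finally show ?thesis by simp
qed

lemma circle_neighbourhood:
  fixes S :: "'a::cvec set"
  assumes "open S" "z0 \<in> S"
  obtains \<rho> e where "\<rho> > 0" "e > 0"
    "\<And>z \<zeta>. z \<in> ball z0 e \<Longrightarrow> norm \<zeta> \<le> \<rho> \<Longrightarrow> z + cscale \<zeta> v \<in> S"
proof -
  obtain e where e: "e > 0" "ball z0 e \<subseteq> S" using assms open_contains_ball by blast
  obtain K where K: "K > 0" "\<And>c (v::'a). norm (cscale c v) \<le> norm c * norm v * K"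
    using bounded_bilinear.pos_bounded[OF bounded_bilinear_cscale] by blast
  \<comment> \<open>Makes the shift by \<open>cscale \<zeta> v\<close> at most \<open>e / 2\<close>,
    the other half of \<open>e\<close> being left for the base point; the \<open>+ 1\<close> covers
    \<open>v = 0\<close>.\<close>
  define \<rho> where "\<rho> = e / (2 * ((norm v + 1) * K))"
  have \<rho>: "\<rho> > 0" unfolding \<rho>_def using e K by (simp add: add_nonneg_pos)
  show ?thesis
  proof (rule that[of \<rho> "e/2"])
    show "\<rho> > 0" by fact
    fix z \<zeta> assume z: "z \<in> ball z0 (e/2)" and \<zeta>: "norm (\<zeta>::complex) \<le> \<rho>"
    have "norm (cscale \<zeta> v) \<le> norm \<zeta> * norm v * K" by (rule K)
    also have "\<dots> \<le> \<rho> * ((norm v + 1) * K)"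
      unfolding mult.assoc using \<zeta> K(1) \<rho> by (intro mult_mono) auto
    also have "\<dots> = e / 2" unfolding \<rho>_def using K(1) by (simp add: add_nonneg_eq_0_iff) 
    finally have "norm (cscale \<zeta> v) \<le> e/2" .
    then have "dist z0 (z + cscale \<zeta> v) < e"
      using z dist_triangle[of z0 "z + cscale \<zeta> v" z] by (simp add: dist_norm)
    then show "z + cscale \<zeta> v \<in> S" using e by auto
  qed (use e in auto)
qed

text \<open>\<open>cholo_on\<close> asks only for a derivative at each point; its continuity comes
  from Cauchy's formula, as a parameter integral with continuous integrand.\<close>

lemma continuous_on_frechet_apply:
  fixes f :: "'a::cvec \<Rightarrow> complex"
  assumes f: "f cholo_on S" and S: "open S"
  shows "continuous_on S (\<lambda>z. frechet_derivative f (at z) v)"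
proof (rule continuous_at_imp_continuous_on, rule ballI)
  fix z0 assume "z0 \<in> S"
  then obtain \<rho> e where \<rho>: "\<rho> > 0" and e: "e > 0" and
    n: "\<And>z \<zeta>. z \<in> ball z0 e \<Longrightarrow> norm \<zeta> \<le> \<rho> \<Longrightarrow> z + cscale \<zeta> v \<in> S"
    using circle_neighbourhood[OF S] by metis
  let ?I = "\<lambda>z. integral (cbox 0 (1::real)) (\<lambda>\<theta>. exp (- (2 * of_real pi * \<i> * of_real \<theta>)) / of_real \<rho> *
       f (z + cscale (of_real \<rho> * exp (2 * of_real pi * \<i> * of_real \<theta>)) v))"
  have "continuous_on (ball z0 e) ?I"
  proof (rule integral_continuous_on_param)
    have "norm (of_real \<rho> * exp (2 * of_real pi * \<i> * of_real \<theta>) :: complex) \<le> \<rho>" for \<theta> :: real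
      using \<rho> by (simp add: norm_mult norm_exp_eq_Re)
    then have "continuous_on (ball z0 e \<times> cbox 0 1)
      (\<lambda>x. f (fst x + cscale (of_real \<rho> * exp (2 * of_real pi * \<i> * of_real (snd x))) v))"
      by (intro continuous_on_compose2[OF cholo_on_continuous_on[OF f]] continuous_intros)
        (auto intro!: n)
    then show "continuous_on (ball z0 e \<times> cbox 0 1)
      (\<lambda>(z, \<theta>). exp (- (2 * of_real pi * \<i> * of_real \<theta>)) / of_real \<rho> *
       f (z + cscale (of_real \<rho> * exp (2 * of_real pi * \<i> * of_real \<theta>)) v))"
      unfolding split_def using \<rho> by (intro continuous_intros) auto
  qed
  moreover have "frechet_derivative f (at z) v = ?I z" if "z \<in> ball z0 e" for z
    using Cauchy_directional[OF f \<rho> n[OF that]] by simp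
  ultimately have "continuous_on (ball z0 e) (\<lambda>z. frechet_derivative f (at z) v)"
    using continuous_on_cong by (metis (no_types, lifting))
  then show "isCont (\<lambda>z. frechet_derivative f (at z) v) z0"
    using e by (simp add: continuous_on_eq_continuous_at)
qed

text \<open>Point and vector vary together, so continuity in operator norm is needed; in finite
  dimension it follows from that of the directional derivatives.\<close>

lemma continuous_on_frechet:
  fixes f :: "'a::cvec \<Rightarrow> complex"
  assumes f: "f cholo_on S" and S: "open S"
    and g: "continuous_on T g" "g ` T \<subseteq> S" and h: "continuous_on T h"
  shows "continuous_on T (\<lambda>t. frechet_derivative f (at (g t)) (h t))"
proof -
  have "continuous_on S (\<lambda>z. Blinfun (frechet_derivative f (at z)))"
  proof (rule continuous_on_blinfun_componentwise)
    fix i :: 'a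
    have "continuous_on S (\<lambda>z. frechet_derivative f (at z) i)"
      by (rule continuous_on_frechet_apply[OF f S])
    then show "continuous_on S (\<lambda>z. blinfun_apply (Blinfun (frechet_derivative f (at z))) i)"
      by (rule continuous_on_eq) (simp add: bounded_linear_Blinfun_apply[OF bounded_linear_frechet[OF f]])
  qed
  from continuous_on_compose2[OF this g]
  have "continuous_on T (\<lambda>t. blinfun_apply (Blinfun (frechet_derivative f (at (g t)))) (h t))"
    using h by (intro continuous_intros)
  then show ?thesis
    by (rule continuous_on_eq) (use g in \<open>auto simp: bounded_linear_Blinfun_apply[OF bounded_linear_frechet[OF f]]\<close>)
qed

text \<open>Differentiation under the integral sign; the differential inherits complex linearity
  from the integrand. It serves Cauchy's formula, where \<open>\<Lambda>\<close> translates, and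
  division by a coordinate, where \<open>\<Lambda>\<close> scales.\<close>

lemma cholo_on_param_integral:
  fixes f :: "'a::cvec \<Rightarrow> complex" and \<Lambda> :: "real \<Rightarrow> 'b::cvec \<Rightarrow> 'a"
  assumes f: "f cholo_on S" and S: "open S" and U: "open U" "convex U"
    and \<Lambda>: "\<And>\<theta> z. \<theta> \<in> {0..1} \<Longrightarrow> z \<in> U \<Longrightarrow> has_cderiv (\<Lambda> \<theta>) (L \<theta>) z \<and> \<Lambda> \<theta> z \<in> S"
    and c\<Lambda>: "continuous_on (U \<times> {0..1}) (\<lambda>(z, \<theta>). \<Lambda> \<theta> z)"
    and cL: "\<And>w. continuous_on {0..1} (\<lambda>\<theta>. L \<theta> w)"
    and k: "continuous_on {0..1} k"
  shows "(\<lambda>z. integral {0..1} (\<lambda>\<theta>. k \<theta> * f (\<Lambda> \<theta> z))) cholo_on U"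
proof (rule cholo_onI)
  fix z0 assume z0: "z0 \<in> U"
  let ?D = "\<lambda>z \<theta> w. k \<theta> * frechet_derivative f (at (\<Lambda> \<theta> z)) (L \<theta> w)"
  let ?fx = "\<lambda>z \<theta>. Blinfun (?D z \<theta>)"
  have cd: "has_cderiv (\<lambda>z. k \<theta> * f (\<Lambda> \<theta> z)) (?D z \<theta>) z" if "\<theta> \<in> {0..1}" "z \<in> U" for z \<theta>
    using has_cderiv_mult[OF has_cderiv_const[of "k \<theta>"]
        has_cderiv_compose[OF conjunct1[OF \<Lambda>[OF that]] cholo_on_has_cderiv[OF f]]] \<Lambda>[OF that] by simp
  then have bl: "bounded_linear (?D z \<theta>)" if "\<theta> \<in> {0..1}" "z \<in> U" for z \<theta>
    using that has_cderivD(1) has_derivative_bounded_linear by blast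
  have cf: "continuous_on (U \<times> {0..1}) (\<lambda>x. f (\<Lambda> (snd x) (fst x)))"
    using c\<Lambda> \<Lambda> by (intro continuous_on_compose2[OF cholo_on_continuous_on[OF f]])
      (auto simp: split_def)
  have cfx: "continuous_on (U \<times> {0..1}) (\<lambda>x. ?fx (fst x) (snd x))"
  proof (rule continuous_on_blinfun_componentwise)
    fix i :: 'b
    have "continuous_on (U \<times> {0..1}) (\<lambda>x. ?D (fst x) (snd x) i)"
      using c\<Lambda> \<Lambda> 
      by (intro continuous_intros continuous_on_frechet[OF f S] continuous_on_compose2[OF k]
          continuous_on_compose2[OF cL]) (auto simp: split_def)
    then show "continuous_on (U \<times> {0..1}) (\<lambda>x. blinfun_apply (?fx (fst x) (snd x)) i)"
      by (rule continuous_on_eq) (use bl in \<open>auto simp: bounded_linear_Blinfun_apply\<close>)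
  qed
  have iD: "?fx z0 integrable_on cbox 0 1"
  proof (rule integrable_continuous)
    show "continuous_on (cbox 0 1) (?fx z0)"
    proof -
      have "continuous_on {0..1::real} (\<lambda>\<theta>. (z0, \<theta>))" by (intro continuous_intros)
      from continuous_on_compose2[OF cfx this] show ?thesis using z0 by auto
    qed
  qed
  have "((\<lambda>z. integral (cbox 0 1) (\<lambda>\<theta>. k \<theta> * f (\<Lambda> \<theta> z))) has_derivative
      blinfun_apply (integral (cbox 0 1) (?fx z0))) (at z0 within U)"
  proof (rule leibniz_rule[where U = U])
    show "((\<lambda>z. k \<theta> * f (\<Lambda> \<theta> z)) has_derivative blinfun_apply (?fx z \<theta>)) (at z within U)"
      if "z \<in> U" "\<theta> \<in> cbox 0 1" for z \<theta>
      using has_cderivD(1)[OF cd] that bl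
      by (auto simp: bounded_linear_Blinfun_apply intro: has_derivative_at_withinI)
    show "(\<lambda>\<theta>. k \<theta> * f (\<Lambda> \<theta> z)) integrable_on cbox 0 1" if "z \<in> U" for z
    proof -
      have "continuous_on {0..1::real} (\<lambda>\<theta>. (z, \<theta>))" by (intro continuous_intros)
      from continuous_on_compose2[OF cf this] have "continuous_on {0..1} (\<lambda>\<theta>. f (\<Lambda> \<theta> z))"
        using that by auto
      from continuous_on_mult[OF k this] show ?thesis
        using integrable_continuous_interval by simp
    qed
    show "continuous_on (U \<times> cbox 0 1) (\<lambda>(z, \<theta>). ?fx z \<theta>)" using cfx by (simp add: split_def)
  qed (use z0 U in auto)
  then have d: "((\<lambda>z. integral {0..1} (\<lambda>\<theta>. k \<theta> * f (\<Lambda> \<theta> z))) has_derivative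
      blinfun_apply (integral {0..1} (?fx z0))) (at z0)"
    unfolding at_within_open[OF z0 U(1)] box_real(2) .
  have ap: "blinfun_apply (integral {0..1} (?fx z0)) w = integral {0..1} (\<lambda>\<theta>. ?D z0 \<theta> w)" for w
  proof -
    have "blinfun_apply (integral {0..1} (?fx z0)) w = integral {0..1} (\<lambda>\<theta>. blinfun_apply (?fx z0 \<theta>) w)"
      using blinfun_apply_integral[OF iD] unfolding box_real(2) .
    also have "\<dots> = integral {0..1} (\<lambda>\<theta>. ?D z0 \<theta> w)"
      using bl[OF _ z0] by (intro integral_cong) (auto simp: bounded_linear_Blinfun_apply)
    finally show ?thesis .
  qed
  have "blinfun_apply (integral {0..1} (?fx z0)) (cscale c w) =
      c * blinfun_apply (integral {0..1} (?fx z0)) w" for c w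
  proof -
    have "integral {0..1} (\<lambda>\<theta>. ?D z0 \<theta> (cscale c w)) = integral {0..1} (\<lambda>\<theta>. c * ?D z0 \<theta> w)"
      using has_cderivD(2)[OF cd[OF _ z0]] by (intro integral_cong) simp
    then show ?thesis unfolding ap by simp
  qed
  with d show "has_cderiv (\<lambda>z. integral {0..1} (\<lambda>\<theta>. k \<theta> * f (\<Lambda> \<theta> z)))
      (blinfun_apply (integral {0..1} (?fx z0))) z0"
    by (simp add: has_cderiv_def)
qed

text \<open>Cauchy's formula again, now differentiated under the integral.\<close>

lemma cholo_frechet_apply:
  fixes f :: "'a::cvec \<Rightarrow> complex"
  assumes f: "f cholo_on S" and S: "open S"
  shows "(\<lambda>z. frechet_derivative f (at z) v) cholo_on S"
proof (rule cholo_local)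
  fix z0 assume "z0 \<in> S"
  then obtain \<rho> e where \<rho>: "\<rho> > 0" and e: "e > 0" and
    n: "\<And>z \<zeta>. z \<in> ball z0 e \<Longrightarrow> norm \<zeta> \<le> \<rho> \<Longrightarrow> z + cscale \<zeta> v \<in> S"
    using circle_neighbourhood[OF S] by metis
  let ?w = "\<lambda>\<theta>::real. cscale (of_real \<rho> * exp (2 * of_real pi * \<i> * of_real \<theta>)) v"
  have nm: "norm (of_real \<rho> * exp (2 * of_real pi * \<i> * of_real \<theta>) :: complex) \<le> \<rho>" for \<theta> :: real
    using \<rho> by (simp add: norm_mult norm_exp_eq_Re)
  have "(\<lambda>z. integral {0..1} (\<lambda>\<theta>. exp (- (2 * of_real pi * \<i> * of_real \<theta>)) / of_real \<rho> *
       f (z + ?w \<theta>))) cholo_on ball z0 e"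
  proof (rule cholo_on_param_integral[where L = "\<lambda>_ w. w", OF f S])
    show "has_cderiv (\<lambda>z. z + ?w \<theta>) (\<lambda>w. w) z \<and> z + ?w \<theta> \<in> S" if "z \<in> ball z0 e" for \<theta> z
      using has_cderiv_add[OF has_cderiv_clinear[OF bounded_linear_ident] has_cderiv_const[of "?w \<theta>"]]
        n[OF that nm] by simp
  qed (use \<rho> in \<open>auto intro!: continuous_intros simp: split_def\<close>)
  then have "(\<lambda>z. frechet_derivative f (at z) v) cholo_on ball z0 e"
    by (rule cholo_on_cong) (use Cauchy_directional[OF f \<rho> n] in auto)
  then show "\<exists>T g. open T \<and> z0 \<in> T \<and> g cholo_on T \<and>
      (\<forall>x\<in>T. g x = frechet_derivative f (at x) v)"
    using e by (intro exI[of _ "ball z0 e"] exI[of _ "\<lambda>z. frechet_derivative f (at z) v"] conjI ballI) auto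
qed

lemma frechet_apply_Basis:
  fixes f :: "'a::cvec \<Rightarrow> complex"
  assumes "f cholo_on S" "z \<in> S"
  shows "frechet_derivative f (at z) v = (\<Sum>b\<in>Basis. (v \<bullet> b) *\<^sub>R frechet_derivative f (at z) b)"
proof -
  interpret bounded_linear "frechet_derivative f (at z)" by (rule bounded_linear_frechet[OF assms])
  have "frechet_derivative f (at z) v = frechet_derivative f (at z) (\<Sum>b\<in>Basis. (v \<bullet> b) *\<^sub>R b)"
    by (simp add: euclidean_representation)
  then show ?thesis by (simp add: sum scaleR)
qed

lemma cholo_vderiv:
  fixes f :: "'a::cvec \<Rightarrow> complex" and V :: "'a \<Rightarrow> 'a"
  assumes f: "f cholo_on S" and S: "open S" and V: "V cholo_on S"
  shows "vderiv V f cholo_on S"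
proof (rule cholo_onI)
  fix z assume z: "z \<in> S"
  let ?F = "\<lambda>z. frechet_derivative f (at z)"
  let ?DV = "frechet_derivative V (at z)"
  let ?D2 = "\<lambda>b. frechet_derivative (\<lambda>z. ?F z b) (at z)"
  note V' = cholo_on_has_cderiv[OF V z]
  note D2 = cholo_on_has_cderiv[OF cholo_frechet_apply[OF f S] z]
  have "((\<lambda>z. \<Sum>b\<in>Basis. (V z \<bullet> b) *\<^sub>R ?F z b) has_derivative
      (\<lambda>w. \<Sum>b\<in>Basis. (V z \<bullet> b) *\<^sub>R ?D2 b w + (?DV w \<bullet> b) *\<^sub>R ?F z b)) (at z)"
    by (intro has_derivative_sum has_derivative_scaleR has_derivative_inner_left
        has_cderivD(1)[OF V'] has_cderivD(1)[OF D2])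
  then have "(vderiv V f has_derivative
      (\<lambda>w. \<Sum>b\<in>Basis. (V z \<bullet> b) *\<^sub>R ?D2 b w + (?DV w \<bullet> b) *\<^sub>R ?F z b)) (at z)"
    by (rule has_derivative_transform_within_open[OF _ S z])
      (simp add: vderiv_def frechet_apply_Basis[OF f])
  \<comment> \<open>The coefficients \<open>?DV w \<bullet> b\<close> are only real linear in
    \<open>w\<close>; complex linearity becomes visible once these terms are collected into
    \<open>?F z (?DV w)\<close>.\<close>
  moreover have "(\<lambda>w. \<Sum>b\<in>Basis. (V z \<bullet> b) *\<^sub>R ?D2 b w + (?DV w \<bullet> b) *\<^sub>R ?F z b) =
     (\<lambda>w. (\<Sum>b\<in>Basis. (V z \<bullet> b) *\<^sub>R ?D2 b w) + ?F z (?DV w))" (is "_ = ?D")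
    by (simp add: frechet_apply_Basis[OF f z, of "?DV _"] sum.distrib)
  ultimately have "(vderiv V f has_derivative ?D) (at z)" by simp
  moreover have "?D (cscale c w) = cscale c (?D w)" for c w
    using has_cderivD(2)[OF V'] has_cderivD(2)[OF D2] clinear_frechet[OF f z]
    by (simp add: sum_distrib_left algebra_simps)
  ultimately show "has_cderiv (vderiv V f) ?D z" by (simp add: has_cderiv_def)
qed

section \<open>Division by a coordinate\<close>

text \<open>On the hyperplane \<open>fst z = 0\<close> the value is the limit of the quotient, for
  functions that vanish there.\<close>

definition div_fst :: "(complex \<times> 'b::cvec \<Rightarrow> complex) \<Rightarrow> complex \<times> 'b \<Rightarrow> complex" where
  "div_fst f z = (if fst z = 0 then frechet_derivative f (at z) (1, 0) else f z / fst z)"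

text \<open>Hadamard's lemma: near the hyperplane, \<open>f z\<close> is \<open>fst z\<close> times
  the mean of the first partial derivative over the segment from \<open>(0, snd z)\<close> to
  \<open>z\<close>.\<close>

lemma cholo_div_fst:
  fixes f :: "complex \<times> 'b::cvec \<Rightarrow> complex"
  assumes f: "f cholo_on S" and S: "open S" and 0: "\<And>s. (0, s) \<in> S \<Longrightarrow> f (0, s) = 0"
  shows "div_fst f cholo_on S"
proof (rule cholo_local)
  fix z0 assume z0: "z0 \<in> S"
  show "\<exists>T g. open T \<and> z0 \<in> T \<and> g cholo_on T \<and> (\<forall>x\<in>T. g x = div_fst f x)"
  proof (cases "fst z0 = 0")
    case False
    let ?T = "S \<inter> {z. fst z \<noteq> 0}"
    have "open ?T" using S by (intro open_Int open_Collect_neq continuous_intros)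
    moreover have "(\<lambda>z. f z / fst z) cholo_on ?T"
      by (intro cholo_intros cholo_on_subset[OF f]) auto
    ultimately show ?thesis using False z0
      by (intro exI[of _ ?T] exI[of _ "\<lambda>z. f z / fst z"]) (auto simp: div_fst_def)
  next
    case True
    obtain e where e: "e > 0" "ball z0 e \<subseteq> S" using S z0 open_contains_ball by blast
    let ?B = "ball z0 e"
    let ?g = "\<lambda>z. frechet_derivative f (at z) (1, 0)"
    let ?\<Lambda> = "\<lambda>t::real. \<lambda>z. (of_real t * fst z, snd z) :: complex \<times> 'b"
    \<comment> \<open>\<open>z0\<close> lies on the hyperplane, so shrinking the first coordinate of
      \<open>z\<close> does not increase its distance from \<open>z0\<close>.\<close>
    have inB: "?\<Lambda> t z \<in> ?B" if t: "t \<in> {0..1}" and z: "z \<in> ?B" for t z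
    proof -
      have "norm (z0 - ?\<Lambda> t z) \<le> norm (z0 - z)"
        unfolding norm_prod_def using True t
        by (auto intro!: real_sqrt_le_mono add_right_mono power_mono simp: norm_mult mult_left_le_one_le)
      then show ?thesis using z by (simp add: dist_norm)
    qed
    have L: "has_cderiv (?\<Lambda> t) (?\<Lambda> t) z" for t z
      by (rule has_cderiv_clinear)
        (auto intro!: bounded_linear_Pair bounded_linear_snd
          bounded_linear_compose[OF bounded_linear_mult_right bounded_linear_fst])
    have "(\<lambda>z. integral {0..1} (\<lambda>t. 1 * ?g (?\<Lambda> t z))) cholo_on ?B"
      by (rule cholo_on_param_integral[where L = ?\<Lambda>, OF cholo_frechet_apply[OF f S] S])
        (use inB e L in \<open>auto intro!: continuous_intros simp: split_def\<close>)
    then have "div_fst f cholo_on ?B"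
    proof (rule cholo_on_cong)
      fix z assume z: "z \<in> ?B"
      show "integral {0..1} (\<lambda>t. 1 * ?g (?\<Lambda> t z)) = div_fst f z"
      proof -
      have S': "?\<Lambda> t z \<in> S" if "t \<in> {0..1}" for t using inB[OF that z] e by blast
      have "((\<lambda>t. fst z * ?g (?\<Lambda> t z)) has_integral f (?\<Lambda> 1 z) - f (?\<Lambda> 0 z)) {0..1}"
      proof (rule fundamental_theorem_of_calculus)
        fix t :: real assume t: "t \<in> {0..1}"
        have e1: "cscale (of_real t * fst z) (1, 0) = (of_real t * fst z, 0 :: 'b)" by simp
        have "((\<lambda>\<zeta>. f ((0, snd z) + cscale \<zeta> (1, 0))) has_field_derivative ?g (?\<Lambda> t z))
            (at (of_real t * fst z))"
          using has_field_derivative_line[OF f, of "(0, snd z)" "of_real t * fst z" "(1, 0)"] S'[OF t]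
          unfolding e1 by simp
        moreover have "((\<lambda>t. of_real t * fst z) has_vector_derivative fst z) (at t within {0..1})"
          by (auto intro!: derivative_eq_intros simp: has_vector_derivative_def scaleR_conv_of_real)
        ultimately have "((\<lambda>\<zeta>. f ((0, snd z) + cscale \<zeta> (1, 0))) \<circ> (\<lambda>t. of_real t * fst z) has_vector_derivative
            fst z * ?g (?\<Lambda> t z)) (at t within {0..1})"
          using field_vector_diff_chain_within has_field_derivative_at_within by blast
        then show "((\<lambda>t. f (?\<Lambda> t z)) has_vector_derivative fst z * ?g (?\<Lambda> t z)) (at t within {0..1})"
          by (simp add: o_def)
      qed simp
      then have I: "fst z * integral {0..1} (\<lambda>t. ?g (?\<Lambda> t z)) = f z"
        using integral_unique[of "\<lambda>t. fst z * ?g (?\<Lambda> t z)"] 0[of "snd z"] S'[of 0]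
        unfolding integral_mult_right by simp
      show ?thesis
      proof (cases "fst z = 0")
        case True
        then have "?\<Lambda> t z = z" for t by (simp add: prod_eq_iff)
        then show ?thesis using True by (simp add: div_fst_def)
      qed (use I in \<open>auto simp: div_fst_def field_simps\<close>)
      qed
    qed simp
    then show ?thesis using e by (intro exI[of _ ?B] exI[of _ "div_fst f"] conjI ballI) auto
  qed
qed

lemma fst_div_fst:
  assumes "\<And>s. (0, s) \<in> S \<Longrightarrow> f (0, s) = 0" "z \<in> S"
  shows "fst z * div_fst f z = f z"
  using assms by (cases z) (auto simp: div_fst_def)

text \<open>The complement of the hyperplane is dense, so the cancellation extends to it by
  continuity.\<close>

lemma cancel_fst:
  fixes f g :: "complex \<times> 'b::cvec \<Rightarrow> complex"
  assumes S: "open S" and f: "continuous_on S f" and g: "continuous_on S g"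
    and eq: "\<And>z. z \<in> S \<Longrightarrow> fst z * f z = fst z * g z" and z: "z \<in> S"
  shows "f z = g z"
proof (cases "fst z = 0")
  case True
  let ?w = "\<lambda>n. z + (of_real (inverse (real (Suc n))), 0)"
  have "(\<lambda>n. of_real (inverse (real (Suc n))) :: complex) \<longlonglongrightarrow> of_real 0"
    by (intro tendsto_of_real LIMSEQ_inverse_real_of_nat)
  then have w: "?w \<longlonglongrightarrow> z"
    using tendsto_add[OF tendsto_const[of z] tendsto_Pair[OF _ tendsto_const[of "0::'b"]],
        of "\<lambda>n. of_real (inverse (real (Suc n)))" "of_real 0"]
    unfolding of_real_0 zero_prod_def[symmetric] by (simp del: of_real_inverse)
  define v where "v = ?w"
  have fv: "fst (v n) \<noteq> 0" for n
    using True of_nat_neq_0[of n] by (simp add: v_def del: of_nat_Suc)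
  note w = w[folded v_def]
  have ev: "eventually (\<lambda>n. v n \<in> S) sequentially" by (rule topological_tendstoD[OF w S z])
  have 1: "(\<lambda>n. f (v n)) \<longlonglongrightarrow> f z" "(\<lambda>n. g (v n)) \<longlonglongrightarrow> g z"
    using continuous_on_tendsto_compose[OF f w z ev] continuous_on_tendsto_compose[OF g w z ev] by auto
  have "eventually (\<lambda>n. f (v n) = g (v n)) sequentially"
    using ev
  proof eventually_elim
    case (elim n)
    from eq[OF this] fv[of n] show ?case by simp
  qed
  from tendsto_cong[OF this] 1(2) have "(\<lambda>n. f (v n)) \<longlonglongrightarrow> g z" by simp
  from LIMSEQ_unique[OF 1(1) this] show ?thesis .
qed (use eq[OF z] in auto)

section \<open>Lagrange inversion and the flat coordinates\<close>

text \<open>The series \<open>exp (c T(z))\<close> for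
  \<open>T(z) = t_1 z + ... + t_(p-1) z ^ (p - 1)\<close>; the variable \<open>z\<close> stands for
  \<open>1 / w\<close>.\<close>

definition expT :: "nat \<Rightarrow> (nat \<Rightarrow> complex) \<Rightarrow> complex \<Rightarrow> complex fps" where
  "expT p t c = fps_exp c oo Abs_fps (\<lambda>k. if 1 \<le> k \<and> k < p then t k else 0)"

definition ecoef :: "nat \<Rightarrow> (nat \<Rightarrow> complex) \<Rightarrow> complex \<Rightarrow> nat \<Rightarrow> complex" where
  "ecoef p t c n = fps_nth (expT p t c) n"

lemma expT_add: "expT p t (c + d) = expT p t c * expT p t d"
  unfolding expT_def fps_exp_add_mult by (rule fps_compose_mult_distrib) simp

lemma expT_0 [simp]: "expT p t 0 = 1"
  by (simp add: expT_def)

lemma expT_nth_0 [simp]: "fps_nth (expT p t c) 0 = 1"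
  by (simp add: expT_def)

lemma expT_power: "expT p t (of_nat n) = expT p t 1 ^ n"
  by (induction n) (auto simp: expT_add)

lemma fps_deriv_expT:
  "fps_deriv (expT p t c) = fps_const c * expT p t c * fps_deriv (Abs_fps (\<lambda>k. if 1 \<le> k \<and> k < p then t k else 0))"
  unfolding expT_def by (subst fps_compose_deriv) (simp_all add: fps_compose_mult_distrib)

lemma ecoef_0 [simp]: "ecoef p t c 0 = 1"
  by (simp add: ecoef_def)

text \<open>Compares coefficients in \<open>E' = c T' E\<close>. The recursion exhibits the
  coefficients as polynomials in the \<open>t_k\<close>; holomorphy and derivatives in
  \<open>t\<close> are later obtained by induction along it.\<close>

lemma ecoef_rec:
  assumes "n \<ge> 1"
  shows "of_nat n * ecoef p t c n =
    c * (\<Sum>k=1..n. of_nat k * (if k < p then t k else 0) * ecoef p t c (n - k))"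
proof -
  obtain m where n: "n = Suc m" using assms by (cases n) auto
  let ?T = "Abs_fps (\<lambda>k. if 1 \<le> k \<and> k < p then t k else 0)"
  have "of_nat n * ecoef p t c n = fps_nth (fps_deriv (expT p t c)) m"
    by (simp add: n ecoef_def)
  also have "\<dots> = c * fps_nth (fps_deriv ?T * expT p t c) m"
    unfolding fps_deriv_expT by (simp add: mult.assoc mult.commute[of "expT p t c"])
  also have "\<dots> = c * (\<Sum>k=0..m. of_nat (Suc k) * (if Suc k < p then t (Suc k) else 0) * ecoef p t c (n - Suc k))"
    by (simp add: fps_mult_nth n ecoef_def)
  also have "(\<Sum>k=0..m. of_nat (Suc k) * (if Suc k < p then t (Suc k) else 0) * ecoef p t c (n - Suc k)) =
     (\<Sum>k=Suc 0..Suc m. of_nat k * (if k < p then t k else 0) * ecoef p t c (n - k))"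
    by (rule sum.shift_bounds_cl_Suc_ivl[symmetric])
  finally show ?thesis by (simp add: n)
qed

lemma ecoef_cong: "(\<And>k. 1 \<le> k \<Longrightarrow> k \<le> n \<Longrightarrow> k < p \<Longrightarrow> t k = t' k) \<Longrightarrow> ecoef p t c n = ecoef p t' c n"
proof (induction n rule: less_induct)
  case (less n)
  show ?case
  proof (cases "n = 0")
    case False
    then have "of_nat n * ecoef p t c n = of_nat n * ecoef p t' c n"
      using less by (subst (1 2) ecoef_rec) (auto intro!: sum.cong arg_cong2[where f = "(*)"])
    then show ?thesis using False by simp
  qed simp
qed

text \<open>Triangularity: \<open>t n\<close> enters the coefficient of index \<open>n\<close>
  linearly, next to a polynomial in the earlier variables. This is what makes the coordinate change
  from the \<open>a_i\<close> to the \<open>t_k\<close> invertible.\<close>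

lemma ecoef_top:
  assumes "n \<ge> 1" "n < p"
  shows "ecoef p t c n = c * t n + ecoef p (t(n := 0)) c n"
proof -
  have s: "(\<Sum>k=1..n. f k) = f n + (\<Sum>k\<in>{1..n} - {n}. f k)" for f :: "nat \<Rightarrow> complex"
    by (rule sum.remove) (use assms in auto)
  have "of_nat n * ecoef p t c n = of_nat n * (c * t n) + of_nat n * ecoef p (t(n := 0)) c n"
    unfolding ecoef_rec[OF assms(1)] s using assms
    by (auto simp: algebra_simps intro!: sum.cong ecoef_cong)
  also have "\<dots> = of_nat n * (c * t n + ecoef p (t(n := 0)) c n)" by (simp add: algebra_simps)
  finally show ?thesis using assms by simp
qed

text \<open>For \<open>X = z E(z)\<close> with \<open>E = expT p t 1\<close>, this is the series \<open>\<Psi>\<close> in \<open>X\<close> with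
  \<open>\<Psi>(X) (1 + z E' / E) = \<Phi>(z)\<close>.\<close>

definition Lag :: "nat \<Rightarrow> (nat \<Rightarrow> complex) \<Rightarrow> complex fps \<Rightarrow> complex fps" where
  "Lag p t \<Phi> = Abs_fps (\<lambda>m. fps_nth (\<Phi> * expT p t (- of_nat m)) m)"

text \<open>This is \<open>1 / x\<close> as a series in \<open>z = 1 / w\<close>, for
  \<open>x = w exp (- \<Sum> t_k w ^ (- k))\<close>.\<close>

definition Xser :: "nat \<Rightarrow> (nat \<Rightarrow> complex) \<Rightarrow> complex fps" where
  "Xser p t = fps_X * expT p t 1"

text \<open>The logarithmic Jacobian \<open>(z / X) dX / dz\<close> of
  \<open>X = Xser p t\<close>.\<close>

definition Jser :: "nat \<Rightarrow> (nat \<Rightarrow> complex) \<Rightarrow> complex fps" where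
  "Jser p t = 1 + fps_X * fps_deriv (expT p t 1) * expT p t (- 1)"

text \<open>The residue of \<open>X ^ (n - m) dX / X\<close>, a form that is exact for
  \<open>n < m\<close>. With \<open>d = m - n\<close>, the series times \<open>- d\<close> is
  \<open>- d E ^ (- d) + z (E ^ (- d))'\<close>, whose coefficient of index \<open>d\<close>
  cancels.\<close>

lemma residue_power:
  assumes "n \<le> m"
  shows "fps_nth (expT p t (of_nat n - of_nat m) * Jser p t) (m - n) = (if n = m then 1 else 0)"
proof (cases "n = m")
  case True
  then show ?thesis by (simp add: Jser_def)
next
  case False
  define d where "d = m - n"
  let ?T' = "fps_deriv (Abs_fps (\<lambda>k. if 1 \<le> k \<and> k < p then t k else 0))"
  have d: "d > 0" "of_nat n - of_nat m = - (of_nat d :: complex)"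
    using assms False by (auto simp: d_def of_nat_diff)
  have "expT p t (- of_nat d) * Jser p t =
    expT p t (- of_nat d) + fps_X * ?T' * (expT p t (- of_nat d) * (expT p t 1 * expT p t (- 1)))"
    by (simp add: Jser_def fps_deriv_expT algebra_simps)
  also have "expT p t 1 * expT p t (- 1) = 1" by (simp add: expT_add[symmetric])
  finally have "fps_const (- of_nat d) * (expT p t (- of_nat d) * Jser p t) =
    fps_const (- of_nat d) * expT p t (- of_nat d) + fps_X * fps_deriv (expT p t (- of_nat d))"
    by (simp add: fps_deriv_expT algebra_simps)
  moreover have "fps_nth (fps_const (- of_nat d) * expT p t (- of_nat d) +
      fps_X * fps_deriv (expT p t (- of_nat d))) d = 0"
    using d(1) by (cases d) (simp_all add: algebra_simps)
  ultimately have "fps_nth (fps_const (- of_nat d) * (expT p t (- of_nat d) * Jser p t)) d = 0"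
    by simp
  then have "- of_nat d * fps_nth (expT p t (- of_nat d) * Jser p t) d = 0"
    by (simp only: fps_mult_left_const_nth)
  then have "fps_nth (expT p t (- of_nat d) * Jser p t) d = 0" using d by simp
  then show ?thesis using False unfolding d d_def[symmetric] by simp
qed

text \<open>Invariance of the residue under a change of variable: the coefficient of
  \<open>X ^ m\<close> in \<open>\<Psi>\<close> is the residue of
  \<open>\<Psi>(X) X ^ (- m) dX / X\<close>, evaluated here in \<open>z\<close>.\<close>

lemma residue_change:
  "fps_nth ((\<Psi> oo Xser p t) * Jser p t * expT p t (- of_nat m)) m = fps_nth \<Psi> m"
proof -
  let ?X = "Xser p t" and ?J = "Jser p t" and ?E = "expT p t (- of_nat m)"
  have X0: "fps_nth ?X 0 = 0" by (simp add: Xser_def)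
  \<comment> \<open>Terms of \<open>\<Psi>\<close> above index \<open>m\<close> have order above
    \<open>m\<close> in \<open>z\<close>, so only the polynomial part \<open>P\<close>
    contributes.\<close>
  define R where "R = Abs_fps (\<lambda>n. if n \<le> m then 0 else fps_nth \<Psi> n)"
  define P where "P = (\<Sum>n\<le>m. fps_const (fps_nth \<Psi> n) * fps_X ^ n)"
  have Pn: "fps_nth P n = (if n \<le> m then fps_nth \<Psi> n else 0)" for n
    unfolding P_def by (simp add: fps_sum_nth if_distrib[where f = "\<lambda>x. _ * x"] cong: if_cong)
  have \<Psi>: "\<Psi> = P + R" by (rule fps_ext) (simp add: Pn R_def)
  have Xp: "?X ^ n = fps_X ^ n * expT p t (of_nat n)" for n
    by (simp add: Xser_def power_mult_distrib expT_power)
  have "fps_nth (R oo ?X) k = 0" if "k \<le> m" for k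
    unfolding fps_compose_nth using that by (intro sum.neutral) (auto simp: R_def)
  then have 1: "fps_nth ((R oo ?X) * (?J * ?E)) m = 0"
    by (auto simp: fps_mult_nth intro!: sum.neutral)
  have "P oo ?X = (\<Sum>n\<le>m. fps_const (fps_nth \<Psi> n) * ?X ^ n)"
    unfolding P_def
    by (simp add: fps_compose_sum_distrib fps_compose_mult_distrib[OF X0] fps_compose_power[OF X0, symmetric]
        fps_X_fps_compose_startby0[OF X0])
  then have "fps_nth ((P oo ?X) * (?J * ?E)) m =
     (\<Sum>n\<le>m. fps_nth (fps_const (fps_nth \<Psi> n) * (fps_X ^ n * (expT p t (of_nat n) * ?E * ?J))) m)"
    unfolding Xp by (simp only: sum_distrib_right fps_sum_nth) (simp only: mult_ac)
  also have "\<dots> = (\<Sum>n\<le>m. fps_nth \<Psi> n * fps_nth (fps_X ^ n * (expT p t (of_nat n) * ?E * ?J)) m)"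
    by (simp only: fps_mult_left_const_nth)
  also have "\<dots> = (\<Sum>n\<le>m. fps_nth \<Psi> n * (if n = m then 1 else 0))"
    by (intro sum.cong refl arg_cong2[where f = "(*)"])
      (simp add: fps_X_power_mult_nth expT_add[symmetric] residue_power del: mult_minus_right)
  also have "\<dots> = fps_nth \<Psi> m"
    by (simp add: if_distrib[where f = "\<lambda>x. _ * x"] cong: if_cong)
  finally show ?thesis
    unfolding \<Psi> using 1 by (simp add: fps_compose_add_distrib distrib_right mult.assoc Pn R_def)
qed

text \<open>\<open>Lag\<close> sends \<open>\<Phi>\<close> to \<open>\<Phi> / J\<close> rewritten as
  a series in \<open>X\<close>. Substitution is multiplicative, so both sides are
  \<open>\<Phi> \<Theta> \<Xi> / J ^ 2\<close> in the variable \<open>X\<close>.\<close>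

lemma Lag_mult: "Lag p t (\<Phi> * \<Theta>) * Lag p t \<Xi> = Lag p t \<Phi> * Lag p t (\<Theta> * \<Xi>)"
proof -
  let ?X = "Xser p t" and ?J = "Jser p t"
  let ?Z = "fps_inv ?X"
  have X: "fps_nth ?X 0 = 0" "fps_nth ?X 1 \<noteq> 0" by (simp_all add: Xser_def)
  have Z0: "fps_nth ?Z 0 = 0" by (simp add: fps_inv_def)
  have ZX: "?Z oo ?X = fps_X" by (rule fps_inv[OF X])
  have J: "?J * inverse ?J = 1" by (rule inverse_mult_eq_1') (simp add: Jser_def)
  have L: "Lag p t \<Phi> = (\<Phi> * inverse ?J) oo ?Z" for \<Phi>
  proof (rule fps_ext)
    fix m
    have "((\<Phi> * inverse ?J) oo ?Z) oo ?X = (\<Phi> * inverse ?J) oo (?Z oo ?X)"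
      by (rule fps_compose_assoc[OF X(1) Z0, symmetric])
    then have "((\<Phi> * inverse ?J) oo ?Z) oo ?X = \<Phi> * inverse ?J" by (simp add: ZX)
    then have "fps_nth ((\<Phi> * inverse ?J) oo ?Z) m = fps_nth (\<Phi> * inverse ?J * ?J * expT p t (- of_nat m)) m"
      using residue_change[of "(\<Phi> * inverse ?J) oo ?Z" p t m] by simp
    also have "\<Phi> * inverse ?J * ?J = \<Phi>" using J by (simp add: mult.assoc mult.commute)
    finally show "fps_nth (Lag p t \<Phi>) m = fps_nth ((\<Phi> * inverse ?J) oo ?Z) m"
      by (simp add: Lag_def)
  qed
  show ?thesis
    unfolding L fps_compose_mult_distrib[OF Z0, symmetric] by (simp add: mult_ac)
qed

text \<open>If \<open>x = w exp (- \<Sum> t_k w ^ (- k))\<close>, then \<open>acoef p t i\<close> is the coefficient of \<open>x ^ i\<close> in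
  \<open>w ^ p\<close>, by Lagrange inversion, and \<open>dacoef p t k i\<close> is its derivative along \<open>t_k\<close>.\<close>

definition acoef :: "nat \<Rightarrow> (nat \<Rightarrow> complex) \<Rightarrow> nat \<Rightarrow> complex" where
  "acoef p t i = of_nat p / of_nat i * ecoef p t (of_nat i) (p - i)"

definition dacoef :: "nat \<Rightarrow> (nat \<Rightarrow> complex) \<Rightarrow> nat \<Rightarrow> nat \<Rightarrow> complex" where
  "dacoef p t k i = (if k \<le> p - i then of_nat p * ecoef p t (of_nat i) (p - i - k) else 0)"

text \<open>For \<open>f = x ^ p + \<Sum> a_i x ^ i\<close>, the generating series of \<open>kap p a\<close> is the inverse of
  \<open>x f'(x) / x ^ p\<close> in the variable \<open>1 / x\<close>.\<close>

fun kap :: "nat \<Rightarrow> (nat \<Rightarrow> complex) \<Rightarrow> nat \<Rightarrow> complex" where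
  "kap p a m = (if m = 0 then 1 / of_nat p
     else - (\<Sum>l\<in>{1..<p}. if l \<le> m then of_nat (p - l) * a (p - l) * kap p a (m - l) else 0) / of_nat p)"

declare kap.simps [simp del]

section \<open>Expansion of the inverse of x f'(x) at infinity, and constancy of the pairing in the
  t_k\<close>

lemma kap_0: "kap p a 0 = 1 / of_nat p"
  by (simp add: kap.simps)

lemma kap_rec:
  assumes "p \<ge> 1" "m > 0"
  shows "of_nat p * kap p a m = - (\<Sum>l\<in>{1..<p}. if l \<le> m then of_nat (p - l) * a (p - l) * kap p a (m - l) else 0)"
  using assms by (subst kap.simps) simp

lemma kap_series:
  assumes p: "p \<ge> 1"
  shows "Abs_fps (\<lambda>m. if m = 0 then of_nat p else if m < p then of_nat (p - m) * a (p - m) else 0) *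
    Abs_fps (kap p a) = 1" (is "?A * ?K = 1")
proof (rule fps_ext)
  fix m
  show "fps_nth (?A * ?K) m = fps_nth 1 m"
  proof (cases "m = 0")
    case True
    then show ?thesis using p by (simp add: fps_mult_nth kap_0)
  next
    case False
    have "fps_nth (?A * ?K) m = (\<Sum>l=0..m. fps_nth ?A l * kap p a (m - l))" by (simp add: fps_mult_nth)
    also have "\<dots> = of_nat p * kap p a m + (\<Sum>l\<in>{1..m}. fps_nth ?A l * kap p a (m - l))"
      by (subst sum.atLeast_Suc_atMost) auto
    also have "(\<Sum>l\<in>{1..m}. fps_nth ?A l * kap p a (m - l)) =
       (\<Sum>l\<in>{1..<p}. if l \<le> m then of_nat (p - l) * a (p - l) * kap p a (m - l) else 0)"
      by (rule sum.mono_neutral_cong) auto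
    finally show ?thesis using False p by (simp add: kap_rec)
  qed
qed

text \<open>A factor known only below degree \<open>m\<close> determines the product up to degree
  \<open>m\<close> if the other factor has no constant term: one degree is gained for truncated
  series.\<close>

lemma fps_nth_mult_eqI:
  assumes "\<And>i. i < m \<Longrightarrow> fps_nth A i = fps_nth A' i" "fps_nth B 0 = 0" "i \<le> m"
  shows "fps_nth (A * B) i = fps_nth (A' * (B :: complex fps)) i"
  unfolding fps_mult_nth
proof (rule sum.cong)
  fix j assume "j \<in> {0..i}"
  then show "fps_nth A j * fps_nth B (i - j) = fps_nth A' j * fps_nth B (i - j)"
    using assms by (cases "j = m") auto
qed simp

text \<open>In the variable \<open>1 / x\<close>, \<open>?L k\<close> is the derivative of
  \<open>w ^ p\<close> along \<open>t_k\<close> at fixed \<open>x\<close>, divided by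
  \<open>p x ^ p\<close>, and \<open>?L 0\<close> is \<open>x\<close> times the
  \<open>x\<close>-derivative of \<open>w ^ p\<close>, divided likewise. Multiplicativity of
  \<open>Lag\<close> gives \<open>?L k * ?L l = ?L 0 * ?L (k + l)\<close>, so division by
  \<open>x f'(x)\<close> leaves a single coefficient of \<open>?L (k + l)\<close>.\<close>

lemma flat_pairing:
  assumes p: "p \<ge> 1" and k: "1 \<le> k" "k < p" and l: "1 \<le> l" "l < p"
  shows "(\<Sum>i\<in>{1..<p}. \<Sum>j\<in>{1..<p}. (if p \<le> i + j then kap p (acoef p t) (i + j - p) else 0) *
     dacoef p t k i * dacoef p t l j) = (if k + l = p then of_nat p else 0)" (is "?S = _")
proof -
  let ?L = "\<lambda>k. Lag p t (fps_X ^ k * expT p t (of_nat p))"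
  \<comment> \<open>Degree \<open>m\<close> stands for \<open>x ^ (p - m)\<close>; the truncation
    keeps exactly the powers \<open>x ^ i\<close> with \<open>i \<ge> 1\<close>, as they occur in
    \<open>f\<close>.\<close>
  define G where "G k = Abs_fps (\<lambda>m. if m < p then fps_nth (?L k) m else 0)" for k
  let ?K = "Abs_fps (kap p (acoef p t))"
  have Ln: "fps_nth (?L k) m = (if k \<le> m then ecoef p t (of_nat p - of_nat m) (m - k) else 0)" for k m
    by (simp add: Lag_def mult.assoc expT_add[symmetric] fps_X_power_mult_nth ecoef_def)
  have GL: "fps_nth (G k) i = fps_nth (?L k) i" if "i < p" for i k using that by (simp add: G_def)
  have G0: "fps_nth (G k) 0 = 0" "fps_nth (?L k) 0 = 0" if "1 \<le> k" for k
    using that by (auto simp: G_def Ln)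
  have da: "fps_nth (G k) (p - i) = dacoef p t k i / of_nat p" if "1 \<le> i" "i < p" for k i
    using that by (auto simp: G_def Ln dacoef_def of_nat_diff)
  have A: "Abs_fps (\<lambda>m. if m = 0 then of_nat p else if m < p then of_nat (p - m) * acoef p t (p - m) else 0) =
     fps_const (of_nat p) * G 0"
    using p by (intro fps_ext) (auto simp: G_def Ln[of 0, simplified] acoef_def of_nat_diff)
  have KG: "fps_const (of_nat p) * G 0 * ?K = 1" using kap_series[OF p, of "acoef p t"] unfolding A .
  have LL: "?L k * ?L l = ?L 0 * ?L (k + l)"
    using Lag_mult[of p t "expT p t (of_nat p)" "fps_X ^ k" "fps_X ^ l * expT p t (of_nat p)"]
    by (simp add: power_add mult_ac)
  \<comment> \<open>Degree \<open>p\<close> is still exact although the factors are cut off below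
    it, because the partner in each exchange starts in degree one or higher.\<close>
  have "fps_nth (G k * G l) i = fps_nth (G 0 * ?L (k + l)) i" if i: "i \<le> p" for i
  proof -
    have "fps_nth (G k * G l) i = fps_nth (?L k * G l) i"
      by (rule fps_nth_mult_eqI[OF GL _ i]) (use G0(1)[OF l(1)] in auto)
    also have "\<dots> = fps_nth (G l * ?L k) i" by (simp add: mult.commute)
    also have "\<dots> = fps_nth (?L l * ?L k) i"
      by (rule fps_nth_mult_eqI[OF GL _ i]) (use G0(2)[OF k(1)] in auto)
    also have "\<dots> = fps_nth (?L 0 * ?L (k + l)) i" using LL by (simp add: mult.commute)
    also have "\<dots> = fps_nth (G 0 * ?L (k + l)) i"
      by (rule fps_nth_mult_eqI[OF GL[symmetric] _ i]) (use G0(2)[of "k + l"] k in auto)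
    finally show ?thesis .
  qed
  then have "fps_nth ((G k * G l) * ?K) p = fps_nth ((G 0 * ?L (k + l)) * ?K) p"
    by (simp add: fps_mult_nth)
  then have "of_nat p * fps_nth (G k * G l * ?K) p =
     fps_nth (fps_const (of_nat p) * ((G 0 * ?L (k + l)) * ?K)) p"
    by (simp only: fps_mult_left_const_nth)
  also have "fps_const (of_nat p) * ((G 0 * ?L (k + l)) * ?K) =
     (fps_const (of_nat p) * G 0 * ?K) * ?L (k + l)"
    by (simp only: mult_ac)
  \<comment> \<open>In degree \<open>p\<close> the exponent of \<open>expT\<close> is
    \<open>p - p = 0\<close>, so that series is \<open>1\<close> and only \<open>k + l = p\<close>
    contributes.\<close>
  also have "fps_nth \<dots> p = (if k + l = p then 1 else 0)"
    unfolding KG by (auto simp: Ln) (auto simp: ecoef_def)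
  finally have 1: "of_nat p * fps_nth (G k * G l * ?K) p = (if k + l = p then 1 else 0)" .
  have "fps_nth (G k * G l * ?K) p = (\<Sum>n=0..p. (\<Sum>m=0..n. fps_nth (G k) m * fps_nth (G l) (n - m)) * kap p (acoef p t) (p - n))"
    by (simp add: fps_mult_nth)
  also have "\<dots> = (\<Sum>n=0..p. \<Sum>m=0..p. if m \<le> n then fps_nth (G k) m * fps_nth (G l) (n - m) * kap p (acoef p t) (p - n) else 0)"
    unfolding sum_distrib_right by (intro sum.cong refl sum.mono_neutral_cong_left) auto
  also have "\<dots> = (\<Sum>m=0..p. \<Sum>n=0..p. if m \<le> n then fps_nth (G k) m * fps_nth (G l) (n - m) * kap p (acoef p t) (p - n) else 0)"
    by (rule sum.swap)
  also have "\<dots> = (\<Sum>m=0..p. \<Sum>j=0..p. if m + j \<le> p then fps_nth (G k) m * fps_nth (G l) j * kap p (acoef p t) (p - (m + j)) else 0)"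
  proof (rule sum.cong[OF refl])
    fix m assume m: "m \<in> {0..p}"
    show "(\<Sum>n=0..p. if m \<le> n then fps_nth (G k) m * fps_nth (G l) (n - m) * kap p (acoef p t) (p - n) else 0) =
      (\<Sum>j=0..p. if m + j \<le> p then fps_nth (G k) m * fps_nth (G l) j * kap p (acoef p t) (p - (m + j)) else 0)"
      by (rule sum.reindex_bij_witness_not_neutral[where S' = "{0..<m}" and T' = "{p-m<..p}"
          and i = "\<lambda>j. j + m" and j = "\<lambda>n. n - m"])
        (use m G0(1)[OF l(1)] in auto)
  qed
  also have "\<dots> = (\<Sum>m\<in>{1..<p}. \<Sum>j\<in>{1..<p}. if m + j \<le> p then fps_nth (G k) m * fps_nth (G l) j * kap p (acoef p t) (p - (m + j)) else 0)"
  proof -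
    have "fps_nth (G k) m = 0 \<and> fps_nth (G l) m = 0" if "m \<in> {0..p} - {1..<p}" for m
      using that G0 k l by (cases "m = 0") (auto simp: G_def)
    then show ?thesis
      by (intro sum.mono_neutral_cong_right) (auto intro!: sum.mono_neutral_right)
  qed
  \<comment> \<open>Back from degrees in \<open>1 / x\<close> to powers of \<open>x\<close>, by
    \<open>i = p - m\<close> in both sums.\<close>
  also have "\<dots> = (\<Sum>i\<in>{1..<p}. \<Sum>j\<in>{1..<p}. if p \<le> i + j then fps_nth (G k) (p - i) * fps_nth (G l) (p - j) * kap p (acoef p t) (i + j - p) else 0)"
    by (rule sum.reindex_bij_witness[where i = "\<lambda>m. p - m" and j = "\<lambda>m. p - m"], auto)
      (rule sum.reindex_bij_witness[where i = "\<lambda>m. p - m" and j = "\<lambda>m. p - m"]; auto)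
  also have "\<dots> = (\<Sum>i\<in>{1..<p}. \<Sum>j\<in>{1..<p}. (if p \<le> i + j then kap p (acoef p t) (i + j - p) else 0) *
     dacoef p t k i * dacoef p t l j) / (of_nat p)\<^sup>2"
    unfolding sum_divide_distrib
    by (intro sum.cong refl) (simp add: da power2_eq_square)
  finally have "of_nat p * (?S / (of_nat p)\<^sup>2) = (if k + l = p then 1 else 0)"
    using 1 by simp
  moreover have "?S = of_nat p * (of_nat p * (?S / (of_nat p)\<^sup>2))"
    using p by (simp add: power2_eq_square)
  ultimately show ?thesis by (simp split: if_splits)
qed

section \<open>The residue functional of a fibre\<close>

text \<open>This is \<open>x f'(x)\<close> for \<open>f = x ^ p + \<Sum> a_i x ^ i\<close>, so that
  \<open>H\<close> is \<open>pol p a x - pol q b y\<close>.\<close>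

definition pol :: "nat \<Rightarrow> (nat \<Rightarrow> complex) \<Rightarrow> complex \<Rightarrow> complex" where
  "pol p a x = of_nat p * x ^ p + (\<Sum>i\<in>{1..<p}. of_nat i * a i * x ^ i)"

section \<open>Location of the zeros of H\<close>

lemma norm_pol_lower:
  assumes p: "p \<ge> 1" and \<rho>: "0 < \<rho>" "\<rho> \<le> 1" and x: "\<rho> \<le> norm x"
    and \<delta>: "\<delta> * (2 * real p ^ 2) \<le> \<rho> ^ p" and a: "\<And>i. i \<in> {1..<p} \<Longrightarrow> norm (a i) \<le> \<delta>"
  shows "\<rho> ^ p / 2 \<le> norm (pol p a x)"
proof -
  have xi: "norm x ^ i \<le> norm x ^ p / \<rho> ^ p" if "i < p" for i
  proof -
    have "norm x ^ p = norm x ^ i * norm x ^ (p - i)" using that by (simp flip: power_add)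
    also have "\<dots> \<ge> norm x ^ i * \<rho> ^ (p - i)" using x \<rho> by (intro mult_left_mono power_mono) auto
    also have "norm x ^ i * \<rho> ^ (p - i) \<ge> norm x ^ i * \<rho> ^ p"
      using \<rho> that by (intro mult_left_mono power_decreasing) auto
    finally show ?thesis using \<rho> by (simp add: field_simps)
  qed
  have "norm (\<Sum>i\<in>{1..<p}. of_nat i * a i * x ^ i) \<le> (\<Sum>i\<in>{1..<p}. real p * \<delta> * (norm x ^ p / \<rho> ^ p))"
  proof (rule sum_norm_le)
    fix i assume i: "i \<in> {1..<p}"
    have \<delta>0: "\<delta> \<ge> 0" using a[OF i] norm_ge_zero order_trans by blast
    have "norm (of_nat i * a i * x ^ i) = real i * norm (a i) * norm x ^ i"
      by (simp add: norm_mult norm_power)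
    also have "\<dots> \<le> real p * \<delta> * (norm x ^ p / \<rho> ^ p)"
      using i a[OF i] xi[of i] \<delta>0 by (intro mult_mono) auto
    finally show "norm (of_nat i * a i * x ^ i) \<le> real p * \<delta> * (norm x ^ p / \<rho> ^ p)" .
  qed
  also have "\<dots> = real (p - 1) * (real p * \<delta> * (norm x ^ p / \<rho> ^ p))" by simp
  also have "\<dots> \<le> norm x ^ p / 2"
  \<comment> \<open>For \<open>p = 1\<close> the sum is empty; otherwise
    \<open>\<delta> \<ge> 0\<close> is read off from the bound on \<open>a 1\<close>.\<close>
  proof (cases "p = 1")
    case False
    then have "norm (a 1) \<le> \<delta>" using p by (intro a) auto
    then have \<delta>0: "\<delta> \<ge> 0" using norm_ge_zero order_trans by blast
    have "real (p - 1) * (real p * \<delta> * (norm x ^ p / \<rho> ^ p)) \<le> real p * (real p * \<delta> * (norm x ^ p / \<rho> ^ p))"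
      using \<delta>0 \<rho> by (intro mult_right_mono) auto
    also have "\<dots> = (\<delta> * (2 * real p ^ 2)) * (norm x ^ p / (2 * \<rho> ^ p))"
      using \<rho> by (simp add: power2_eq_square field_simps)
    also have "\<dots> \<le> \<rho> ^ p * (norm x ^ p / (2 * \<rho> ^ p))" using \<rho> by (intro mult_right_mono \<delta>) auto
    also have "\<dots> = norm x ^ p / 2" using \<rho> by simp
    finally show ?thesis .
  qed simp
  finally have 1: "norm (\<Sum>i\<in>{1..<p}. of_nat i * a i * x ^ i) \<le> norm x ^ p / 2" .
  have "norm x ^ p \<le> norm (of_nat p * x ^ p)"
    using p mult_right_mono[of 1 "real p" "norm x ^ p"] by (simp add: norm_mult norm_power)
  with 1 have "norm x ^ p / 2 \<le> norm (pol p a x)"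
    unfolding pol_def using norm_diff_ineq[of "of_nat p * x ^ p" "\<Sum>i\<in>{1..<p}. of_nat i * a i * x ^ i"] by linarith
  moreover have "\<rho> ^ p \<le> norm x ^ p" using x \<rho> by (intro power_mono) auto
  ultimately show ?thesis by linarith
qed

text \<open>\<open>pol\<close> has no constant term, hence a bound linear in \<open>norm y\<close>
  on the unit disc.\<close>

lemma norm_pol_upper:
  assumes q: "q \<ge> 1" and y: "norm y \<le> 1" and b: "\<And>i. i \<in> {1..<q} \<Longrightarrow> norm (b i) \<le> 1"
  shows "norm (pol q b y) \<le> (real q + real q ^ 2) * norm y"
proof -
  have yi: "norm y ^ i \<le> norm y" if "i \<ge> 1" for i
    using power_decreasing[of 1 i "norm y"] that y by simp
  have "norm (\<Sum>i\<in>{1..<q}. of_nat i * b i * y ^ i) \<le> (\<Sum>i\<in>{1..<q}. real q * 1 * norm y)"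
  proof (rule sum_norm_le)
    fix i assume i: "i \<in> {1..<q}"
    have "norm (of_nat i * b i * y ^ i) = real i * norm (b i) * norm y ^ i"
      by (simp add: norm_mult norm_power)
    also have "\<dots> \<le> real q * 1 * norm y"
      using i b[OF i] yi[of i] by (intro mult_mono) auto
    finally show "norm (of_nat i * b i * y ^ i) \<le> real q * 1 * norm y" .
  qed
  also have "\<dots> = real (q - 1) * (real q * norm y)" by simp
  also have "\<dots> \<le> real q * (real q * norm y)" by (intro mult_right_mono) auto
  finally have 1: "norm (\<Sum>i\<in>{1..<q}. of_nat i * b i * y ^ i) \<le> real q ^ 2 * norm y"
    by (simp add: power2_eq_square mult.assoc)
  have "norm (of_nat q * y ^ q) \<le> real q * norm y"
    using yi[OF q] by (simp add: norm_mult norm_power mult_left_mono)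
  then show ?thesis unfolding pol_def using 1
      norm_triangle_ineq[of "of_nat q * y ^ q" "\<Sum>i\<in>{1..<q}. of_nat i * b i * y ^ i"]
    by (simp add: algebra_simps)
qed

text \<open>If \<open>x\<close> is not small and \<open>x y\<close> is, then \<open>y\<close> is
  small, so \<open>pol q b y\<close> is small while the leading term keeps \<open>pol p a x\<close>
  away from zero. There is no upper bound on \<open>norm x\<close>; this is what lets contours go to
  infinity.\<close>

lemma pol_separation:
  assumes p: "p \<ge> 1" and q: "q \<ge> 1" and \<rho>: "0 < \<rho>" "\<rho> \<le> 1"
  obtains \<delta> where "\<delta> > 0" "\<And>a b x y. norm (x * y) < \<delta> \<Longrightarrow> (\<And>i. norm (a i) < \<delta>) \<Longrightarrow>
    (\<And>i. norm (b i) < \<delta>) \<Longrightarrow> \<rho> \<le> norm x \<Longrightarrow> pol p a x \<noteq> pol q b y"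
proof
  define K where "K = real q + real q ^ 2"
  have K: "K \<ge> 1" using q unfolding K_def by (simp add: add_increasing2)
  have p2: "real p ^ 2 \<ge> 1" using p by simp
  \<comment> \<open>The factor \<open>1 / (4 p ^ 2)\<close> meets the demand of
    \<open>norm_pol_lower\<close>; the factor \<open>1 / K\<close>, with \<open>K\<close> from
    \<open>norm_pol_upper\<close>, keeps \<open>pol q b y\<close> below
    \<open>\<rho> ^ p / 2\<close>.\<close>
  define \<delta> where "\<delta> = \<rho> ^ Suc p / (4 * real p ^ 2 * K)"
  have KP: "4 * real p ^ 2 * K \<ge> 4" using mult_mono[OF p2 K] by simp
  show \<delta>: "\<delta> > 0"
    unfolding \<delta>_def using KP \<rho> by (intro divide_pos_pos zero_less_power) linarith+
  have \<rho>p: "\<rho> ^ p \<le> 1" "\<rho> ^ Suc p \<le> \<rho>" "\<rho> ^ Suc p \<le> \<rho> ^ p"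
    using \<rho> by (auto simp: power_le_one mult_left_le mult_left_le_one_le)
  have "\<delta> \<le> \<rho> ^ Suc p / 4" unfolding \<delta>_def using \<rho> KP by (intro divide_left_mono) auto
  then have \<delta>\<rho>: "\<delta> \<le> \<rho> / 4" "\<delta> \<le> 1" using \<rho>p(2) \<rho>(2) by linarith+
  have d1: "\<delta> * (2 * real p ^ 2) \<le> \<rho> ^ p"
  proof -
    have "\<delta> * (2 * real p ^ 2) = \<rho> ^ Suc p / (2 * K)" unfolding \<delta>_def using p K by (simp add: field_simps)
    also have "\<dots> \<le> \<rho> ^ Suc p / 1" using K \<rho> by (intro divide_left_mono) auto
    finally show ?thesis using \<rho>p by simp
  qed
  have d2: "K * \<delta> \<le> \<rho> * (\<rho> ^ p / 4)"
  proof -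
    have "K * \<delta> = \<rho> ^ Suc p / (4 * real p ^ 2)" unfolding \<delta>_def using p K by (simp add: field_simps)
    also have "\<dots> \<le> \<rho> ^ Suc p / 4" using p2 \<rho> p by (intro divide_left_mono) auto
    finally show ?thesis by simp
  qed
  fix a b :: "nat \<Rightarrow> complex" and x y :: complex
  assume xy: "norm (x * y) < \<delta>" and a: "\<And>i. norm (a i) < \<delta>" and b: "\<And>i. norm (b i) < \<delta>" and x: "\<rho> \<le> norm x"
  have "\<rho> * norm y \<le> norm (x * y)" unfolding norm_mult by (rule mult_right_mono[OF x]) simp
  then have y: "\<rho> * norm y < \<delta>" using xy by linarith
  then have "\<rho> * norm y \<le> \<rho> * 1" using \<delta>\<rho> \<rho> by linarith
  then have y1: "norm y \<le> 1" using \<rho> by (simp only: mult_le_cancel_left_pos)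
  have "norm (pol q b y) \<le> K * norm y"
    unfolding K_def using b \<delta>\<rho> by (intro norm_pol_upper q y1) (meson less_eq_real_def order_trans)
  then have "\<rho> * norm (pol q b y) \<le> K * (\<rho> * norm y)" using \<rho> by (simp add: mult.left_commute)
  also have "\<dots> \<le> K * \<delta>" using y K by (intro mult_left_mono) auto
  also have "\<dots> < \<rho> * (\<rho> ^ p / 2)"
    using d2 mult_pos_pos[OF \<rho>(1) zero_less_power[OF \<rho>(1), of p]]
    unfolding times_divide_eq_right by linarith
  finally have "norm (pol q b y) < \<rho> ^ p / 2" using \<rho> by (simp only: mult_less_cancel_left_pos)
  moreover have "\<rho> ^ p / 2 \<le> norm (pol p a x)"
    by (rule norm_pol_lower[OF p \<rho> x d1]) (use a less_imp_le in blast)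
  ultimately show "pol p a x \<noteq> pol q b y" by auto
qed

section \<open>Contour integrals near infinity and over a period\<close>

lemma circle_integral_eq:
  assumes f: "f holomorphic_on S" and S: "open S" and \<rho>: "0 < \<rho>" "\<rho> \<le> R" and sub: "{x. norm x \<ge> \<rho>} \<subseteq> S"
  shows "contour_integral (circlepath 0 \<rho>) f = contour_integral (circlepath 0 R) f"
proof (rule Cauchy_theorem_homotopic_loops[OF _ S f])
  show "homotopic_loops S (circlepath 0 \<rho>) (circlepath 0 R)"
  proof (rule homotopic_loops_linear)
    fix t :: real assume "t \<in> {0..1}"
    let ?e = "exp (2 * of_real pi * \<i> * of_real t) :: complex"
    \<comment> \<open>The homotopy is radial, so it never enters the open disc of radius
      \<open>\<rho>\<close>.\<close>
    show "closed_segment (circlepath 0 \<rho> t) (circlepath 0 R t) \<subseteq> S"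
    proof
      fix w assume "w \<in> closed_segment (circlepath 0 \<rho> t) (circlepath 0 R t)"
      then obtain u where u: "0 \<le> u" "u \<le> 1" "w = of_real ((1 - u) * \<rho> + u * R) * ?e"
        unfolding in_segment circlepath by (auto simp: scaleR_conv_of_real algebra_simps)
      have "(1 - u) * \<rho> + u * R \<ge> (1 - u) * \<rho> + u * \<rho>" using u \<rho> by (intro add_left_mono mult_left_mono) auto
      then have "\<rho> \<le> (1 - u) * \<rho> + u * R" by (simp add: algebra_simps)
      moreover have "norm w = \<bar>(1 - u) * \<rho> + u * R\<bar>"
        unfolding u norm_mult by (simp add: norm_exp_eq_Re del: of_real_add of_real_mult of_real_diff)
      ultimately show "w \<in> S" using sub by auto
    qed
  qed auto
qed auto

text \<open>On a circle of radius \<open>R\<close> the integrand is \<open>o(1 / R)\<close> while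
  the length is \<open>2 pi R\<close>.\<close>

lemma circle_integral_zero:
  assumes f: "f holomorphic_on S" and S: "open S" and \<rho>: "0 < \<rho>" and sub: "{x. norm x \<ge> \<rho>} \<subseteq> S"
    and lim: "((\<lambda>x. x * f x) \<longlongrightarrow> 0) at_infinity"
  shows "contour_integral (circlepath 0 \<rho>) f = 0"
proof -
  let ?I = "contour_integral (circlepath 0 \<rho>) f"
  have "norm ?I \<le> e * (2 * pi)" if e: "e > 0" for e
  proof -
    obtain R0 where R0: "\<And>x. R0 \<le> norm x \<Longrightarrow> norm (x * f x) < e"
      using lim e unfolding Lim_at_infinity dist_norm by (metis diff_zero)
    define R where "R = max \<rho> R0"
    have R: "R > 0" "R \<ge> \<rho>" "R \<ge> R0" using \<rho> by (auto simp: R_def)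
    have "f contour_integrable_on circlepath 0 R"
    proof (rule contour_integrable_continuous_circlepath)
      have "path_image (circlepath 0 R) \<subseteq> S" using R sub by auto
      then show "continuous_on (path_image (circlepath 0 R)) f"
        using f holomorphic_on_imp_continuous_on continuous_on_subset by blast
    qed
    then have "norm (contour_integral (circlepath 0 R) f) \<le> (e / R) * (2 * pi * R)"
    proof (intro has_contour_integral_bound_circlepath[OF has_contour_integral_integral])
      fix x :: complex assume x: "norm (x - 0) = R"
      then have "norm (x * f x) < e" using R R0 by simp
      then show "norm (f x) \<le> e / R" using x R by (simp add: norm_mult field_simps)
    qed (use R e in auto)
    then show ?thesis
      using circle_integral_eq[OF f S \<rho> R(2) sub] R by simp
  qed
  then have "norm ?I / (2 * pi) \<le> 0 + e" if "e > 0" for e using that by (simp add: pos_divide_le_eq)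
  then have "norm ?I / (2 * pi) \<le> 0" by (rule field_le_epsilon)
  then show ?thesis by (simp add: pos_divide_le_eq)
qed

text \<open>The points \<open>exp w\<close> and \<open>exp (w + 2 \<pi> i)\<close> coincide, so the integral of \<open>g \<circ> exp\<close> over the
  period starting at \<open>w\<close> does not depend on \<open>w\<close>.\<close>

lemma period_integral_const:
  assumes g: "g holomorphic_on S" and S: "open S" "convex S"
    and per: "\<And>w. w \<in> S \<Longrightarrow> w + 2 * of_real pi * \<i> \<in> S \<and> g (w + 2 * of_real pi * \<i>) = g w"
    and v: "v \<in> S" and w: "w \<in> S"
  shows "contour_integral (linepath v (v + 2 * of_real pi * \<i>)) g =
    contour_integral (linepath w (w + 2 * of_real pi * \<i>)) g"
proof -
  let ?T = "2 * of_real pi * \<i>"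
  obtain G where G: "\<And>x. x \<in> S \<Longrightarrow> (G has_field_derivative g x) (at x)"
    using holomorphic_convex_primitive'[OF S(2) S(1) g] at_within_open S(1) by metis
  have I: "contour_integral (linepath v (v + ?T)) g = G (v + ?T) - G v" if "v \<in> S" for v
  proof -
    have "closed_segment v (v + ?T) \<subseteq> S" using that per S(2) closed_segment_subset by blast
    then have "(g has_contour_integral G (pathfinish (linepath v (v + ?T))) - G (pathstart (linepath v (v + ?T))))
        (linepath v (v + ?T))"
      using has_field_derivative_at_within[OF G]
      by (intro contour_integral_primitive[where S = S]) (simp_all add: valid_path_linepath)
    then show ?thesis by (simp add: contour_integral_unique)
  qed
  have d: "((\<lambda>w. G (w + ?T) - G w) has_field_derivative 0) (at w within S)" if "w \<in> S" for w
  proof -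
    have "((\<lambda>w. G (w + ?T)) has_field_derivative g (w + ?T)) (at w)"
      using G[of "w + ?T"] per[OF that] by (simp add: DERIV_shift)
    from DERIV_diff[OF this G[OF that]] show ?thesis
      using per[OF that] by (simp add: has_field_derivative_at_within)
  qed
  obtain c where "\<And>w. w \<in> S \<Longrightarrow> G (w + ?T) - G w = c"
    using has_field_derivative_zero_constant[OF S(2) d] by blast
  then show ?thesis using I v w by metis
qed

text \<open>For \<open>\<epsilon> \<noteq> 0\<close> the substitution \<open>x = exp w\<close> turns
  both sides into integrals of one periodic function over a period: the circle in \<open>y\<close>
  runs backwards in \<open>x\<close>, and \<open>dy / y = - dx / x\<close> restores the sign. For
  \<open>\<epsilon> = 0\<close> both sides are \<open>2 pi i K(0, 0)\<close>.\<close>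

lemma boundary_integrals_eq:
  assumes \<rho>: "0 < \<rho>" "\<rho> < r" and \<epsilon>: "norm \<epsilon> < \<rho>\<^sup>2"
    and K: "\<epsilon> \<noteq> 0 \<Longrightarrow> (\<lambda>x. K x (\<epsilon> / x)) holomorphic_on {x. x \<noteq> 0 \<and> norm x < r \<and> norm (\<epsilon> / x) < r}"
    and K0: "\<epsilon> = 0 \<Longrightarrow> (\<lambda>x. K x 0) holomorphic_on ball 0 r \<and> (\<lambda>y. K 0 y) holomorphic_on ball 0 r"
  shows "contour_integral (circlepath 0 \<rho>) (\<lambda>x. K x (\<epsilon> / x) / x) =
    contour_integral (circlepath 0 \<rho>) (\<lambda>y. K (\<epsilon> / y) y / y)"
proof (cases "\<epsilon> = 0")
  case True
  have sub: "cball 0 \<rho> \<subseteq> ball (0::complex) r" using \<rho> by auto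
  have "((\<lambda>u. K u 0 / (u - 0)) has_contour_integral 2 * of_real pi * \<i> * K 0 0) (circlepath 0 \<rho>)"
    using K0[OF True] \<rho> by (intro Cauchy_integral_circlepath_simple holomorphic_on_subset[OF _ sub]) auto
  moreover have "((\<lambda>u. K 0 u / (u - 0)) has_contour_integral 2 * of_real pi * \<i> * K 0 0) (circlepath 0 \<rho>)"
    using K0[OF True] \<rho> by (intro Cauchy_integral_circlepath_simple holomorphic_on_subset[OF _ sub]) auto
  ultimately have "contour_integral (circlepath 0 \<rho>) (\<lambda>u. K u 0 / (u - 0)) =
      contour_integral (circlepath 0 \<rho>) (\<lambda>u. K 0 u / (u - 0))"
    using contour_integral_unique by metis
  then show ?thesis using True \<rho>(1) by simp
next
  case False
  let ?T = "2 * of_real pi * \<i> :: complex"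
  \<comment> \<open>The preimage under \<open>exp\<close> of the annulus \<open>norm x < r\<close>,
    \<open>norm (\<epsilon> / x) < r\<close>.\<close>
  define S where "S = {w::complex. ln (norm \<epsilon> / r) < Re w \<and> Re w < ln r}"
  define g where "g w = K (exp w) (\<epsilon> / exp w)" for w
  have r: "r > 0" using \<rho> by simp
  have S: "open S" "convex S"
  proof -
    have "S = {w. Re w > ln (norm \<epsilon> / r)} \<inter> {w. Re w < ln r}" by (auto simp: S_def)
    then show "open S" "convex S"
      by (auto intro!: open_Int convex_Int open_halfspace_Re_gt open_halfspace_Re_lt
          convex_halfspace_Re_gt convex_halfspace_Re_lt)
  qed
  have S_exp: "norm (exp w) < r \<and> norm (\<epsilon> / exp w) < r" if "w \<in> S" for w
  proof -
    have "norm \<epsilon> / r < exp (Re w)" "exp (Re w) < r"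
      using that False r by (auto simp: S_def) (metis divide_pos_pos exp_less_mono exp_ln zero_less_norm_iff, metis exp_less_mono exp_ln)
    then show ?thesis using r by (simp add: norm_divide norm_exp_eq_Re field_simps)
  qed
  have g: "g holomorphic_on S"
    unfolding g_def using S_exp
    by (intro holomorphic_on_compose_gen[OF holomorphic_on_exp K[OF False], unfolded o_def]) auto
  have per: "w + ?T \<in> S \<and> g (w + ?T) = g w" if "w \<in> S" for w
    using that by (simp add: S_def g_def exp_add)
  define v where "v = complex_of_real (ln \<rho>)"
  \<comment> \<open>\<open>w + ?T\<close> is a logarithm of \<open>\<epsilon> / \<rho>\<close>, the
    value of \<open>x\<close> at the point \<open>y = \<rho>\<close> where the second circle starts;
    the path then descends to \<open>w\<close>.\<close>
  define w where "w = Ln \<epsilon> - of_real (ln \<rho>) - ?T"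
  have ev: "exp v = of_real \<rho>" unfolding v_def exp_of_real using \<rho> by simp
  have ew: "exp w = \<epsilon> / of_real \<rho>"
    unfolding w_def exp_diff exp_of_real using \<rho> False by simp
  have rr: "\<rho>\<^sup>2 < \<rho> * r" using \<rho> by (simp add: power2_eq_square)
  have vS: "v \<in> S"
  proof -
    have "norm \<epsilon> / r < \<rho>" using rr \<epsilon> r by (simp add: field_simps)
    then have "ln (norm \<epsilon> / r) < ln \<rho>" using False r by (intro ln_less_cancel_iff[THEN iffD2]) (use \<rho> in auto)
    then show ?thesis using \<rho> by (simp add: S_def v_def)
  qed
  have wS: "w \<in> S"
  proof -
    have "norm \<epsilon> / \<rho> < r" using rr \<epsilon> \<rho> by (simp add: field_simps)
    then have "ln (norm \<epsilon>) - ln \<rho> < ln r"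
      using False \<rho> r ln_less_cancel_iff[of "norm \<epsilon> / \<rho>" r] by (simp add: ln_div)
    moreover have "ln \<rho> < ln r" using \<rho> by simp
    ultimately show ?thesis using False \<rho> r by (simp add: S_def w_def ln_div)
  qed
  have "contour_integral (circlepath 0 \<rho>) (\<lambda>x. K x (\<epsilon> / x) / x) =
      contour_integral (linepath v (v + ?T)) g"
    unfolding contour_integral_integral
  proof (rule integral_cong)
    fix t :: real
    have l: "linepath v (v + ?T) t = v + ?T * of_real t"
      by (simp add: linepath_def scaleR_conv_of_real algebra_simps)
    have c: "circlepath 0 \<rho> t = exp (v + ?T * of_real t)"
      by (simp add: circlepath exp_add ev)
    show "K (circlepath 0 \<rho> t) (\<epsilon> / circlepath 0 \<rho> t) / circlepath 0 \<rho> t * vector_derivative (circlepath 0 \<rho>) (at t) =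
        g (linepath v (v + ?T) t) * vector_derivative (linepath v (v + ?T)) (at t)"
      unfolding vector_derivative_circlepath l
      unfolding c using \<rho>(1) by (simp add: g_def exp_add ev)
  qed
  moreover have "contour_integral (circlepath 0 \<rho>) (\<lambda>y. K (\<epsilon> / y) y / y) =
      contour_integral (linepath w (w + ?T)) g"
  proof -
    have "contour_integral (linepath w (w + ?T)) g = - contour_integral (linepath (w + ?T) w) g"
      using contour_integral_reversepath[of "linepath w (w + ?T)" g] by simp
    also have "\<dots> = - integral {0..1} (\<lambda>t. g (linepath (w + ?T) w t) * vector_derivative (linepath (w + ?T) w) (at t))"
      by (simp only: contour_integral_integral)
    also have "\<dots> = integral {0..1} (\<lambda>t. - (g (linepath (w + ?T) w t) * vector_derivative (linepath (w + ?T) w) (at t)))"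
      by (rule integral_neg[symmetric])
    also have "\<dots> = contour_integral (circlepath 0 \<rho>) (\<lambda>y. K (\<epsilon> / y) y / y)"
      unfolding contour_integral_integral
    proof (rule integral_cong)
      fix t :: real
      have l: "linepath (w + ?T) w t = w + ?T - ?T * of_real t"
        by (simp add: linepath_def scaleR_conv_of_real algebra_simps)
      have c: "circlepath 0 \<rho> t = of_real \<rho> * exp (?T * of_real t)"
        by (simp add: circlepath)
      have e: "exp (w + ?T - ?T * of_real t) = \<epsilon> / (of_real \<rho> * exp (?T * of_real t))"
        unfolding exp_diff exp_add ew by simp
      show "- (g (linepath (w + ?T) w t) * vector_derivative (linepath (w + ?T) w) (at t)) =
          K (\<epsilon> / circlepath 0 \<rho> t) (circlepath 0 \<rho> t) / circlepath 0 \<rho> t * vector_derivative (circlepath 0 \<rho>) (at t)"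
        unfolding vector_derivative_circlepath l g_def e c
        using False \<rho> by simp
    qed
    finally show ?thesis by simp
  qed
  ultimately show ?thesis using period_integral_const[OF g S per vS wS] by simp
qed


text \<open>The contribution of the boundary component \<open>norm x = \<rho>\<close> on one fibre.
  The other component is the same integral with the two axes exchanged: \<open>H\<close> then
  changes sign, which absorbs the sign in \<open>- dy / y\<close>.\<close>

definition xint :: "nat \<Rightarrow> nat \<Rightarrow> (nat \<Rightarrow> complex) \<Rightarrow> (nat \<Rightarrow> complex) \<Rightarrow> complex \<Rightarrow> real \<Rightarrow>
    (complex \<Rightarrow> complex \<Rightarrow> complex) \<Rightarrow> complex" where
  "xint p q a b \<epsilon> \<rho> G = contour_integral (circlepath 0 \<rho>)
     (\<lambda>x. G x (\<epsilon> / x) / (pol p a x - pol q b (\<epsilon> / x)) * (1 / x))"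

definition xcont :: "complex \<Rightarrow> real \<Rightarrow> (complex \<Rightarrow> complex \<Rightarrow> complex) \<Rightarrow> bool" where
  "xcont \<epsilon> \<rho> G \<longleftrightarrow> continuous_on (sphere 0 \<rho>) (\<lambda>x. G x (\<epsilon> / x))"

lemma xcont_const: "xcont \<epsilon> \<rho> (\<lambda>x y. c)"
  and xcont_x: "xcont \<epsilon> \<rho> (\<lambda>x y. x)"
  and xcont_add: "xcont \<epsilon> \<rho> G \<Longrightarrow> xcont \<epsilon> \<rho> G' \<Longrightarrow> xcont \<epsilon> \<rho> (\<lambda>x y. G x y + G' x y)"
  and xcont_diff: "xcont \<epsilon> \<rho> G \<Longrightarrow> xcont \<epsilon> \<rho> G' \<Longrightarrow> xcont \<epsilon> \<rho> (\<lambda>x y. G x y - G' x y)"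
  and xcont_mult: "xcont \<epsilon> \<rho> G \<Longrightarrow> xcont \<epsilon> \<rho> G' \<Longrightarrow> xcont \<epsilon> \<rho> (\<lambda>x y. G x y * G' x y)"
  and xcont_power: "xcont \<epsilon> \<rho> G \<Longrightarrow> xcont \<epsilon> \<rho> (\<lambda>x y. G x y ^ n)"
  and xcont_sum: "(\<And>i. i \<in> I \<Longrightarrow> xcont \<epsilon> \<rho> (F i)) \<Longrightarrow> xcont \<epsilon> \<rho> (\<lambda>x y. \<Sum>i\<in>I. F i x y)"
  unfolding xcont_def by (intro continuous_intros; simp)+

lemma xcont_y: "\<rho> > 0 \<Longrightarrow> xcont \<epsilon> \<rho> (\<lambda>x y. y)"
  unfolding xcont_def by (intro continuous_intros) auto

text \<open>Only the end of the fibre where \<open>x\<close> is large is concerned, so the locale is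
  instantiated once for each end. The absence of zeros is required for all large \<open>x\<close>,
  not only within the tube.\<close>

locale half_fibre =
  fixes p q :: nat and a b :: "nat \<Rightarrow> complex" and \<epsilon> :: complex and \<rho> :: real
  assumes p: "p \<ge> 1" and q: "q \<ge> 1" and \<rho>: "0 < \<rho>"
    and nz: "\<And>x. \<rho> \<le> norm x \<Longrightarrow> pol p a x \<noteq> pol q b (\<epsilon> / x)"
begin

lemma xcont_int:
  assumes "xcont \<epsilon> \<rho> G"
  shows "(\<lambda>x. G x (\<epsilon> / x) / (pol p a x - pol q b (\<epsilon> / x)) * (1 / x)) contour_integrable_on circlepath 0 \<rho>"
proof (rule contour_integrable_continuous_circlepath)
  have "x \<noteq> 0 \<and> pol p a x - pol q b (\<epsilon> / x) \<noteq> 0" if "x \<in> sphere 0 \<rho>" for x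
    using that nz[of x] \<rho> by auto
  then have "continuous_on (sphere 0 \<rho>) (\<lambda>x. G x (\<epsilon> / x) / (pol p a x - pol q b (\<epsilon> / x)) * (1 / x))"
    using assms unfolding xcont_def pol_def by (intro continuous_intros) auto
  then show "continuous_on (path_image (circlepath 0 \<rho>))
      (\<lambda>x. G x (\<epsilon> / x) / (pol p a x - pol q b (\<epsilon> / x)) * (1 / x))" using \<rho> by simp
qed

lemma xint_add:
  "xcont \<epsilon> \<rho> G \<Longrightarrow> xcont \<epsilon> \<rho> G' \<Longrightarrow>
   xint p q a b \<epsilon> \<rho> (\<lambda>x y. G x y + G' x y) = xint p q a b \<epsilon> \<rho> G + xint p q a b \<epsilon> \<rho> G'"
  unfolding xint_def using contour_integral_add[OF xcont_int xcont_int, of G G']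
  by (simp add: add_divide_distrib)

lemma xint_cmult:
  "xcont \<epsilon> \<rho> G \<Longrightarrow> xint p q a b \<epsilon> \<rho> (\<lambda>x y. c * G x y) = c * xint p q a b \<epsilon> \<rho> G"
  unfolding xint_def using contour_integral_lmul[OF xcont_int, of G c] by (simp add: mult_ac)

lemma xint_cong:
  assumes "\<And>x y. x * y = \<epsilon> \<Longrightarrow> norm x = \<rho> \<Longrightarrow> G x y = G' x y"
  shows "xint p q a b \<epsilon> \<rho> G = xint p q a b \<epsilon> \<rho> G'"
  unfolding xint_def
proof (rule contour_integral_eq)
  fix x assume "x \<in> path_image (circlepath 0 \<rho>)"
  then have "x \<noteq> 0" "norm x = \<rho>" using \<rho> by auto
  then show "G x (\<epsilon> / x) / (pol p a x - pol q b (\<epsilon> / x)) * (1 / x) =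
      G' x (\<epsilon> / x) / (pol p a x - pol q b (\<epsilon> / x)) * (1 / x)" using assms[of x "\<epsilon> / x"] by simp
qed

text \<open>With \<open>y = \<epsilon> / x\<close> the integrand times \<open>x\<close> grows at
  most like \<open>x ^ (i - j - p)\<close>, hence tends to zero at infinity.\<close>

lemma xint_monom:
  assumes ij: "i < p + j"
  shows "xint p q a b \<epsilon> \<rho> (\<lambda>x y. x ^ i * y ^ j) = 0"
  unfolding xint_def
proof (rule circle_integral_zero)
  let ?D = "\<lambda>x. pol p a x - pol q b (\<epsilon> / x)"
  let ?S = "{x. x \<noteq> 0 \<and> ?D x \<noteq> 0}"
  have "?S = (- {0}) \<inter> ?D -` (- {0})" by auto
  moreover have "continuous_on (- {0}) ?D" unfolding pol_def by (intro continuous_intros) auto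
  ultimately show "open ?S"
    using continuous_open_preimage[of "- {0}" ?D "- {0}"] by (simp add: open_Compl)
  show "(\<lambda>x. x ^ i * (\<epsilon> / x) ^ j / ?D x * (1 / x)) holomorphic_on ?S"
    unfolding pol_def by (intro holomorphic_intros) (auto simp: pol_def)
  show "{x. \<rho> \<le> norm x} \<subseteq> ?S" using nz \<rho> by auto
  have inv: "((\<lambda>x::complex. inverse x) \<longlongrightarrow> 0) at_infinity" by (rule tendsto_inverse_0)
  \<comment> \<open>After division by \<open>x ^ p\<close> the denominator \<open>H\<close> tends to
    \<open>p\<close>, its leading coefficient.\<close>
  have 1: "((\<lambda>x. of_nat p + (\<Sum>k\<in>{1..<p}. of_nat k * a k * inverse x ^ (p - k)) -
      pol q b (\<epsilon> * inverse x) * inverse x ^ p) \<longlongrightarrow>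
      of_nat p + (\<Sum>k\<in>{1..<p}. of_nat k * a k * 0 ^ (p - k)) - pol q b (\<epsilon> * 0) * 0 ^ p) at_infinity"
    unfolding pol_def by (intro tendsto_intros inv)
  have 2: "of_nat p + (\<Sum>k\<in>{1..<p}. of_nat k * a k * 0 ^ (p - k)) - pol q b (\<epsilon> * 0) * 0 ^ p = of_nat p"
    using p by (auto intro!: sum.neutral simp: power_0_left)
  have 3: "((\<lambda>x. \<epsilon> ^ j * inverse x ^ (p + j - i)) \<longlongrightarrow> \<epsilon> ^ j * 0 ^ (p + j - i)) at_infinity"
    by (intro tendsto_intros inv)
  have "((\<lambda>x. \<epsilon> ^ j * inverse x ^ (p + j - i) / (of_nat p + (\<Sum>k\<in>{1..<p}. of_nat k * a k * inverse x ^ (p - k)) -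
      pol q b (\<epsilon> * inverse x) * inverse x ^ p)) \<longlongrightarrow> \<epsilon> ^ j * 0 ^ (p + j - i) / of_nat p) at_infinity"
    using tendsto_divide[OF 3 1[unfolded 2]] p by simp
  then have lim: "((\<lambda>x. \<epsilon> ^ j * inverse x ^ (p + j - i) / (of_nat p + (\<Sum>k\<in>{1..<p}. of_nat k * a k * inverse x ^ (p - k)) -
      pol q b (\<epsilon> * inverse x) * inverse x ^ p)) \<longlongrightarrow> 0) at_infinity"
    using ij by (simp add: power_0_left)
  have ev: "eventually (\<lambda>x::complex. x \<noteq> 0) at_infinity"
    unfolding eventually_at_infinity by (rule exI[of _ 1]) auto
  show "((\<lambda>x. x * (x ^ i * (\<epsilon> / x) ^ j / ?D x * (1 / x))) \<longlongrightarrow> 0) at_infinity"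
  proof (rule Lim_transform_eventually[OF lim eventually_mono[OF ev]])
    fix x :: complex assume x: "x \<noteq> 0"
    have k: "x ^ p * (inverse x ^ (p - k)) = x ^ k" if "k \<le> p" for k
      using that x by (simp add: power_inverse field_simps flip: power_add)
    have D: "?D x = x ^ p * (of_nat p + (\<Sum>k\<in>{1..<p}. of_nat k * a k * inverse x ^ (p - k)) -
      pol q b (\<epsilon> * inverse x) * inverse x ^ p)" (is "_ = _ * ?E")
    proof -
      have "x ^ p * (\<Sum>k\<in>{1..<p}. of_nat k * a k * inverse x ^ (p - k)) = (\<Sum>k\<in>{1..<p}. of_nat k * a k * x ^ k)"
        unfolding sum_distrib_left by (intro sum.cong refl) (simp add: k mult.left_commute)
      moreover have "x ^ p * (pol q b (\<epsilon> * inverse x) * inverse x ^ p) = pol q b (\<epsilon> / x)"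
        using x by (simp add: power_inverse divide_inverse)
      ultimately show ?thesis
        unfolding right_diff_distrib distrib_left by (simp add: pol_def[of p] mult.commute)
    qed
    have e: "x ^ i * (\<epsilon> / x) ^ j = x ^ p * (\<epsilon> ^ j * inverse x ^ (p + j - i))"
    proof -
      have "x ^ (p + j) = x ^ i * x ^ (p + j - i)" using ij by (simp flip: power_add)
      then show ?thesis using x
        by (simp add: power_divide power_inverse power_add field_simps)
    qed
    show "\<epsilon> ^ j * inverse x ^ (p + j - i) / ?E = x * (x ^ i * (\<epsilon> / x) ^ j / ?D x * (1 / x))"
      unfolding D e using x by simp
  qed
qed (rule \<rho>)

lemma xint_sum:
  "finite I \<Longrightarrow> (\<And>i. i \<in> I \<Longrightarrow> xcont \<epsilon> \<rho> (F i)) \<Longrightarrow>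
   xint p q a b \<epsilon> \<rho> (\<lambda>x y. \<Sum>i\<in>I. F i x y) = (\<Sum>i\<in>I. xint p q a b \<epsilon> \<rho> (F i))"
proof (induction I rule: finite_induct)
  case empty
  then show ?case by (simp add: xint_def)
next
  case (insert i I)
  then show ?case using xint_add[of "F i" "\<lambda>x y. \<Sum>i\<in>I. F i x y"] by (simp add: xcont_sum)
qed

lemma xint_pol_y: "xint p q a b \<epsilon> \<rho> (\<lambda>x y. pol n d y) = 0"
proof -
  have c: "xcont \<epsilon> \<rho> (\<lambda>x y. y ^ j)" "xcont \<epsilon> \<rho> (\<lambda>x y. c * y ^ j)" for c j
    by (intro xcont_mult xcont_const xcont_power xcont_y \<rho>)+
  have "xint p q a b \<epsilon> \<rho> (\<lambda>x y. y ^ j) = 0" for j using xint_monom[of 0 j] p by simp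
  then show ?thesis
    unfolding pol_def by (simp add: xint_add xint_sum xint_cmult c xcont_sum)
qed

end

text \<open>The normal form at one point of the base: \<open>h\<close> is the coefficient of
  \<epsilon> \<partial>/\<partial>\<epsilon>, and \<open>A\<close>, \<open>B\<close>,
  \<open>c\<close> are the components along the parameters.\<close>

definition nform :: "nat \<Rightarrow> nat \<Rightarrow> (nat \<Rightarrow> complex) \<Rightarrow> complex \<Rightarrow> (nat \<Rightarrow> complex) \<Rightarrow> (nat \<Rightarrow> complex) \<Rightarrow> complex \<Rightarrow>
    complex \<Rightarrow> complex \<Rightarrow> complex" where
  "nform p q a h A B c x y =
     h * pol p a x + (\<Sum>i\<in>{1..<p}. A i * x ^ i) + (\<Sum>j\<in>{1..<q}. B j * y ^ j) + c"

text \<open>Up to \<open>2 pi i\<close>, the residue pairing of \<open>\<Sum> A_i x ^ i\<close> with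
  \<open>\<Sum> A'_j x ^ j\<close>; its matrix is of Hankel type.\<close>

definition gram :: "nat \<Rightarrow> (nat \<Rightarrow> complex) \<Rightarrow> (nat \<Rightarrow> complex) \<Rightarrow> (nat \<Rightarrow> complex) \<Rightarrow> complex" where
  "gram p a A A' = (\<Sum>i\<in>{1..<p}. \<Sum>j\<in>{1..<p}.
     (if p \<le> i + j then kap p a (i + j - p) else 0) * A i * A' j)"

locale fibre = X: half_fibre p q a b \<epsilon> \<rho> + Y: half_fibre q p b a \<epsilon> \<rho>
  for p q :: nat and a b :: "nat \<Rightarrow> complex" and \<epsilon> :: complex and \<rho> :: real +
  assumes \<epsilon>: "norm \<epsilon> < \<rho>\<^sup>2"

text \<open>Transfers statements about powers of \<open>x\<close> to powers of
  \<open>y\<close>.\<close>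

lemma (in fibre) swapped: "fibre q p b a \<epsilon> \<rho>"
  by unfold_locales (rule \<epsilon>)

section \<open>The residue functional of one fibre\<close>

context fibre
begin

definition res :: "(complex \<Rightarrow> complex \<Rightarrow> complex) \<Rightarrow> complex" where
  "res G = xint p q a b \<epsilon> \<rho> G + xint q p b a \<epsilon> \<rho> (\<lambda>x y. G y x)"

definition adm :: "(complex \<Rightarrow> complex \<Rightarrow> complex) \<Rightarrow> bool" where
  "adm G \<longleftrightarrow> xcont \<epsilon> \<rho> G \<and> xcont \<epsilon> \<rho> (\<lambda>x y. G y x)"

lemma adm_intros:
  "adm (\<lambda>x y. c)" "adm (\<lambda>x y. x)" "adm (\<lambda>x y. y)"
  "adm G \<Longrightarrow> adm G' \<Longrightarrow> adm (\<lambda>x y. G x y + G' x y)"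
  "adm G \<Longrightarrow> adm G' \<Longrightarrow> adm (\<lambda>x y. G x y - G' x y)"
  "adm G \<Longrightarrow> adm G' \<Longrightarrow> adm (\<lambda>x y. G x y * G' x y)"
  "adm G \<Longrightarrow> adm (\<lambda>x y. G x y ^ n)"
  "(\<And>i. i \<in> I \<Longrightarrow> adm (F i)) \<Longrightarrow> adm (\<lambda>x y. \<Sum>i\<in>I. F i x y)"
  unfolding adm_def using X.\<rho>
  by (auto intro: xcont_const xcont_x xcont_y xcont_add xcont_diff xcont_mult xcont_power xcont_sum)

lemma adm_pol: "adm (\<lambda>x y. pol n d x)" "adm (\<lambda>x y. pol n d y)"
  unfolding pol_def by (intro adm_intros)+

lemma res_add: "adm G \<Longrightarrow> adm G' \<Longrightarrow> res (\<lambda>x y. G x y + G' x y) = res G + res G'"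
  unfolding res_def adm_def by (simp add: X.xint_add Y.xint_add)

lemma res_cmult: "adm G \<Longrightarrow> res (\<lambda>x y. c * G x y) = c * res G"
  unfolding res_def adm_def by (simp add: X.xint_cmult Y.xint_cmult distrib_left)

lemma res_cong_circles:
  "(\<And>x y. x * y = \<epsilon> \<Longrightarrow> norm x = \<rho> \<or> norm y = \<rho> \<Longrightarrow> G x y = G' x y) \<Longrightarrow> res G = res G'"
  unfolding res_def using X.xint_cong[of G G'] Y.xint_cong[of "\<lambda>x y. G y x" "\<lambda>x y. G' y x"]
  by (simp add: mult.commute)

lemma res_cong: "(\<And>x y. x * y = \<epsilon> \<Longrightarrow> G x y = G' x y) \<Longrightarrow> res G = res G'"
  using res_cong_circles by blast

lemma res_zero: "res (\<lambda>x y. 0) = 0"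
  by (simp add: res_def xint_def)

lemma res_sum: "(\<And>i. i \<in> I \<Longrightarrow> adm (F i)) \<Longrightarrow> res (\<lambda>x y. \<Sum>i\<in>I. F i x y) = (\<Sum>i\<in>I. res (F i))"
proof (induction I rule: infinite_finite_induct)
  case (insert i I)
  then show ?case using res_add[of "F i" "\<lambda>x y. \<Sum>i\<in>I. F i x y"] by (simp add: adm_intros)
qed (simp_all add: res_zero)

text \<open>The first inequality gives decay where \<open>x\<close> is large, the second where
  \<open>y\<close> is large.\<close>

lemma res_monom: "i < p + j \<Longrightarrow> j < q + i \<Longrightarrow> res (\<lambda>x y. x ^ i * y ^ j) = 0"
  unfolding res_def using X.xint_monom[of i j] Y.xint_monom[of j i] by (simp add: mult.commute)

text \<open>\<open>H\<close> cancels in the integrand, leaving \<open>K dx / x\<close> and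
  \<open>- K dy / y\<close> on the two boundary components, whose integrals cancel.\<close>

lemma res_mult_H:
  assumes r: "\<rho> < r"
    and K: "\<epsilon> \<noteq> 0 \<Longrightarrow> (\<lambda>x. K x (\<epsilon> / x)) holomorphic_on {x. x \<noteq> 0 \<and> norm x < r \<and> norm (\<epsilon> / x) < r}"
    and K0: "\<epsilon> = 0 \<Longrightarrow> (\<lambda>x. K x 0) holomorphic_on ball 0 r \<and> (\<lambda>y. K 0 y) holomorphic_on ball 0 r"
  shows "res (\<lambda>x y. (pol p a x - pol q b y) * K x y) = 0"
proof -
  have "xint p q a b \<epsilon> \<rho> (\<lambda>x y. (pol p a x - pol q b y) * K x y) =
      contour_integral (circlepath 0 \<rho>) (\<lambda>x. K x (\<epsilon> / x) / x)"
    unfolding xint_def by (rule contour_integral_eq) (use X.nz X.\<rho> in auto)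
  moreover have "xint q p b a \<epsilon> \<rho> (\<lambda>x y. (pol p a y - pol q b x) * K y x) =
      contour_integral (circlepath 0 \<rho>) (\<lambda>y. - (K (\<epsilon> / y) y / y))"
    unfolding xint_def
  proof (rule contour_integral_eq)
    fix y assume "y \<in> path_image (circlepath 0 \<rho>)"
    then have "pol q b y - pol p a (\<epsilon> / y) \<noteq> 0" using Y.nz[of y] Y.\<rho> by auto
    then have "(pol p a (\<epsilon> / y) - pol q b y) / (pol q b y - pol p a (\<epsilon> / y)) = - 1"
      by (simp add: divide_eq_minus_1_iff)
    then have "(pol p a (\<epsilon> / y) - pol q b y) / (pol q b y - pol p a (\<epsilon> / y)) * (K (\<epsilon> / y) y / y) = - (K (\<epsilon> / y) y / y)"
      by simp
    then show "(pol p a (\<epsilon> / y) - pol q b y) * K (\<epsilon> / y) y / (pol q b y - pol p a (\<epsilon> / y)) * (1 / y) = - (K (\<epsilon> / y) y / y)"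
      by simp
  qed
  ultimately show ?thesis
    using boundary_integrals_eq[OF X.\<rho> r \<epsilon> K K0]
    by (simp add: res_def contour_integral_neg)
qed

text \<open>The hypothesis holds for polynomials in \<open>x\<close> and \<open>y\<close>; the outer
  radius is arbitrary above \<open>\<rho>\<close>.\<close>

lemma res_mult_H_poly:
  assumes "\<And>S f g. f holomorphic_on S \<Longrightarrow> g holomorphic_on S \<Longrightarrow> (\<lambda>x. K (f x) (g x)) holomorphic_on S"
  shows "res (\<lambda>x y. (pol p a x - pol q b y) * K x y) = 0"
  by (rule res_mult_H[of "\<rho> + 1"]) (auto intro!: assms holomorphic_intros)

lemma res_pol_x: "adm M \<Longrightarrow> res (\<lambda>x y. pol n d x * M x y) =
    of_nat n * res (\<lambda>x y. x ^ n * M x y) + (\<Sum>i\<in>{1..<n}. of_nat i * d i * res (\<lambda>x y. x ^ i * M x y))"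
proof -
  assume M: "adm M"
  have "res (\<lambda>x y. pol n d x * M x y) =
    res (\<lambda>x y. of_nat n * (x ^ n * M x y) + (\<Sum>i\<in>{1..<n}. of_nat i * d i * (x ^ i * M x y)))"
    by (rule res_cong) (simp add: pol_def distrib_right sum_distrib_right mult.assoc)
  also have "\<dots> = of_nat n * res (\<lambda>x y. x ^ n * M x y) + (\<Sum>i\<in>{1..<n}. of_nat i * d i * res (\<lambda>x y. x ^ i * M x y))"
    by (simp add: res_add res_sum res_cmult adm_intros M)
  finally show ?thesis .
qed

lemma res_pol_y: "adm M \<Longrightarrow> res (\<lambda>x y. pol n d y * M x y) =
    of_nat n * res (\<lambda>x y. y ^ n * M x y) + (\<Sum>i\<in>{1..<n}. of_nat i * d i * res (\<lambda>x y. y ^ i * M x y))"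
proof -
  assume M: "adm M"
  have "res (\<lambda>x y. pol n d y * M x y) =
    res (\<lambda>x y. of_nat n * (y ^ n * M x y) + (\<Sum>i\<in>{1..<n}. of_nat i * d i * (y ^ i * M x y)))"
    by (rule res_cong) (simp add: pol_def distrib_right sum_distrib_right mult.assoc)
  also have "\<dots> = of_nat n * res (\<lambda>x y. y ^ n * M x y) + (\<Sum>i\<in>{1..<n}. of_nat i * d i * res (\<lambda>x y. y ^ i * M x y))"
    by (simp add: res_add res_sum res_cmult adm_intros M)
  finally show ?thesis .
qed

text \<open>\<open>pol p a x\<close> and \<open>pol q b y\<close> differ by \<open>H\<close> on the
  fibre.\<close>

lemma res_swap_P_Q:
  assumes "adm M"
    and "\<And>S f g. f holomorphic_on S \<Longrightarrow> g holomorphic_on S \<Longrightarrow> (\<lambda>x. M (f x) (g x)) holomorphic_on S"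
  shows "res (\<lambda>x y. pol p a x * M x y) = res (\<lambda>x y. pol q b y * M x y)"
proof -
  have "res (\<lambda>x y. pol p a x * M x y) =
      res (\<lambda>x y. (pol p a x - pol q b y) * M x y + pol q b y * M x y)"
    by (rule res_cong) (simp add: algebra_simps)
  also have "\<dots> = res (\<lambda>x y. (pol p a x - pol q b y) * M x y) + res (\<lambda>x y. pol q b y * M x y)"
    by (intro res_add adm_intros(5,6) adm_pol assms(1))
  also have "res (\<lambda>x y. (pol p a x - pol q b y) * M x y) = 0"
    by (rule res_mult_H_poly) (rule assms(2))
  finally show ?thesis by simp
qed

text \<open>Every monomial \<open>x ^ i * y ^ j\<close> with \<open>1 \<le> i \<le> p\<close> that
  occurs decays at both ends.\<close>

lemma res_P_y: "1 \<le> j \<Longrightarrow> j \<le> q \<Longrightarrow> res (\<lambda>x y. pol p a x * y ^ j) = 0"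
  using X.p X.q by (subst res_pol_x) (auto intro!: adm_intros sum.neutral simp: res_monom)

text \<open>The term \<open>x ^ (p + i)\<close> does not decay, so \<open>pol p a x\<close> is first
  exchanged for \<open>pol q b y\<close> modulo \<open>H\<close>; then every monomial
  decays.\<close>

lemma res_P_x:
  assumes "1 \<le> i" "i < p"
  shows "res (\<lambda>x y. pol p a x * x ^ i) = 0"
proof -
  have "res (\<lambda>x y. pol p a x * x ^ i) = res (\<lambda>x y. pol q b y * x ^ i)"
    by (intro res_swap_P_Q adm_intros holomorphic_intros)
  also have "\<dots> = 0"
    using assms res_monom[of i] 
    by (subst res_pol_y) (auto intro!: adm_intros sum.neutral simp: mult.commute)
  finally show ?thesis .
qed

text \<open>Exchanging one factor for \<open>pol q b y\<close> modulo \<open>H\<close> reduces this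
  to \<open>res_P_y\<close>.\<close>

lemma res_P_P: "res (\<lambda>x y. pol p a x * pol p a x) = 0"
proof -
  have "res (\<lambda>x y. pol p a x * pol p a x) = res (\<lambda>x y. pol q b y * pol p a x)"
    unfolding pol_def[of p a] by (rule res_swap_P_Q[unfolded pol_def[of p a]]) (intro adm_intros holomorphic_intros)+
  also have "\<dots> = 0"
    using X.q res_P_y by (subst res_pol_y) (auto intro!: adm_pol sum.neutral simp: mult.commute)
  finally show ?thesis .
qed

text \<open>The source of all nonzero residues: with \<open>pol p a x = H + pol q b y\<close>, the
  part \<open>H\<close> contributes the integral of \<open>dx / x\<close> over the
  \<open>x\<close>-circle, the part \<open>pol q b y\<close> decays there, and the
  \<open>y\<close>-circle contributes nothing.\<close>

lemma res_P: "res (\<lambda>x y. pol p a x) = 2 * of_real pi * \<i>"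
proof -
  have x: "xcont \<epsilon> \<rho> (\<lambda>x y. pol q b y)" and x1: "xcont \<epsilon> \<rho> (\<lambda>x y. pol p a x - pol q b y)"
    using adm_pol[of q b] adm_pol[of p a] xcont_diff by (auto simp: adm_def)
  have "xint p q a b \<epsilon> \<rho> (\<lambda>x y. pol p a x - pol q b y) = contour_integral (circlepath 0 \<rho>) (\<lambda>x. 1 / (x - 0))"
    unfolding xint_def by (rule contour_integral_eq) (use X.nz X.\<rho> in auto)
  also have "\<dots> = 2 * of_real pi * \<i>"
    using Cauchy_integral_circlepath_simple[of "\<lambda>_. 1" 0 \<rho> 0] X.\<rho> by (intro contour_integral_unique) auto
  finally have "xint p q a b \<epsilon> \<rho> (\<lambda>x y. (pol p a x - pol q b y) + pol q b y) = 2 * of_real pi * \<i>"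
    by (subst X.xint_add) (simp_all add: x x1 X.xint_pol_y)
  then show ?thesis by (simp add: res_def Y.xint_pol_y)
qed

text \<open>Expanding the known residue of \<open>pol p a x * x ^ m\<close>, which is nonzero only
  for \<open>m = 0\<close>, gives the recursion that defines \<open>kap\<close>.\<close>

lemma res_x_power: "m < p \<Longrightarrow> res (\<lambda>x y. x ^ (p + m)) = 2 * of_real pi * \<i> * kap p a m"
proof (induction m rule: less_induct)
  case (less m)
  have low: "res (\<lambda>x y. x ^ n) = 0" if "n < p" for n
    using res_monom[of n 0] that X.q by simp
  have "of_nat p * res (\<lambda>x y. x ^ (p + m)) + (\<Sum>i\<in>{1..<p}. of_nat i * a i * res (\<lambda>x y. x ^ (i + m))) =
      res (\<lambda>x y. pol p a x * x ^ m)"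
    by (subst res_pol_x) (auto intro!: adm_intros simp: power_add)
  also have "\<dots> = (if m = 0 then 2 * of_real pi * \<i> else 0)"
    using res_P res_P_x less.prems by simp
  also have "(\<Sum>i\<in>{1..<p}. of_nat i * a i * res (\<lambda>x y. x ^ (i + m))) =
     (\<Sum>l\<in>{1..<p}. of_nat (p - l) * a (p - l) * res (\<lambda>x y. x ^ (p - l + m)))"
    by (rule sum.reindex_bij_witness[where i = "\<lambda>m. p - m" and j = "\<lambda>m. p - m"]) auto
  also have "\<dots> = (\<Sum>l\<in>{1..<p}. 2 * of_real pi * \<i> *
      (if l \<le> m then of_nat (p - l) * a (p - l) * kap p a (m - l) else 0))"
  proof (rule sum.cong[OF refl])
    fix l assume l: "l \<in> {1..<p}"
    show "of_nat (p - l) * a (p - l) * res (\<lambda>x y. x ^ (p - l + m)) =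
      2 * of_real pi * \<i> * (if l \<le> m then of_nat (p - l) * a (p - l) * kap p a (m - l) else 0)"
    proof (cases "l \<le> m")
      case True
      then have "p - l + m = p + (m - l)" using l by auto
      then show ?thesis using less.IH[of "m - l"] less.prems True l by simp
    next
      case False
      then show ?thesis using low[of "p - l + m"] l by auto
    qed
  qed
  finally have e: "of_nat p * res (\<lambda>x y. x ^ (p + m)) =
      (if m = 0 then 2 * of_real pi * \<i> else 0) - 2 * of_real pi * \<i> *
      (\<Sum>l\<in>{1..<p}. if l \<le> m then of_nat (p - l) * a (p - l) * kap p a (m - l) else 0)"
    by (simp add: sum_distrib_left eq_diff_eq)
  have "of_nat p * res (\<lambda>x y. x ^ (p + m)) = of_nat p * (2 * of_real pi * \<i> * kap p a m)"
  proof (cases "m = 0")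
    case True
    then show ?thesis using e X.p by (simp add: kap_0)
  next
    case False
    have "of_nat p * (2 * of_real pi * \<i> * kap p a m) = 2 * of_real pi * \<i> * (of_nat p * kap p a m)"
      by (simp only: mult.left_commute)
    also have "of_nat p * kap p a m =
        - (\<Sum>l\<in>{1..<p}. if l \<le> m then of_nat (p - l) * a (p - l) * kap p a (m - l) else 0)"
      by (rule kap_rec[OF X.p]) (use False in simp)
    finally show ?thesis unfolding e using False by (simp only: if_False mult_minus_right diff_0)
  qed
  then show ?case using X.p by simp
qed

lemma res_x: "i < p \<Longrightarrow> j < p \<Longrightarrow> res (\<lambda>x y. x ^ i * x ^ j) =
    2 * of_real pi * \<i> * (if p \<le> i + j then kap p a (i + j - p) else 0)"
proof (cases "p \<le> i + j")
  case True
  then have "p + (i + j - p) = i + j" by simp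
  moreover assume "i < p" "j < p"
  ultimately show ?thesis using True res_x_power[of "i + j - p"] by (simp flip: power_add)
next
  case False
  then show ?thesis using res_monom[of "i + j" 0] X.q by (simp flip: power_add)
qed

end

lemma (in fibre) res_swapped: "fibre.res q p b a \<epsilon> \<rho> G = res (\<lambda>x y. G y x)"
  unfolding res_def fibre.res_def[OF swapped] by simp

section \<open>The Gram matrix of normal forms\<close>

context fibre
begin

lemma res_y: "i < q \<Longrightarrow> j < q \<Longrightarrow> res (\<lambda>x y. y ^ i * y ^ j) =
    2 * of_real pi * \<i> * (if q \<le> i + j then kap q b (i + j - q) else 0)"
  using fibre.res_x[OF swapped, of i j] unfolding res_swapped .

lemma adm_nform: "adm (nform p q a h A B c)"
  unfolding nform_def[abs_def] by (intro adm_intros adm_pol)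

lemma res_nform_mult:
  assumes M: "adm M"
  shows "res (\<lambda>x y. nform p q a h A B c x y * M x y) = h * res (\<lambda>x y. pol p a x * M x y)
    + (\<Sum>i\<in>{1..<p}. A i * res (\<lambda>x y. x ^ i * M x y))
    + (\<Sum>j\<in>{1..<q}. B j * res (\<lambda>x y. y ^ j * M x y)) + c * res M"
proof -
  have "res (\<lambda>x y. nform p q a h A B c x y * M x y) = res (\<lambda>x y. h * (pol p a x * M x y)
    + (\<Sum>i\<in>{1..<p}. A i * (x ^ i * M x y)) + (\<Sum>j\<in>{1..<q}. B j * (y ^ j * M x y)) + c * M x y)"
    by (rule res_cong) (simp add: nform_def distrib_right sum_distrib_right mult.assoc)
  then show ?thesis by (simp add: res_add res_sum res_cmult adm_intros adm_pol M)
qed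

text \<open>\<open>1\<close> and \<open>pol p a x\<close> are isotropic and dual to each other, and
  the blocks of powers of \<open>x\<close> and of \<open>y\<close> are orthogonal to them and to one
  another.\<close>

lemma res_nform:
  shows "res (nform p q a h A B c) = 2 * of_real pi * \<i> * h"
    and "res (\<lambda>x y. nform p q a h A B c x y * pol p a x) = 2 * of_real pi * \<i> * c"
    and "1 \<le> k \<Longrightarrow> k < p \<Longrightarrow> res (\<lambda>x y. nform p q a h A B c x y * x ^ k) =
      2 * of_real pi * \<i> * (\<Sum>i\<in>{1..<p}. A i * (if p \<le> i + k then kap p a (i + k - p) else 0))"
    and "1 \<le> k \<Longrightarrow> k < q \<Longrightarrow> res (\<lambda>x y. nform p q a h A B c x y * y ^ k) =
      2 * of_real pi * \<i> * (\<Sum>j\<in>{1..<q}. B j * (if q \<le> j + k then kap q b (j + k - q) else 0))"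
proof -
  have x0: "res (\<lambda>x y. x ^ i) = 0" if "i < p" for i using res_monom[of i 0] that X.q by simp
  have y0: "res (\<lambda>x y. y ^ i) = 0" if "i < q" for i using res_monom[of 0 i] that X.p by simp
  have 1: "res (\<lambda>x y. 1) = 0" using x0[of 0] X.p by simp
  have xy: "res (\<lambda>x y. x ^ i * y ^ j) = 0" "res (\<lambda>x y. y ^ j * x ^ i) = 0" if "i < p" "j < q" for i j
    using res_monom[of i j] that by (auto simp: mult.commute)
  have xP: "res (\<lambda>x y. x ^ i * pol p a x) = 0" if "1 \<le> i" "i < p" for i
    using res_P_x[OF that] by (simp add: mult.commute)
  have yP: "res (\<lambda>x y. y ^ j * pol p a x) = 0" if "1 \<le> j" "j < q" for j
    using res_P_y[of j] that by (simp add: mult.commute)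
  show "res (nform p q a h A B c) = 2 * of_real pi * \<i> * h"
    using res_nform_mult[OF adm_intros(1), of h A B c 1] by (simp add: res_P x0 y0 1)
  show "res (\<lambda>x y. nform p q a h A B c x y * pol p a x) = 2 * of_real pi * \<i> * c"
    by (subst res_nform_mult) (auto simp: adm_pol res_P_P xP yP res_P intro!: sum.neutral)
  show "res (\<lambda>x y. nform p q a h A B c x y * x ^ k) =
      2 * of_real pi * \<i> * (\<Sum>i\<in>{1..<p}. A i * (if p \<le> i + k then kap p a (i + k - p) else 0))"
    if k: "1 \<le> k" "k < p"
  proof -
    have "res (\<lambda>x y. nform p q a h A B c x y * x ^ k) =
       (\<Sum>i\<in>{1..<p}. A i * (2 * of_real pi * \<i> * (if p \<le> i + k then kap p a (i + k - p) else 0)))"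
      using k by (subst res_nform_mult) (auto simp: adm_intros res_P_x res_x xy x0 intro!: sum.cong)
    then show ?thesis by (simp add: sum_distrib_left mult.left_commute)
  qed
  show "res (\<lambda>x y. nform p q a h A B c x y * y ^ k) =
      2 * of_real pi * \<i> * (\<Sum>j\<in>{1..<q}. B j * (if q \<le> j + k then kap q b (j + k - q) else 0))"
    if k: "1 \<le> k" "k < q"
  proof -
    have "res (\<lambda>x y. nform p q a h A B c x y * y ^ k) =
       (\<Sum>j\<in>{1..<q}. B j * (2 * of_real pi * \<i> * (if q \<le> j + k then kap q b (j + k - q) else 0)))"
      using k by (subst res_nform_mult) (auto simp: adm_intros res_P_y res_y xy y0 intro!: sum.cong)
    then show ?thesis by (simp add: sum_distrib_left mult.left_commute)
  qed
qed

lemma res_nform_nform: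
  "res (\<lambda>x y. nform p q a h A B c x y * nform p q a h' A' B' c' x y) =
    2 * of_real pi * \<i> * (h * c' + c * h' + gram p a A A' + gram q b B B')"
proof -
  let ?N = "nform p q a h A B c"
  note [simp] = adm_nform
  have c: "res (\<lambda>x y. M x y * ?N x y) = res (\<lambda>x y. ?N x y * M x y)" for M
    by (rule res_cong) simp
  have "res (\<lambda>x y. ?N x y * nform p q a h' A' B' c' x y) = res (\<lambda>x y. nform p q a h' A' B' c' x y * ?N x y)"
    by (rule c[symmetric])
  also have "\<dots> = h' * (2 * of_real pi * \<i> * c)
    + (\<Sum>k\<in>{1..<p}. A' k * (2 * of_real pi * \<i> * (\<Sum>i\<in>{1..<p}. A i * (if p \<le> i + k then kap p a (i + k - p) else 0))))
    + (\<Sum>k\<in>{1..<q}. B' k * (2 * of_real pi * \<i> * (\<Sum>j\<in>{1..<q}. B j * (if q \<le> j + k then kap q b (j + k - q) else 0))))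
    + c' * (2 * of_real pi * \<i> * h)"
    unfolding res_nform_mult[OF adm_nform] c by (simp add: res_nform)
  also have "(\<Sum>k\<in>{1..<p}. A' k * (2 * of_real pi * \<i> * (\<Sum>i\<in>{1..<p}. A i * (if p \<le> i + k then kap p a (i + k - p) else 0)))) =
     2 * of_real pi * \<i> * gram p a A A'"
    unfolding gram_def sum_distrib_left by (subst sum.swap) (intro sum.cong refl; simp)
  also have "(\<Sum>k\<in>{1..<q}. B' k * (2 * of_real pi * \<i> * (\<Sum>i\<in>{1..<q}. B i * (if q \<le> i + k then kap q b (i + k - q) else 0)))) =
     2 * of_real pi * \<i> * gram q b B B'"
    unfolding gram_def sum_distrib_left by (subst sum.swap) (intro sum.cong refl; simp)
  finally show ?thesis by (simp add: algebra_simps)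
qed

end

text \<open>The Hankel matrix is triangular with respect to the antidiagonal
  \<open>i + j = p\<close>, where its entries are \<open>kap p a 0 = 1 / p\<close>. Testing with the
  unit vector at \<open>p - m\<close>, for the largest \<open>m\<close> with
  \<open>A m \<noteq> 0\<close>, isolates \<open>A m\<close>.\<close>

lemma gram_nondegenerate:
  assumes "p \<ge> 1" "\<And>k. k \<in> {1..<p} \<Longrightarrow> gram p a A (\<lambda>j. if j = k then 1 else 0) = 0" "i \<in> {1..<p}"
  shows "A i = 0"
proof (rule ccontr)
  assume "A i \<noteq> 0"
  define S where "S = {i \<in> {1..<p}. A i \<noteq> 0}"
  have S: "finite S" "S \<noteq> {}" using assms(3) \<open>A i \<noteq> 0\<close> by (auto simp: S_def)
  define m where "m = Max S"
  have "m \<in> S" using S Max_in by (auto simp: m_def)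
  then have m: "m \<in> {1..<p}" "A m \<noteq> 0" by (auto simp: S_def)
  have m0: "A j = 0" if "j \<in> {1..<p}" "j > m" for j
    using Max_ge[OF S(1), of j] that by (fastforce simp: S_def m_def)
  have k: "p - m \<in> {1..<p}" using m by auto
  have "gram p a A (\<lambda>j. if j = p - m then 1 else 0) =
      (\<Sum>i\<in>{1..<p}. (if p \<le> i + (p - m) then kap p a (i + (p - m) - p) else 0) * A i)"
    unfolding gram_def using k by (intro sum.cong refl) (simp add: if_distrib[where f = "\<lambda>x. _ * x"] cong: if_cong)
  also have "\<dots> = (\<Sum>i\<in>{1..<p}. if i = m then kap p a 0 * A m else 0)"
    using m m0 by (intro sum.cong refl) (auto simp: not_less_iff_gr_or_eq not_less)
  also have "\<dots> = A m / of_nat p" using m by (simp add: kap_0)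
  finally show False using assms(1) assms(2)[OF k] m by simp
qed

section \<open>The ring of holomorphic functions and the Jacobian ideal\<close>

lemma cholo_restrict:
  fixes f :: "'a::cvec \<Rightarrow> complex"
  shows "f cholo_on S \<Longrightarrow> open S \<Longrightarrow> restrict f S cholo_on S"
  by (rule cholo_on_cong) auto

lemma cring_holo_ring:
  assumes S: "open (S :: 'a::cvec set)"
  shows "cring (holo_ring S)"
proof (rule cringI)
  let ?R = "holo_ring S"
  show "abelian_group ?R"
  proof (rule abelian_groupI)
    fix f assume f: "f \<in> carrier ?R"
    have "restrict (\<lambda>z. - f z) S \<in> carrier ?R"
      using f S by (auto simp: holo_ring_def intro!: cholo_restrict cholo_intros)
    then show "\<exists>g\<in>carrier ?R. g \<oplus>\<^bsub>?R\<^esub> f = \<zero>\<^bsub>?R\<^esub>"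
      by (rule bexI[rotated]) (auto simp: holo_ring_def fun_eq_iff)
  qed (use S in \<open>auto simp: holo_ring_def fun_eq_iff extensional_def add_ac intro!: cholo_restrict cholo_intros\<close>)
  show "comm_monoid ?R"
    by (rule comm_monoidI)
      (use S in \<open>auto simp: holo_ring_def fun_eq_iff extensional_def mult_ac intro!: cholo_restrict cholo_intros\<close>)
qed (auto simp: holo_ring_def fun_eq_iff distrib_right)

section \<open>The projection and the derivatives of F and H\<close>

lemma proj_eq: "proj z = (fst z * fst (snd z), snd (snd z))"
  by (cases z) (auto simp: proj_def)

lemma tube_iff: "z \<in> tube r U \<longleftrightarrow> norm (fst z) < r \<and> norm (fst (snd z)) < r \<and> proj z \<in> U"
  by (cases z) (auto simp: tube_def)

lemma proj_tube: "z \<in> tube r U \<Longrightarrow> proj z \<in> U"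
  by (simp add: tube_iff)

lemma tube_mono: "U \<subseteq> V \<Longrightarrow> tube r U \<subseteq> tube r V"
  by (auto simp: tube_iff)

lemma cholo_proj: "proj cholo_on S"
  unfolding proj_eq[abs_def] by (intro cholo_intros)

lemma open_tube:
  assumes "open U"
  shows "open (tube r U)"
proof -
  have "tube r U = {z. norm (fst z) < r} \<inter> {z. norm (fst (snd z)) < r} \<inter> proj -` U"
    by (auto simp: tube_iff)
  moreover have "open (proj -` U)"
    by (rule open_vimage[OF assms cholo_on_continuous_on[OF cholo_proj]])
  ultimately show ?thesis
    by (auto intro!: open_Int open_Collect_less continuous_intros)
qed

lemma cholo_compose_proj [cholo_intros]:
  fixes f :: "'m::finite base \<Rightarrow> 'b::cvec"
  shows "f cholo_on U \<Longrightarrow> (\<lambda>z. f (proj z)) cholo_on tube r U"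
  by (rule cholo_compose[OF _ cholo_proj]) (auto simp: proj_tube)

definition apar :: "(param \<Rightarrow> 'm::finite) \<Rightarrow> complex ^ 'm \<Rightarrow> nat \<Rightarrow> complex" where
  "apar ix s i = s $ ix (PA i)"

definition bpar :: "(param \<Rightarrow> 'm::finite) \<Rightarrow> complex ^ 'm \<Rightarrow> nat \<Rightarrow> complex" where
  "bpar ix s i = s $ ix (PB i)"

definition dpol :: "nat \<Rightarrow> (nat \<Rightarrow> complex) \<Rightarrow> complex \<Rightarrow> complex" where
  "dpol p a x = of_nat p * x ^ (p - 1) + (\<Sum>i\<in>{1..<p}. of_nat i * a i * x ^ (i - 1))"

text \<open>The derivative of \<open>F\<close> along the parameter direction
  \<open>v\<close>.\<close>

definition smono :: "nat \<Rightarrow> nat \<Rightarrow> (param \<Rightarrow> 'm::finite) \<Rightarrow> complex ^ 'm \<Rightarrow> complex \<Rightarrow> complex \<Rightarrow> complex" where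
  "smono p q ix v x y = v $ ix PC + (\<Sum>i\<in>{1..<p}. v $ ix (PA i) * x ^ i) + (\<Sum>i\<in>{1..<q}. v $ ix (PB i) * y ^ i)"

lemma mult_dpol: "p \<ge> 1 \<Longrightarrow> x * dpol p a x = pol p a x"
proof -
  assume p: "p \<ge> 1"
  have e: "x * x ^ (i - 1) = x ^ i" if "i \<ge> 1" for i using that by (cases i) auto
  have "x * dpol p a x = of_nat p * (x * x ^ (p - 1)) + (\<Sum>i\<in>{1..<p}. of_nat i * a i * (x * x ^ (i - 1)))"
    by (simp add: dpol_def distrib_left sum_distrib_left mult.left_commute)
  also have "\<dots> = pol p a x"
    unfolding pol_def e[OF p] by (intro arg_cong2[where f = "(+)"] sum.cong refl) (simp add: e del: One_nat_def)
  finally show ?thesis .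
qed

lemma has_derivative_Fdef:
  "(Fdef p q ix has_derivative (\<lambda>v. fst v * dpol p (apar ix (snd (snd z))) (fst z) +
      fst (snd v) * dpol q (bpar ix (snd (snd z))) (fst (snd z)) +
      smono p q ix (snd (snd v)) (fst z) (fst (snd z)))) (at z)"
proof -
  have c: "((\<lambda>z. snd (snd z) $ k) has_derivative (\<lambda>v. snd (snd v) $ k)) (at z)" for k
    by (intro bounded_linear.has_derivative[OF bounded_linear_vec_nth] has_derivative_snd has_derivative_ident)
  have x: "((\<lambda>z. fst z ^ i) has_derivative (\<lambda>v. fst v * (of_nat i * fst z ^ (i - 1)))) (at z)" for i
    by (auto intro!: derivative_eq_intros simp: mult_ac)
  have y: "((\<lambda>z. fst (snd z) ^ i) has_derivative (\<lambda>v. fst (snd v) * (of_nat i * fst (snd z) ^ (i - 1)))) (at z)" for i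
    by (auto intro!: derivative_eq_intros simp: mult_ac)
  have F: "Fdef p q ix = (\<lambda>z. snd (snd z) $ ix PC + (\<Sum>i\<in>{1..<p}. snd (snd z) $ ix (PA i) * fst z ^ i) + fst z ^ p
               + (\<Sum>i\<in>{1..<q}. snd (snd z) $ ix (PB i) * fst (snd z) ^ i) + fst (snd z) ^ q)"
    by (simp add: Fdef_def split_def)
  have 1: "((\<lambda>z. \<Sum>i\<in>{1..<p}. snd (snd z) $ ix (PA i) * fst z ^ i) has_derivative
      (\<lambda>v. \<Sum>i\<in>{1..<p}. snd (snd z) $ ix (PA i) * (fst v * (of_nat i * fst z ^ (i - 1))) +
        snd (snd v) $ ix (PA i) * fst z ^ i)) (at z)"
    by (rule has_derivative_sum) (rule has_derivative_mult[OF c x])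
  have 2: "((\<lambda>z. \<Sum>i\<in>{1..<q}. snd (snd z) $ ix (PB i) * fst (snd z) ^ i) has_derivative
      (\<lambda>v. \<Sum>i\<in>{1..<q}. snd (snd z) $ ix (PB i) * (fst (snd v) * (of_nat i * fst (snd z) ^ (i - 1))) +
        snd (snd v) $ ix (PB i) * fst (snd z) ^ i)) (at z)"
    by (rule has_derivative_sum) (rule has_derivative_mult[OF c y])
  have "(Fdef p q ix has_derivative (\<lambda>v. snd (snd v) $ ix PC +
      (\<Sum>i\<in>{1..<p}. snd (snd z) $ ix (PA i) * (fst v * (of_nat i * fst z ^ (i - 1))) +
        snd (snd v) $ ix (PA i) * fst z ^ i) + fst v * (of_nat p * fst z ^ (p - 1)) +
      (\<Sum>i\<in>{1..<q}. snd (snd z) $ ix (PB i) * (fst (snd v) * (of_nat i * fst (snd z) ^ (i - 1))) +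
        snd (snd v) $ ix (PB i) * fst (snd z) ^ i) + fst (snd v) * (of_nat q * fst (snd z) ^ (q - 1)))) (at z)"
    unfolding F by (intro has_derivative_add c 1 2 x y)
  then show ?thesis
    by (rule has_derivative_eq_rhs)
      (simp add: fun_eq_iff dpol_def smono_def apar_def bpar_def sum.distrib sum_distrib_left algebra_simps)
qed

lemma frechet_proj: "frechet_derivative proj (at z) v =
    (fst z * fst (snd v) + fst v * fst (snd z), snd (snd v))"
proof -
  have "((\<lambda>z. (fst z * fst (snd z), snd (snd z))) has_derivative
      (\<lambda>v. (fst z * fst (snd v) + fst v * fst (snd z), snd (snd v)))) (at z)"
    by (intro has_derivative_Pair has_derivative_mult has_derivative_fst has_derivative_snd has_derivative_ident)
  from frechet_derivative_at[OF this] show ?thesis unfolding proj_eq[abs_def] by (simp add: fun_eq_iff)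
qed

lemma vderiv_Fdef: "vderiv V (Fdef p q ix) z =
      fst (V z) * dpol p (apar ix (snd (snd z))) (fst z) +
      fst (snd (V z)) * dpol q (bpar ix (snd (snd z))) (fst (snd z)) +
      smono p q ix (snd (snd (V z))) (fst z) (fst (snd z))"
  unfolding vderiv_def using fun_cong[OF frechet_derivative_at[OF has_derivative_Fdef[of p q ix z]], of "V z"] by simp

lemma Hdef_eq:
  assumes "p \<ge> 1" "q \<ge> 1"
  shows "Hdef p q ix z = pol p (apar ix (snd (snd z))) (fst z) - pol q (bpar ix (snd (snd z))) (fst (snd z))"
proof -
  obtain x y s where z: "z = (x, y, s)" by (metis prod.collapse)
  have "((\<lambda>t. Fdef p q ix (t, y, s)) has_field_derivative dpol p (apar ix s) x) (at x)"
    unfolding Fdef_def split_conv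
    by (rule derivative_eq_intros refl)+
      (simp add: dpol_def apar_def algebra_simps)
  then have 1: "deriv (\<lambda>t. Fdef p q ix (t, y, s)) x = dpol p (apar ix s) x" by (rule DERIV_imp_deriv)
  have "((\<lambda>t. Fdef p q ix (x, t, s)) has_field_derivative dpol q (bpar ix s) y) (at y)"
    unfolding Fdef_def split_conv
    by (rule derivative_eq_intros refl)+
      (simp add: dpol_def bpar_def algebra_simps)
  then have 2: "deriv (\<lambda>t. Fdef p q ix (x, t, s)) y = dpol q (bpar ix s) y" by (rule DERIV_imp_deriv)
  show ?thesis using assms by (simp add: z Hdef_def 1 2 mult_dpol)
qed

lemma cholo_pol [cholo_intros]:
  fixes x :: "'a::cvec \<Rightarrow> complex"
  assumes "\<And>i. i \<in> {1..<p} \<Longrightarrow> (\<lambda>z. a z i) cholo_on S" "x cholo_on S"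
  shows "(\<lambda>z. pol p (a z) (x z)) cholo_on S"
  unfolding pol_def by (intro cholo_intros assms)

lemma cholo_apar [cholo_intros]: 
  fixes s :: "'a::cvec \<Rightarrow> complex ^ 'm::finite"
  shows "s cholo_on S \<Longrightarrow> (\<lambda>z. apar ix (s z) i) cholo_on S"
  unfolding apar_def by (intro cholo_intros)

lemma cholo_bpar [cholo_intros]: 
  fixes s :: "'a::cvec \<Rightarrow> complex ^ 'm::finite"
  shows "s cholo_on S \<Longrightarrow> (\<lambda>z. bpar ix (s z) i) cholo_on S"
  unfolding bpar_def by (intro cholo_intros)

lemma cholo_Hdef:
  assumes "p \<ge> 1" "q \<ge> 1"
  shows "Hdef p q ix cholo_on S"
proof -
  have "Hdef p q ix = (\<lambda>z. pol p (apar ix (snd (snd z))) (fst z) - pol q (bpar ix (snd (snd z))) (fst (snd z)))"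
    by (rule ext) (rule Hdef_eq[OF assms])
  then show ?thesis by (simp only:) (intro cholo_intros)
qed

text \<open>Congruence modulo \<open>H\<close> for total functions. Values off the tube do not
  matter, so the restrictions built into \<open>holo_ring\<close> enter only through
  \<open>jclass\<close>.\<close>

definition congH :: "nat \<Rightarrow> nat \<Rightarrow> (param \<Rightarrow> 'm::finite) \<Rightarrow> real \<Rightarrow> 'm base set \<Rightarrow>
    ('m total \<Rightarrow> complex) \<Rightarrow> ('m total \<Rightarrow> complex) \<Rightarrow> bool" where
  "congH p q ix r U G G' \<longleftrightarrow>
     (\<exists>K. K cholo_on tube r U \<and> (\<forall>z\<in>tube r U. G z = G' z + Hdef p q ix z * K z))"

section \<open>Cosets in the Jacobian ring and congruences of functions\<close>

definition jclass :: "nat \<Rightarrow> nat \<Rightarrow> (param \<Rightarrow> 'm::finite) \<Rightarrow> real \<Rightarrow> 'm base set \<Rightarrow>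
    ('m total \<Rightarrow> complex) \<Rightarrow> ('m total \<Rightarrow> complex) set" where
  "jclass p q ix r U G = a_r_coset (holo_ring (tube r U)) (jac_ideal p q ix r U) (restrict G (tube r U))"

lemma restrict_in_carrier:
  "open U \<Longrightarrow> G cholo_on tube r U \<Longrightarrow> restrict G (tube r U) \<in> carrier (holo_ring (tube r U))"
  using open_tube by (auto simp: holo_ring_def intro: cholo_restrict)

lemma ideal_jac_ideal:
  assumes "p \<ge> 1" "q \<ge> 1" "open U"
  shows "ideal (jac_ideal p q ix r U) (holo_ring (tube r U))"
  unfolding jac_ideal_def
  by (intro cring.cgenideal_ideal cring_holo_ring open_tube restrict_in_carrier cholo_Hdef assms)

lemma mem_jclassD:
  assumes "g \<in> jclass p q ix r U G"
  shows "congH p q ix r U g G"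
proof -
  let ?T = "tube r U"
  obtain k where k: "k \<in> carrier (holo_ring ?T)"
    and g: "g = k \<otimes>\<^bsub>holo_ring ?T\<^esub> restrict (Hdef p q ix) ?T \<oplus>\<^bsub>holo_ring ?T\<^esub> restrict G ?T"
    using assms unfolding jclass_def a_r_coset_def' jac_ideal_def cgenideal_def by auto
  then have "k cholo_on ?T" "\<forall>z\<in>?T. g z = G z + Hdef p q ix z * k z"
    by (auto simp: holo_ring_def)
  then show ?thesis unfolding congH_def by blast
qed

lemma restrict_mem_jclass:
  assumes U: "open U" and K: "K cholo_on tube r U"
    and G: "\<forall>z\<in>tube r U. G z = G' z + Hdef p q ix z * K z"
  shows "restrict G (tube r U) \<in> jclass p q ix r U G'"
proof -
  let ?T = "tube r U"
  have "restrict K ?T \<in> carrier (holo_ring ?T)" by (rule restrict_in_carrier[OF U K])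
  moreover have "restrict G ?T = restrict K ?T \<otimes>\<^bsub>holo_ring ?T\<^esub> restrict (Hdef p q ix) ?T \<oplus>\<^bsub>holo_ring ?T\<^esub> restrict G' ?T"
    using G by (auto simp: holo_ring_def fun_eq_iff)
  ultimately show ?thesis
    unfolding jclass_def a_r_coset_def' jac_ideal_def cgenideal_def by blast
qed

lemma congH_refl: "congH p q ix r U G G"
  unfolding congH_def by (rule exI[of _ "\<lambda>_. 0"]) (auto intro: cholo_intros)

lemma congH_sym:
  assumes "congH p q ix r U G G'"
  shows "congH p q ix r U G' G"
proof -
  obtain K where "K cholo_on tube r U" "\<forall>z\<in>tube r U. G z = G' z + Hdef p q ix z * K z"
    using assms unfolding congH_def by blast
  then show ?thesis unfolding congH_def by (intro exI[of _ "\<lambda>z. - K z"]) (auto intro: cholo_intros)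
qed

lemma congH_trans:
  assumes "congH p q ix r U G G'" "congH p q ix r U G' G''"
  shows "congH p q ix r U G G''"
proof -
  obtain K K' where "K cholo_on tube r U" "\<forall>z\<in>tube r U. G z = G' z + Hdef p q ix z * K z"
     "K' cholo_on tube r U" "\<forall>z\<in>tube r U. G' z = G'' z + Hdef p q ix z * K' z"
    using assms unfolding congH_def by blast
  then show ?thesis unfolding congH_def
    by (intro exI[of _ "\<lambda>z. K z + K' z"]) (auto intro: cholo_intros simp: distrib_left)
qed

lemma congH_add:
  assumes "congH p q ix r U G G'" "congH p q ix r U M M'"
  shows "congH p q ix r U (\<lambda>z. G z + M z) (\<lambda>z. G' z + M' z)"
proof -
  obtain K K' where "K cholo_on tube r U" "\<forall>z\<in>tube r U. G z = G' z + Hdef p q ix z * K z"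
     "K' cholo_on tube r U" "\<forall>z\<in>tube r U. M z = M' z + Hdef p q ix z * K' z"
    using assms unfolding congH_def by blast
  then show ?thesis unfolding congH_def
    by (intro exI[of _ "\<lambda>z. K z + K' z"]) (auto intro: cholo_intros simp: distrib_left)
qed

lemma congH_cmult:
  assumes "congH p q ix r U G G'" "M cholo_on tube r U"
  shows "congH p q ix r U (\<lambda>z. M z * G z) (\<lambda>z. M z * G' z)"
proof -
  obtain K where "K cholo_on tube r U" "\<forall>z\<in>tube r U. G z = G' z + Hdef p q ix z * K z"
    using assms unfolding congH_def by blast
  then show ?thesis unfolding congH_def using assms(2)
    by (intro exI[of _ "\<lambda>z. M z * K z"]) (auto intro: cholo_intros simp: distrib_left)
qed

lemma congH_eq_on: "(\<And>z. z \<in> tube r U \<Longrightarrow> G z = G' z) \<Longrightarrow> congH p q ix r U G G'"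
  unfolding congH_def by (rule exI[of _ "\<lambda>_. 0"]) (auto intro: cholo_intros)

lemma congH_subset: "congH p q ix r U G G' \<Longrightarrow> V \<subseteq> U \<Longrightarrow> congH p q ix r V G G'"
  unfolding congH_def using tube_mono[of V U r] cholo_on_subset by blast

context
  fixes p q :: nat and ix :: "param \<Rightarrow> 'm::finite" and r :: real and U :: "'m base set"
  assumes p: "p \<ge> 1" and q: "q \<ge> 1" and U: "open U"
begin

text \<open>The bridge from the quotient ring to congruences, in which all later reasoning takes
  place.\<close>

lemma jclass_eq_iff:
  assumes "G cholo_on tube r U" "G' cholo_on tube r U"
  shows "jclass p q ix r U G = jclass p q ix r U G' \<longleftrightarrow> congH p q ix r U G G'"
proof -
  let ?R = "holo_ring (tube r U)"
  interpret cring ?R by (rule cring_holo_ring[OF open_tube[OF U]])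
  interpret ideal "jac_ideal p q ix r U" ?R by (rule ideal_jac_ideal[OF p q U])
  have a: "abelian_subgroup (jac_ideal p q ix r U) ?R"
    by (rule abelian_subgroupI3[OF is_additive_subgroup is_abelian_group])
  show ?thesis
  proof
    assume eq: "jclass p q ix r U G = jclass p q ix r U G'"
    have "restrict G (tube r U) \<in> jclass p q ix r U G"
      by (rule restrict_mem_jclass[OF U cholo_const[of 0]]) auto
    then have "congH p q ix r U (restrict G (tube r U)) G'" unfolding eq by (rule mem_jclassD)
    then show "congH p q ix r U G G'" by (simp add: congH_def)
  next
    assume "congH p q ix r U G G'"
    then have "restrict G (tube r U) \<in> jclass p q ix r U G'"
      unfolding congH_def using restrict_mem_jclass[OF U] by blast
    then show "jclass p q ix r U G = jclass p q ix r U G'"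
      unfolding jclass_def
      by (intro abelian_subgroup.a_repr_independence'[OF a, symmetric] restrict_in_carrier U assms)
  qed
qed

lemma jclass_mult:
  assumes "G cholo_on tube r U" "G' cholo_on tube r U"
  shows "jclass p q ix r U G \<otimes>\<^bsub>jac_ring p q ix r U\<^esub> jclass p q ix r U G' = jclass p q ix r U (\<lambda>z. G z * G' z)"
proof -
  have "restrict G (tube r U) \<otimes>\<^bsub>holo_ring (tube r U)\<^esub> restrict G' (tube r U) = restrict (\<lambda>z. G z * G' z) (tube r U)"
    by (auto simp: holo_ring_def fun_eq_iff)
  then show ?thesis
    unfolding jclass_def jac_ring_def
    using ideal.rcoset_mult_add[OF ideal_jac_ideal[OF p q U] restrict_in_carrier[OF U assms(1)]
        restrict_in_carrier[OF U assms(2)], of ix]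
    by (simp add: FactRing_def)
qed

lemma jclass_carrier:
  assumes "G cholo_on tube r U"
  shows "jclass p q ix r U G \<in> carrier (jac_ring p q ix r U)"
proof -
  let ?R = "holo_ring (tube r U)"
  interpret cring ?R by (rule cring_holo_ring[OF open_tube[OF U]])
  interpret ideal "jac_ideal p q ix r U" ?R by (rule ideal_jac_ideal[OF p q U])
  show ?thesis
    unfolding jclass_def jac_ring_def FactRing_def
    using a_rcosetsI[OF a_subset restrict_in_carrier[OF U assms]] by simp
qed

lemma jclass_one: "\<one>\<^bsub>jac_ring p q ix r U\<^esub> = jclass p q ix r U (\<lambda>_. 1)"
  by (simp add: jac_ring_def FactRing_def jclass_def holo_ring_def)

end

section \<open>Normal forms of logarithmic vector fields\<close>

text \<open>The function \<open>h\<close> with \<open>d\<epsilon>(u) = \<epsilon> h\<close>; it is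
  holomorphic across the discriminant because \<open>d\<epsilon>(u)\<close> vanishes there for a
  logarithmic field.\<close>

definition hco :: "('m::finite base \<Rightarrow> 'm base) \<Rightarrow> 'm base \<Rightarrow> complex" where
  "hco u = div_fst (\<lambda>\<beta>. fst (u \<beta>))"

definition nfd :: "nat \<Rightarrow> nat \<Rightarrow> (param \<Rightarrow> 'm::finite) \<Rightarrow> ('m base \<Rightarrow> complex) \<Rightarrow> (nat \<Rightarrow> 'm base \<Rightarrow> complex) \<Rightarrow>
    (nat \<Rightarrow> 'm base \<Rightarrow> complex) \<Rightarrow> ('m base \<Rightarrow> complex) \<Rightarrow> 'm total \<Rightarrow> complex" where
  "nfd p q ix h A B c z = nform p q (apar ix (snd (snd z))) (h (proj z)) (\<lambda>i. A i (proj z))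
     (\<lambda>i. B i (proj z)) (c (proj z)) (fst z) (fst (snd z))"

definition nff :: "nat \<Rightarrow> nat \<Rightarrow> (param \<Rightarrow> 'm::finite) \<Rightarrow> ('m base \<Rightarrow> 'm base) \<Rightarrow> 'm total \<Rightarrow> complex" where
  "nff p q ix u = nfd p q ix (hco u) (\<lambda>i \<beta>. apar ix (snd (u \<beta>)) i) (\<lambda>i \<beta>. bpar ix (snd (u \<beta>)) i)
     (\<lambda>\<beta>. snd (u \<beta>) $ ix PC)"

lemma log_fields_cholo: "u \<in> log_fields U \<Longrightarrow> u cholo_on U"
  by (simp add: log_fields_def)

lemma log_fields_zero: "u \<in> log_fields U \<Longrightarrow> (0, s) \<in> U \<Longrightarrow> fst (u (0, s)) = 0"
  unfolding log_fields_def discr_def by fastforce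

lemma cholo_hco: "u \<in> log_fields U \<Longrightarrow> open U \<Longrightarrow> hco u cholo_on U"
  unfolding hco_def by (intro cholo_div_fst cholo_intros log_fields_cholo log_fields_zero)

lemma hco_mult: "u \<in> log_fields U \<Longrightarrow> \<beta> \<in> U \<Longrightarrow> fst \<beta> * hco u \<beta> = fst (u \<beta>)"
  unfolding hco_def by (rule fst_div_fst[where S = U]) (auto simp: log_fields_zero)

text \<open>Off the discriminant this is division; on it, density and continuity decide.\<close>

lemma hco_unique:
  assumes "u \<in> log_fields U" "open U" "h cholo_on U" "\<And>\<beta>. \<beta> \<in> U \<Longrightarrow> fst \<beta> * h \<beta> = fst (u \<beta>)" "\<beta> \<in> U"
  shows "hco u \<beta> = h \<beta>"
  by (rule cancel_fst[OF assms(2) cholo_on_continuous_on[OF cholo_hco[OF assms(1,2)]]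
        cholo_on_continuous_on[OF assms(3)] _ assms(5)])
    (use assms(4) hco_mult[OF assms(1)] in simp)

lemma log_fieldsI:
  assumes "u cholo_on U" "\<And>\<beta>. \<beta> \<in> U \<Longrightarrow> fst (u \<beta>) = fst \<beta> * h \<beta>"
  shows "u \<in> log_fields U"
  using assms by (auto simp: log_fields_def discr_def)

lemma log_fields_subset: "u \<in> log_fields U \<Longrightarrow> V \<subseteq> U \<Longrightarrow> u \<in> log_fields V"
  unfolding log_fields_def using cholo_on_subset by blast

lemma cholo_nform [cholo_intros]:
  fixes x y h c :: "'a::cvec \<Rightarrow> complex"
  assumes "\<And>i. i \<in> {1..<p} \<Longrightarrow> (\<lambda>z. a z i) cholo_on S" "\<And>i. i \<in> {1..<p} \<Longrightarrow> (\<lambda>z. A z i) cholo_on S"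
    "\<And>i. i \<in> {1..<q} \<Longrightarrow> (\<lambda>z. B z i) cholo_on S" "h cholo_on S" "c cholo_on S" "x cholo_on S" "y cholo_on S"
  shows "(\<lambda>z. nform p q (a z) (h z) (A z) (B z) (c z) (x z) (y z)) cholo_on S"
  unfolding nform_def by (intro cholo_intros assms)

lemma cholo_nfd:
  assumes "h cholo_on U" "\<And>i. i \<in> {1..<p} \<Longrightarrow> A i cholo_on U" "\<And>i. i \<in> {1..<q} \<Longrightarrow> B i cholo_on U" "c cholo_on U"
  shows "nfd p q ix h A B c cholo_on tube r U"
  unfolding nfd_def[abs_def] by (intro cholo_intros assms)

lemma cholo_nff: "u \<in> log_fields U \<Longrightarrow> open U \<Longrightarrow> nff p q ix u cholo_on tube r U"
  unfolding nff_def by (intro cholo_nfd cholo_hco cholo_intros log_fields_cholo)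

lemma log_fields_lincomb:
  assumes "u \<in> log_fields U" "v \<in> log_fields U" "f cholo_on U" "g cholo_on U"
  shows "(\<lambda>\<beta>. cscale (f \<beta>) (u \<beta>) + cscale (g \<beta>) (v \<beta>)) \<in> log_fields U"
  using assms by (auto simp: log_fields_def intro!: cholo_intros)

lemma hco_lincomb:
  assumes "u \<in> log_fields U" "v \<in> log_fields U" "f cholo_on U" "g cholo_on U" "open U" "\<beta> \<in> U"
  shows "hco (\<lambda>\<beta>. cscale (f \<beta>) (u \<beta>) + cscale (g \<beta>) (v \<beta>)) \<beta> = f \<beta> * hco u \<beta> + g \<beta> * hco v \<beta>"
proof (rule hco_unique[OF log_fields_lincomb[OF assms(1-4)] assms(5) _ _ assms(6)])
  show "(\<lambda>\<beta>. f \<beta> * hco u \<beta> + g \<beta> * hco v \<beta>) cholo_on U"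
    by (intro cholo_intros cholo_hco assms)
  fix \<gamma> assume \<gamma>: "\<gamma> \<in> U"
  have "fst \<gamma> * (f \<gamma> * hco u \<gamma> + g \<gamma> * hco v \<gamma>) = f \<gamma> * (fst \<gamma> * hco u \<gamma>) + g \<gamma> * (fst \<gamma> * hco v \<gamma>)"
    by (simp add: algebra_simps)
  then show "fst \<gamma> * (f \<gamma> * hco u \<gamma> + g \<gamma> * hco v \<gamma>) = fst (cscale (f \<gamma>) (u \<gamma>) + cscale (g \<gamma>) (v \<gamma>))"
    unfolding hco_mult[OF assms(1) \<gamma>] hco_mult[OF assms(2) \<gamma>] by simp
qed

lemma nff_lincomb:
  assumes "u \<in> log_fields U" "v \<in> log_fields U" "f cholo_on U" "g cholo_on U" "open U" "z \<in> tube r U"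
  shows "nff p q ix (\<lambda>\<beta>. cscale (f \<beta>) (u \<beta>) + cscale (g \<beta>) (v \<beta>)) z =
    f (proj z) * nff p q ix u z + g (proj z) * nff p q ix v z"
  unfolding nff_def nfd_def nform_def hco_lincomb[OF assms(1-5) proj_tube[OF assms(6)]]
  by (simp add: apar_def bpar_def algebra_simps sum.distrib sum_distrib_left)

lemma nff_diff:
  assumes "u \<in> log_fields U" "v \<in> log_fields U" "open U" "z \<in> tube r U"
  shows "nff p q ix (\<lambda>\<beta>. u \<beta> - v \<beta>) z = nff p q ix u z - nff p q ix v z"
proof -
  have e: "(\<lambda>\<beta>. cscale 1 (u \<beta>) + cscale (- 1) (v \<beta>)) = (\<lambda>\<beta>. u \<beta> - v \<beta>)"
    by (simp add: fun_eq_iff)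
  show ?thesis
    using nff_lincomb[OF assms(1,2) cholo_const cholo_const assms(3,4), of p q ix 1 "- 1"] unfolding e by simp
qed

lemma nform_eq_smono: "nform p q (apar ix s) h (apar ix v) (bpar ix v) (v $ ix PC) x y =
    h * pol p (apar ix s) x + smono p q ix v x y"
  by (simp add: nform_def smono_def apar_def bpar_def)

lemma nff_eq: "nff p q ix u z = hco u (proj z) * pol p (apar ix (snd (snd z))) (fst z) +
    smono p q ix (snd (u (proj z))) (fst z) (fst (snd z))"
  unfolding nff_def nfd_def by (simp add: nform_eq_smono[symmetric] eta_contract_eq)

text \<open>Since \<open>x \<partial>/\<partial>x\<close> takes \<open>x y\<close> to itself, it
  lifts \<epsilon> \<partial>/\<partial>\<epsilon>; the parameter components are kept.\<close>

definition std_lift :: "('m::finite base \<Rightarrow> 'm base) \<Rightarrow> 'm total \<Rightarrow> 'm total" where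
  "std_lift u z = (fst z * hco u (proj z), 0, snd (u (proj z)))"

lemma is_lift_std:
  assumes "u \<in> log_fields U" "open U"
  shows "is_lift r U u (std_lift u)"
proof -
  have "fst z * fst (snd z) * hco u (proj z) = fst (u (proj z))" if "z \<in> tube r U" for z
    using hco_mult[OF assms(1) proj_tube[OF that]] by (simp add: proj_eq)
  moreover have "std_lift u cholo_on tube r U"
    unfolding std_lift_def[abs_def] by (intro cholo_intros cholo_hco log_fields_cholo assms)
  ultimately show ?thesis
    unfolding is_lift_def by (auto simp: std_lift_def frechet_proj prod_eq_iff mult_ac)
qed

text \<open>Two lifts differ by a vertical field \<open>(d, e, 0)\<close> with \<open>y d + x e = 0\<close>, hence by a multiple of
  \<open>x \<partial>/\<partial>x - y \<partial>/\<partial>y\<close>, which takes \<open>F\<close> to \<open>H\<close>.\<close>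

lemma congH_lift:
  assumes u: "u \<in> log_fields U" and U: "open U" and ut: "is_lift r U u ut" and p: "p \<ge> 1" and q: "q \<ge> 1"
  shows "congH p q ix r U (vderiv ut (Fdef p q ix)) (nff p q ix u)"
proof -
  let ?T = "tube r U"
  note T = open_tube[OF U, of r]
  have hut: "ut cholo_on ?T" using ut by (simp add: is_lift_def)
  define d where "d z = fst (ut z) - fst z * hco u (proj z)" for z
  define e where "e z = fst (snd (ut z))" for z
  have dh: "d cholo_on ?T" unfolding d_def[abs_def] by (intro cholo_intros cholo_hco hut u U)
  have eh: "e cholo_on ?T" unfolding e_def[abs_def] by (intro cholo_intros hut)
  have lift: "fst z * e z + fst (ut z) * fst (snd z) = fst (u (proj z)) \<and> snd (snd (ut z)) = snd (u (proj z))"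
    if "z \<in> ?T" for z
    using ut that unfolding is_lift_def frechet_proj e_def by (auto simp: prod_eq_iff)
  have de: "fst (snd z) * d z = - (fst z * e z)" if "z \<in> ?T" for z
    using lift[OF that] hco_mult[OF u proj_tube[OF that]]
    by (simp add: d_def proj_eq algebra_simps)
  \<comment> \<open>On \<open>x = 0\<close> the relation \<open>de\<close> reads
    \<open>y d = 0\<close>, and \<open>y\<close> is cancelled by density. The auxiliary map puts
    \<open>y\<close> in the first coordinate, as \<open>cancel_fst\<close> expects; the second
    coordinate of its argument is a dummy.\<close>
  have d0: "d (0, w) = 0" if w: "(0, w) \<in> ?T" for w
  proof -
    let ?\<iota> = "\<lambda>v :: complex \<times> complex. (0 :: complex, fst v, snd w)"
    let ?S = "?\<iota> -` ?T"
    have c: "continuous_on UNIV ?\<iota>" by (intro continuous_intros)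
    have "open ?S" by (rule open_vimage[OF T c])
    moreover have "continuous_on ?S (\<lambda>v. d (?\<iota> v))"
      by (rule continuous_on_compose2[OF cholo_on_continuous_on[OF dh] continuous_on_subset[OF c]]) auto
    ultimately have "d (?\<iota> (fst w, 0)) = (\<lambda>_. 0) (fst w, 0 :: complex)"
      by (rule cancel_fst[where f = "\<lambda>v. d (?\<iota> v)"]) (use de w in force)+
    then show ?thesis by simp
  qed
  define k where "k = div_fst d"
  have kh: "k cholo_on ?T" unfolding k_def by (rule cholo_div_fst[OF dh T d0])
  have dk: "fst z * k z = d z" if "z \<in> ?T" for z
    unfolding k_def by (rule fst_div_fst[where S = ?T]) (use d0 that in auto)
  \<comment> \<open>Multiplication by \<open>x\<close> turns this into the relation
    \<open>de\<close>; then \<open>x\<close> is cancelled.\<close>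
  have ek: "e z = - (fst (snd z) * k z)" if "z \<in> ?T" for z
  proof (rule cancel_fst[OF T _ _ _ that, where f = e and g = "\<lambda>z. - (fst (snd z) * k z)"])
    show "continuous_on ?T (\<lambda>z. - (fst (snd z) * k z))"
      by (intro cholo_on_continuous_on cholo_intros kh)
    fix z assume z: "z \<in> ?T"
    have "fst (snd z) * (fst z * k z) = - (fst z * e z)" unfolding dk[OF z] by (rule de[OF z])
    then show "fst z * e z = fst z * - (fst (snd z) * k z)"
      by (simp add: mult.left_commute minus_equation_iff)
  qed (rule cholo_on_continuous_on[OF eh])
  have "vderiv ut (Fdef p q ix) z = nff p q ix u z + Hdef p q ix z * k z" if z: "z \<in> ?T" for z
  proof -
    have f: "fst (ut z) = fst z * hco u (proj z) + fst z * k z" unfolding dk[OF z] by (simp add: d_def)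
    have "vderiv ut (Fdef p q ix) z = hco u (proj z) * (fst z * dpol p (apar ix (snd (snd z))) (fst z)) +
       k z * (fst z * dpol p (apar ix (snd (snd z))) (fst z)) -
       k z * (fst (snd z) * dpol q (bpar ix (snd (snd z))) (fst (snd z))) +
       smono p q ix (snd (u (proj z))) (fst z) (fst (snd z))"
      unfolding vderiv_Fdef using ek[OF z] lift[OF z]
      by (simp add: f e_def[symmetric] algebra_simps)
    then show ?thesis using p q by (simp add: mult_dpol nff_eq Hdef_eq algebra_simps)
  qed
  then show ?thesis unfolding congH_def using kh by blast
qed

section \<open>The multiplication and the pairing\<close>

lemma cholo_imp_holomorphic:
  fixes f :: "complex \<Rightarrow> complex"
  assumes "f cholo_on S"
  shows "f holomorphic_on S"
  unfolding holomorphic_on_def field_differentiable_def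
proof
  fix z assume z: "z \<in> S"
  have "(f has_field_derivative frechet_derivative f (at z) 1) (at z)"
    using has_field_derivative_line[of f S 0 z 1] assms z by simp
  then show "\<exists>f'. (f has_field_derivative f') (at z within S)"
    using has_field_derivative_at_within by blast
qed

lemma congH_cholo:
  assumes "congH p q ix r U G G'" "G' cholo_on tube r U" "open U" "p \<ge> 1" "q \<ge> 1"
  shows "G cholo_on tube r U"
proof -
  obtain K where K: "K cholo_on tube r U" "\<forall>z\<in>tube r U. G z = G' z + Hdef p q ix z * K z"
    using assms(1) unfolding congH_def by blast
  have "(\<lambda>z. G' z + Hdef p q ix z * K z) cholo_on tube r U"
    by (intro cholo_intros assms K cholo_Hdef)
  then show ?thesis by (rule cholo_on_cong) (use K open_tube assms in auto)
qed

text \<open>Any two lifts give the class of the same normal form, which eliminates the choice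
  operator in \<open>tF\<close>.\<close>

lemma tF_eq:
  assumes u: "u \<in> log_fields U" and U: "open U" and p: "p \<ge> 1" and q: "q \<ge> 1"
  shows "tF p q ix r U u = jclass p q ix r U (nff p q ix u)"
    and "is_lift r U u ut \<Longrightarrow> lift_class p q ix r U ut = jclass p q ix r U (nff p q ix u)"
proof -
  show *: "lift_class p q ix r U ut = jclass p q ix r U (nff p q ix u)" if "is_lift r U u ut" for ut
  proof -
    have c: "congH p q ix r U (vderiv ut (Fdef p q ix)) (nff p q ix u)"
      by (rule congH_lift[OF u U that p q])
    have "lift_class p q ix r U ut = jclass p q ix r U (vderiv ut (Fdef p q ix))"
      by (simp add: lift_class_def jclass_def)
    also have "\<dots> = jclass p q ix r U (nff p q ix u)"
      using c congH_cholo[OF c cholo_nff[OF u U] U p q] cholo_nff[OF u U]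
      by (subst jclass_eq_iff[OF p q U])
    finally show ?thesis .
  qed
  show "tF p q ix r U u = jclass p q ix r U (nff p q ix u)"
    unfolding tF_def by (rule *) (rule someI[where P = "is_lift r U u", OF is_lift_std[OF u U]])
qed

lemma log_fields_diff:
  assumes "u \<in> log_fields U" "v \<in> log_fields U"
  shows "(\<lambda>\<beta>. u \<beta> - v \<beta>) \<in> log_fields U"
  using log_fields_lincomb[OF assms cholo_const cholo_const, of 1 "- 1"] by simp

text \<open>The logarithmic field with prescribed normal form coefficients; \<open>inv_into\<close>
  turns a vector index back into its parameter label.\<close>

definition mkf :: "nat \<Rightarrow> nat \<Rightarrow> (param \<Rightarrow> 'm::finite) \<Rightarrow> ('m base \<Rightarrow> complex) \<Rightarrow> (nat \<Rightarrow> 'm base \<Rightarrow> complex) \<Rightarrow>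
    (nat \<Rightarrow> 'm base \<Rightarrow> complex) \<Rightarrow> ('m base \<Rightarrow> complex) \<Rightarrow> 'm base \<Rightarrow> 'm base" where
  "mkf p q ix h A B c \<beta> = (fst \<beta> * h \<beta>,
     \<chi> k. case inv_into (params p q) ix k of PA i \<Rightarrow> A i \<beta> | PB i \<Rightarrow> B i \<beta> | PC \<Rightarrow> c \<beta>)"

text \<open>The explicit value of the residue pairing: it depends only on the coefficients of
  \<open>u\<close> and \<open>v\<close> at the point and makes sense on the discriminant as
  well.\<close>

definition gform :: "nat \<Rightarrow> nat \<Rightarrow> (param \<Rightarrow> 'm::finite) \<Rightarrow> ('m base \<Rightarrow> 'm base) \<Rightarrow> ('m base \<Rightarrow> 'm base) \<Rightarrow>
    'm base \<Rightarrow> complex" where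
  "gform p q ix u v \<beta> = 2 * of_real pi * \<i> *
     (hco u \<beta> * snd (v \<beta>) $ ix PC + snd (u \<beta>) $ ix PC * hco v \<beta> +
      gram p (apar ix (snd \<beta>)) (apar ix (snd (u \<beta>))) (apar ix (snd (v \<beta>))) +
      gram q (bpar ix (snd \<beta>)) (bpar ix (snd (u \<beta>))) (bpar ix (snd (v \<beta>))))"

lemma gram_cong:
  assumes "\<And>i. i \<in> {1..<p} \<Longrightarrow> A i = A2 i" "\<And>i. i \<in> {1..<p} \<Longrightarrow> B i = B2 i"
  shows "gram p a A B = gram p a A2 B2"
  unfolding gram_def using assms by (intro sum.cong refl) simp

lemma gram_zero [simp]: "gram p a A (\<lambda>_. 0) = 0" "gram p a (\<lambda>_. 0) A = 0"
  by (simp_all add: gram_def)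

text \<open>Collects what is used of the smallness of the base. The condition \<open>fibre\<close>
  is asked for every appropriate radius, because the pairing works with an arbitrarily chosen
  one.\<close>

locale miniversal =
  fixes p q :: nat and ix :: "param \<Rightarrow> 'm::finite" and r \<delta> :: real
  assumes p: "p \<ge> 1" and q: "q \<ge> 1" and bij: "bij_betw ix (params p q) UNIV" and r: "0 < r"
    and fibre: "\<And>\<beta> \<rho>. \<beta> \<in> ball 0 \<delta> \<Longrightarrow> appropriate p q ix r \<beta> \<rho> \<Longrightarrow>
      fibre p q (apar ix (snd \<beta>)) (bpar ix (snd \<beta>)) (fst \<beta>) \<rho>"
    and appropriate_ex: "\<And>\<beta>. \<beta> \<in> ball 0 \<delta> \<Longrightarrow> \<exists>\<rho>. appropriate p q ix r \<beta> \<rho>"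

section \<open>Choice of a small ball in the base\<close>

lemma norm_apar_le: "norm (apar ix s i) \<le> norm s"
  and norm_bpar_le: "norm (bpar ix s i) \<le> norm s"
  unfolding apar_def bpar_def by (rule Finite_Cartesian_Product.norm_nth_le)+

text \<open>Separation, applied with each of the two axes in turn, confines the zeros of
  \<open>H\<close> over a small ball to \<open>norm x < \<rho>0\<close>,
  \<open>norm y < \<rho>0\<close>.\<close>

lemma miniversal_exists:
  assumes p: "p \<ge> 1" and q: "q \<ge> 1" and bij: "bij_betw ix (params p q) UNIV" and r: "0 < r"
  shows "\<exists>\<delta>>0. miniversal p q (ix :: param \<Rightarrow> 'm::finite) r \<delta>"
proof -
  \<comment> \<open>Below \<open>r\<close>, so that it can serve as a cutting radius, and at most
    \<open>1\<close>, as the separation estimate requires.\<close>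
  define \<rho>0 where "\<rho>0 = min r 1 / 2"
  have \<rho>0: "0 < \<rho>0" "\<rho>0 \<le> 1" "\<rho>0 < r" using r by (auto simp: \<rho>0_def min_def)
  obtain \<delta>1 where \<delta>1: "\<delta>1 > 0" "\<And>a b x y. norm (x * y) < \<delta>1 \<Longrightarrow> (\<And>i. norm (a i) < \<delta>1) \<Longrightarrow>
    (\<And>i. norm (b i) < \<delta>1) \<Longrightarrow> \<rho>0 \<le> norm x \<Longrightarrow> pol p a x \<noteq> pol q b y"
    using pol_separation[OF p q \<rho>0(1,2)] by metis
  obtain \<delta>2 where \<delta>2: "\<delta>2 > 0" "\<And>a b x y. norm (x * y) < \<delta>2 \<Longrightarrow> (\<And>i. norm (a i) < \<delta>2) \<Longrightarrow>
    (\<And>i. norm (b i) < \<delta>2) \<Longrightarrow> \<rho>0 \<le> norm x \<Longrightarrow> pol q a x \<noteq> pol p b y"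
    using pol_separation[OF q p \<rho>0(1,2)] by metis
  \<comment> \<open>The bound \<open>\<rho>0\<^sup>2\<close> gives the inequality between \<epsilon>
    and the radius that \<open>appropriate\<close> contains.\<close>
  define \<delta> where "\<delta> = min (min \<delta>1 \<delta>2) (\<rho>0\<^sup>2)"
  have \<delta>: "\<delta> > 0" "\<delta> \<le> \<delta>1" "\<delta> \<le> \<delta>2" "\<delta> \<le> \<rho>0\<^sup>2" using \<delta>1 \<delta>2 \<rho>0 by (auto simp: \<delta>_def)
  have sep: "pol p (apar ix s) x \<noteq> pol q (bpar ix s) y"
    if b: "(\<epsilon>, s) \<in> ball 0 \<delta>" and xy: "x * y = \<epsilon>" "\<rho>0 \<le> norm x \<or> \<rho>0 \<le> norm y" for \<epsilon> s x y
  proof -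
    have n: "norm (\<epsilon>, s) < \<delta>" using b by simp
    have s: "norm s < \<delta>" using n norm_snd_le[of s \<epsilon>] by linarith
    have e: "norm \<epsilon> < \<delta>" using n norm_fst_le[of \<epsilon> s] by linarith
    have "norm (apar ix s i) < \<delta>" "norm (bpar ix s i) < \<delta>" for i
      using norm_apar_le[of ix s i] norm_bpar_le[of ix s i] s by linarith+
    then have ab: "norm (apar ix s i) < \<delta>1" "norm (bpar ix s i) < \<delta>1"
       "norm (apar ix s i) < \<delta>2" "norm (bpar ix s i) < \<delta>2" for i
      using \<delta> by (meson order_less_le_trans)+
    show ?thesis
    proof (cases "\<rho>0 \<le> norm x")
      case True
      show ?thesis by (rule \<delta>1(2)) (use e xy \<delta> ab True in auto)
    next
      case False
      then have "\<rho>0 \<le> norm y" using xy by simp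
      have "pol q (bpar ix s) y \<noteq> pol p (apar ix s) x"
        by (rule \<delta>2(2)) (use e xy \<delta> ab \<open>\<rho>0 \<le> norm y\<close> in \<open>auto simp: mult.commute\<close>)
      then show ?thesis by simp
    qed
  qed
  have "miniversal p q ix r \<delta>"
  proof (rule miniversal.intro)
    fix \<beta> :: "'m base" assume b: "\<beta> \<in> ball 0 \<delta>"
    obtain \<epsilon> s where \<beta>: "\<beta> = (\<epsilon>, s)" by (cases \<beta>)
    have "norm \<epsilon> < \<delta>" using b norm_fst_le[of \<epsilon> s] by (simp add: \<beta>)
    then have "norm \<epsilon> < \<rho>0\<^sup>2" using \<delta> by linarith
    moreover have "norm x < \<rho>0 \<and> norm y < \<rho>0"
      if "(x, y, s') \<in> tube r {\<beta>} \<and> Hdef p q ix (x, y, s') = 0" for x y s'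
    proof -
      have "x * y = \<epsilon>" "s' = s" using that by (auto simp: tube_iff proj_eq \<beta>)
      moreover have "pol p (apar ix s') x = pol q (bpar ix s') y"
        using that Hdef_eq[OF p q, of ix "(x, y, s')"] by simp
      ultimately have "\<not> (\<rho>0 \<le> norm x \<or> \<rho>0 \<le> norm y)" using sep[of \<epsilon> s x y] b \<beta> by blast
      then show ?thesis by simp
    qed
    ultimately have "appropriate p q ix r \<beta> \<rho>0" unfolding appropriate_def using \<rho>0 by (auto simp: \<beta>)
    then show "\<exists>\<rho>. appropriate p q ix r \<beta> \<rho>" by blast
    fix \<rho> assume ap: "appropriate p q ix r \<beta> \<rho>"
    then have \<rho>: "0 < \<rho>" "\<rho> < r" "norm \<epsilon> < \<rho>\<^sup>2" by (auto simp: appropriate_def \<beta>)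
    have small: "norm (\<epsilon> / x) < \<rho>" if "\<rho> \<le> norm x" for x
    proof -
      have "\<rho> * \<rho> \<le> \<rho> * norm x" using that \<rho>(1) by (intro mult_left_mono) auto
      then have "norm \<epsilon> < \<rho> * norm x" using \<rho>(3) unfolding power2_eq_square by linarith
      then show ?thesis using that \<rho>(1) by (simp add: norm_divide divide_less_eq)
    qed
    \<comment> \<open>For an arbitrary appropriate \<open>\<rho>\<close>, zeros within the tube are
      excluded by \<open>appropriate\<close> and those beyond it by \<open>sep\<close>, because
      \<open>\<rho>0 < r\<close>.\<close>
    have nz: "pol p (apar ix s) x \<noteq> pol q (bpar ix s) y"
      if xy: "x * y = \<epsilon>" and big: "\<rho> \<le> norm x \<and> norm y < \<rho> \<or> \<rho> \<le> norm y \<and> norm x < \<rho>" for x y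
    proof (cases "norm x < r \<and> norm y < r")
      case True
      then have "(x, y, s) \<in> tube r {\<beta>}" using xy by (simp add: tube_iff proj_eq \<beta>)
      then have "Hdef p q ix (x, y, s) \<noteq> 0" using ap big unfolding appropriate_def by fastforce
      then show ?thesis using Hdef_eq[OF p q, of ix "(x, y, s)"] by simp
    next
      case False
      then show ?thesis using \<rho>0 b xy by (intro sep) (auto simp: \<beta>)
    qed
    have "half_fibre p q (apar ix s) (bpar ix s) \<epsilon> \<rho>"
    proof
      fix x :: complex assume "\<rho> \<le> norm x"
      then show "pol p (apar ix s) x \<noteq> pol q (bpar ix s) (\<epsilon> / x)"
        using \<rho>(1) small[of x] by (intro nz) auto
    qed (use p q \<rho> in auto)
    moreover have "half_fibre q p (bpar ix s) (apar ix s) \<epsilon> \<rho>"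
    proof
      fix y :: complex assume "\<rho> \<le> norm y"
      then have "pol p (apar ix s) (\<epsilon> / y) \<noteq> pol q (bpar ix s) y"
        using \<rho>(1) small[of y] by (intro nz) auto
      then show "pol q (bpar ix s) y \<noteq> pol p (apar ix s) (\<epsilon> / y)" by simp
    qed (use p q \<rho> in auto)
    ultimately show "fibre p q (apar ix (snd \<beta>)) (bpar ix (snd \<beta>)) (fst \<beta>) \<rho>"
      using \<rho>(3) by (simp add: fibre_def fibre_axioms_def \<beta>)
  qed (use assms in auto)
  then show ?thesis using \<delta> by blast
qed

section \<open>Residues of normal forms over a small ball\<close>

context miniversal
begin

lemma inv_ix: "l \<in> params p q \<Longrightarrow> inv_into (params p q) ix (ix l) = l"
  using bij by (simp add: bij_betw_def)

lemma ix_cases: "\<exists>l\<in>params p q. k = ix l"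
  using bij by (auto simp: bij_betw_def)

lemma params_mem: "i \<in> {1..<p} \<Longrightarrow> PA i \<in> params p q" "i \<in> {1..<q} \<Longrightarrow> PB i \<in> params p q"
  "PC \<in> params p q"
  by (simp_all add: params_def)

lemma mkf_nth:
  "i \<in> {1..<p} \<Longrightarrow> apar ix (snd (mkf p q ix h A B c \<beta>)) i = A i \<beta>"
  "i \<in> {1..<q} \<Longrightarrow> bpar ix (snd (mkf p q ix h A B c \<beta>)) i = B i \<beta>"
  "snd (mkf p q ix h A B c \<beta>) $ ix PC = c \<beta>"
  by (simp_all add: mkf_def apar_def bpar_def inv_ix params_mem)

lemma vec_eq_zero:
  assumes "v $ ix PC = 0" "\<And>i. i \<in> {1..<p} \<Longrightarrow> apar ix v i = 0" "\<And>i. i \<in> {1..<q} \<Longrightarrow> bpar ix v i = 0"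
  shows "v = 0"
proof (subst vec_eq_iff, intro allI)
  fix k
  obtain l where "l \<in> params p q" "k = ix l" using ix_cases by blast
  then show "v $ k = 0 $ k" using assms by (auto simp: params_def apar_def bpar_def)
qed

lemma mkf_log_fields:
  assumes "h cholo_on U" "\<And>i. i \<in> {1..<p} \<Longrightarrow> A i cholo_on U" "\<And>i. i \<in> {1..<q} \<Longrightarrow> B i cholo_on U" "c cholo_on U"
  shows "mkf p q ix h A B c \<in> log_fields U"
proof (rule log_fieldsI[where h = h])
  have "(\<lambda>\<beta>. case inv_into (params p q) ix k of PA i \<Rightarrow> A i \<beta> | PB i \<Rightarrow> B i \<beta> | PC \<Rightarrow> c \<beta>) cholo_on U" for k
  proof -
    obtain l where "l \<in> params p q" "k = ix l" using ix_cases by blast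
    then have "inv_into (params p q) ix k = l" using inv_ix by simp
    then show ?thesis using assms \<open>l \<in> params p q\<close> by (auto simp: params_def)
  qed
  then show "mkf p q ix h A B c cholo_on U"
    unfolding mkf_def[abs_def] by (intro cholo_intros assms)
qed (simp add: mkf_def)

lemma hco_mkf:
  assumes "open U" "h cholo_on U" "\<And>i. i \<in> {1..<p} \<Longrightarrow> A i cholo_on U" "\<And>i. i \<in> {1..<q} \<Longrightarrow> B i cholo_on U"
    "c cholo_on U" "\<beta> \<in> U"
  shows "hco (mkf p q ix h A B c) \<beta> = h \<beta>"
  by (rule hco_unique[OF mkf_log_fields[OF assms(2-5)] assms(1,2) _ assms(6)]) (auto simp: mkf_def)

lemma nfd_cong:
  assumes "h (proj z) = h' (proj z)" "\<And>i. i \<in> {1..<p} \<Longrightarrow> A i (proj z) = A' i (proj z)"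
    "\<And>i. i \<in> {1..<q} \<Longrightarrow> B i (proj z) = B' i (proj z)" "c (proj z) = c' (proj z)"
  shows "nfd p q ix h A B c z = nfd p q ix h' A' B' c' z"
  unfolding nfd_def nform_def using assms by (intro arg_cong2[where f = "(+)"] sum.cong) auto

lemma nff_mkf:
  assumes "open U" "h cholo_on U" "\<And>i. i \<in> {1..<p} \<Longrightarrow> A i cholo_on U" "\<And>i. i \<in> {1..<q} \<Longrightarrow> B i cholo_on U"
    "c cholo_on U" "z \<in> tube r U"
  shows "nff p q ix (mkf p q ix h A B c) z = nfd p q ix h A B c z"
  unfolding nff_def
proof (rule nfd_cong)
  show "hco (mkf p q ix h A B c) (proj z) = h (proj z)"
    using hco_mkf[OF assms(1-5) proj_tube[OF assms(6)]] .
qed (simp_all add: mkf_nth)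

lemma residue_integral_eq:
  assumes "\<beta> \<in> ball 0 \<delta>" "appropriate p q ix r \<beta> \<rho>"
  shows "residue_integral p q ix \<rho> G \<beta> =
    fibre.res p q (apar ix (snd \<beta>)) (bpar ix (snd \<beta>)) (fst \<beta>) \<rho> (\<lambda>x y. G (x, y, snd \<beta>))"
proof -
  obtain \<epsilon> s where \<beta>: "\<beta> = (\<epsilon>, s)" by (cases \<beta>)
  have e: "a / (b - c) * (- 1 / y) = a / (c - b) * (1 / y)" for a b c y :: complex
    by (metis (no_types, lifting) divide_minus_left minus_diff_eq minus_divide_divide mult_minus_left mult_minus_right
        divide_minus_right)
  show ?thesis
    unfolding fibre.res_def[OF fibre[OF assms]]
    unfolding xint_def residue_integral_def \<beta> prod.case Hdef_eq[OF p q] fst_conv snd_conv e ..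
qed

lemma circle_in_tube:
  assumes "appropriate p q ix r \<beta> \<rho>" "\<beta> \<in> U" "x * y = fst \<beta>" "norm x = \<rho> \<or> norm y = \<rho>"
  shows "(x, y, snd \<beta>) \<in> tube r U"
proof -
  have \<rho>: "0 < \<rho>" "\<rho> < r" "norm (x * y) < \<rho>\<^sup>2" using assms by (auto simp: appropriate_def)
  have "norm x < r \<and> norm y < r"
  proof (cases "norm x = \<rho>")
    case True
    then have "norm y < \<rho>" using \<rho> by (simp add: norm_mult power2_eq_square)
    then show ?thesis using True \<rho> by simp
  next
    case False
    then have y: "norm y = \<rho>" using assms by simp
    then have "norm x < \<rho>" using \<rho> by (simp add: norm_mult power2_eq_square)
    then show ?thesis using y \<rho> by simp
  qed
  then show ?thesis using assms by (cases \<beta>) (simp add: tube_iff proj_eq)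
qed

text \<open>Restricted to the fibre, the difference is \<open>H\<close> times a function holomorphic
  on the whole fibre within the tube, which the residue kills.\<close>

lemma residue_congH:
  assumes U: "open U" "U \<subseteq> ball 0 \<delta>" and \<beta>: "\<beta> \<in> U" and \<rho>: "appropriate p q ix r \<beta> \<rho>"
    and G: "congH p q ix r U G G'" and G': "G' cholo_on tube r U"
  shows "residue_integral p q ix \<rho> G \<beta> = residue_integral p q ix \<rho> G' \<beta>"
proof -
  let ?\<epsilon> = "fst \<beta>" and ?s = "snd \<beta>"
  let ?a = "apar ix ?s" and ?b = "bpar ix ?s"
  have \<beta>': "\<beta> \<in> ball 0 \<delta>" using \<beta> U by blast
  interpret fibre p q ?a ?b ?\<epsilon> \<rho> by (rule fibre[OF \<beta>' \<rho>])
  have \<rho>r: "0 < \<rho>" "\<rho> < r" using \<rho> by (auto simp: appropriate_def)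
  obtain K where K: "K cholo_on tube r U" "\<And>z. z \<in> tube r U \<Longrightarrow> G z = G' z + Hdef p q ix z * K z"
    using G unfolding congH_def by blast
  have admc: "adm (\<lambda>x y. M (x, y, ?s))" if M: "M cholo_on tube r U" for M
  proof -
    have "continuous_on (sphere 0 \<rho>) (\<lambda>x. M (x, ?\<epsilon> / x, ?s))"
    proof (rule continuous_on_compose2[OF cholo_on_continuous_on[OF M]])
      show "continuous_on (sphere 0 \<rho>) (\<lambda>x. (x, ?\<epsilon> / x, ?s))"
        using \<rho>r by (intro continuous_intros) auto
      show "(\<lambda>x. (x, ?\<epsilon> / x, ?s)) ` sphere 0 \<rho> \<subseteq> tube r U"
        using \<rho>r by (auto intro!: circle_in_tube[OF \<rho> \<beta>])
    qed
    moreover have "continuous_on (sphere 0 \<rho>) (\<lambda>y. M (?\<epsilon> / y, y, ?s))"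
    proof (rule continuous_on_compose2[OF cholo_on_continuous_on[OF M]])
      show "continuous_on (sphere 0 \<rho>) (\<lambda>y. (?\<epsilon> / y, y, ?s))"
        using \<rho>r by (intro continuous_intros) auto
      show "(\<lambda>y. (?\<epsilon> / y, y, ?s)) ` sphere 0 \<rho> \<subseteq> tube r U"
        using \<rho>r by (auto intro!: circle_in_tube[OF \<rho> \<beta>])
    qed
    ultimately show ?thesis by (simp add: adm_def xcont_def)
  qed
  have sb: "(?\<epsilon>, ?s) \<in> U" using \<beta> by simp
  have z: "res (\<lambda>x y. (pol p ?a x - pol q ?b y) * K (x, y, ?s)) = 0"
  proof (rule res_mult_H[OF \<rho>r(2)])
    assume "?\<epsilon> \<noteq> 0"
    show "(\<lambda>x. K (x, ?\<epsilon> / x, ?s)) holomorphic_on {x. x \<noteq> 0 \<and> cmod x < r \<and> cmod (?\<epsilon> / x) < r}"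
      by (rule cholo_imp_holomorphic, rule cholo_compose[OF K(1)])
        (use sb in \<open>auto intro!: cholo_intros simp: tube_iff proj_eq\<close>)
  next
    assume 0: "?\<epsilon> = 0"
    show "(\<lambda>x. K (x, 0, ?s)) holomorphic_on ball 0 r \<and> (\<lambda>y. K (0, y, ?s)) holomorphic_on ball 0 r"
      by (intro conjI cholo_imp_holomorphic; rule cholo_compose[OF K(1)])
        (use sb 0 r in \<open>auto intro!: cholo_intros simp: tube_iff proj_eq\<close>)
  qed
  \<comment> \<open>The congruence is available only on the tube, so the integrands are compared on
    the two boundary circles alone.\<close>
  have "res (\<lambda>x y. G (x, y, ?s)) = res (\<lambda>x y. G' (x, y, ?s) + (pol p ?a x - pol q ?b y) * K (x, y, ?s))"
    by (rule res_cong_circles) (simp add: K(2) circle_in_tube[OF \<rho> \<beta>] Hdef_eq[OF p q])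
  also have "\<dots> = res (\<lambda>x y. G' (x, y, ?s))"
    by (subst res_add) (use z in \<open>auto intro!: admc G' adm_intros(5,6) adm_pol K(1)\<close>)
  finally show ?thesis unfolding residue_integral_eq[OF \<beta>' \<rho>] .
qed

lemma residue_nff:
  assumes U: "open U" "U \<subseteq> ball 0 \<delta>" and \<beta>: "\<beta> \<in> U" and \<rho>: "appropriate p q ix r \<beta> \<rho>"
    and u: "u \<in> log_fields U" and v: "v \<in> log_fields U"
    and G: "congH p q ix r U G (\<lambda>z. nff p q ix u z * nff p q ix v z)"
  shows "residue_integral p q ix \<rho> G \<beta> = gform p q ix u v \<beta>"
proof -
  let ?\<epsilon> = "fst \<beta>" and ?s = "snd \<beta>"
  let ?a = "apar ix ?s" and ?b = "bpar ix ?s"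
  have \<beta>': "\<beta> \<in> ball 0 \<delta>" using \<beta> U by blast
  interpret fibre p q ?a ?b ?\<epsilon> \<rho> by (rule fibre[OF \<beta>' \<rho>])
  have "residue_integral p q ix \<rho> G \<beta> = residue_integral p q ix \<rho> (\<lambda>z. nff p q ix u z * nff p q ix v z) \<beta>"
    by (rule residue_congH[OF U \<beta> \<rho> G]) (intro cholo_intros cholo_nff u v U)
  also have "\<dots> = res (\<lambda>x y. nff p q ix u (x, y, ?s) * nff p q ix v (x, y, ?s))"
    by (rule residue_integral_eq[OF \<beta>' \<rho>])
  also have "\<dots> = res (\<lambda>x y. nform p q ?a (hco u \<beta>) (apar ix (snd (u \<beta>))) (bpar ix (snd (u \<beta>))) (snd (u \<beta>) $ ix PC) x y *
       nform p q ?a (hco v \<beta>) (apar ix (snd (v \<beta>))) (bpar ix (snd (v \<beta>))) (snd (v \<beta>) $ ix PC) x y)"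
    by (rule res_cong) (simp add: nff_def nfd_def proj_eq)
  also have "\<dots> = gform p q ix u v \<beta>"
    unfolding res_nform_nform gform_def by simp
  finally show ?thesis .
qed

text \<open>Fields whose normal form has constant coefficients suffice as tests: \<open>h\<close>
  detects the \<open>c\<close>-component, \<open>c\<close> detects \<open>hco u\<close>, and the
  unit vectors detect the rest.\<close>

lemma log_field_zero_at:
  assumes u: "u \<in> log_fields U" and U: "open U" and \<beta>: "\<beta> \<in> U"
    and 0: "\<And>v. v \<in> log_fields U \<Longrightarrow> gform p q ix u v \<beta> = 0"
  shows "u \<beta> = 0"
proof -
  let ?m = "\<lambda>h A B c. mkf p q ix (\<lambda>_. h) (\<lambda>i _. A i) (\<lambda>i _. B i) (\<lambda>_. c)"
  have g: "hco u \<beta> * c + snd (u \<beta>) $ ix PC * h + gram p (apar ix (snd \<beta>)) (apar ix (snd (u \<beta>))) A +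
      gram q (bpar ix (snd \<beta>)) (bpar ix (snd (u \<beta>))) B = 0" for h A B c
  proof -
    have "?m h A B c \<in> log_fields U" by (intro mkf_log_fields cholo_const)
    then have "gform p q ix u (?m h A B c) \<beta> = 0" by (rule 0)
    moreover have "hco (?m h A B c) \<beta> = h" by (rule hco_mkf[OF U _ _ _ _ \<beta>]) (intro cholo_const)+
    moreover have "gram p (apar ix (snd \<beta>)) (apar ix (snd (u \<beta>))) (apar ix (snd (?m h A B c \<beta>))) =
        gram p (apar ix (snd \<beta>)) (apar ix (snd (u \<beta>))) A"
      by (rule gram_cong) (simp_all add: mkf_nth)
    moreover have "gram q (bpar ix (snd \<beta>)) (bpar ix (snd (u \<beta>))) (bpar ix (snd (?m h A B c \<beta>))) =
        gram q (bpar ix (snd \<beta>)) (bpar ix (snd (u \<beta>))) B"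
      by (rule gram_cong) (simp_all add: mkf_nth)
    ultimately show ?thesis by (simp add: gform_def mkf_nth)
  qed
  have h: "hco u \<beta> = 0" using g[of 1 0 "\<lambda>_. 0" "\<lambda>_. 0"] by simp
  have c: "snd (u \<beta>) $ ix PC = 0" using g[of 0 1 "\<lambda>_. 0" "\<lambda>_. 0"] by simp
  have A: "apar ix (snd (u \<beta>)) i = 0" if "i \<in> {1..<p}" for i
    using g[of 0 0 _ "\<lambda>_. 0"] by (intro gram_nondegenerate[OF p _ that]) simp
  have B: "bpar ix (snd (u \<beta>)) i = 0" if "i \<in> {1..<q}" for i
    using g[of 0 0 "\<lambda>_. 0"] by (intro gram_nondegenerate[OF q _ that]) simp
  have "snd (u \<beta>) = 0" by (rule vec_eq_zero[OF c A B])
  moreover have "fst (u \<beta>) = 0" using hco_mult[OF u \<beta>] h by simp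
  ultimately show ?thesis by (simp add: prod_eq_iff)
qed

text \<open>Injectivity of \<open>t'F\<close>: a normal form divisible by \<open>H\<close> pairs to
  zero with every field, so the field vanishes at each point by nondegeneracy.\<close>

lemma nff_unique:
  assumes U: "open U" "U \<subseteq> ball 0 \<delta>" and w: "w \<in> log_fields U" and w': "w' \<in> log_fields U"
    and c: "congH p q ix r U (nff p q ix w) (nff p q ix w')" and \<beta>: "\<beta> \<in> U"
  shows "w \<beta> = w' \<beta>"
proof -
  let ?u = "\<lambda>\<beta>. w \<beta> - w' \<beta>"
  have u: "?u \<in> log_fields U" by (rule log_fields_diff[OF w w'])
  obtain \<rho> where \<rho>: "appropriate p q ix r \<beta> \<rho>" using appropriate_ex \<beta> U by blast
  have 0: "congH p q ix r U (\<lambda>z. 0) (nff p q ix ?u)"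
  proof -
    obtain K where K: "K cholo_on tube r U" "\<And>z. z \<in> tube r U \<Longrightarrow> nff p q ix w z = nff p q ix w' z + Hdef p q ix z * K z"
      using c unfolding congH_def by blast
    then have "nff p q ix ?u z = Hdef p q ix z * K z" if "z \<in> tube r U" for z
      using nff_diff[OF w w' U(1) that] that by simp
    then show ?thesis unfolding congH_def using K(1)
      by (intro exI[of _ "\<lambda>z. - K z"]) (auto intro: cholo_intros)
  qed
  have "?u \<beta> = 0"
  proof (rule log_field_zero_at[OF u U(1) \<beta>])
    fix v assume v: "v \<in> log_fields U"
    have "congH p q ix r U (\<lambda>z. nff p q ix v z * 0) (\<lambda>z. nff p q ix v z * nff p q ix ?u z)"
      by (rule congH_cmult[OF 0 cholo_nff[OF v U(1)]])
    then have "congH p q ix r U (\<lambda>z. 0) (\<lambda>z. nff p q ix ?u z * nff p q ix v z)"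
      by (simp add: mult.commute)
    from residue_nff[OF U \<beta> \<rho> u v this] have "gform p q ix ?u v \<beta> = residue_integral p q ix \<rho> (\<lambda>z. 0) \<beta>" by simp
    then show "gform p q ix ?u v \<beta> = 0" by (simp add: residue_integral_def split_def)
  qed
  then show ?thesis by simp
qed

text \<open>The functions that are congruent to a normal form make up a module over the functions on the base
  that is stable under multiplication by \<open>x\<close> and \<open>y\<close>; this gives the existence of products.\<close>

definition reducible :: "'m base set \<Rightarrow> ('m total \<Rightarrow> complex) \<Rightarrow> bool" where
  "reducible U G \<longleftrightarrow> (\<exists>w\<in>log_fields U. congH p q ix r U G (nff p q ix w))"

section \<open>Reduction of products to normal forms\<close>

context
  fixes U :: "'m base set"
  assumes U: "open U"
begin

lemma reducible_cong: "reducible U G \<Longrightarrow> congH p q ix r U G' G \<Longrightarrow> reducible U G'"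
  unfolding reducible_def using congH_trans by blast

lemma reducible_eq: "reducible U G \<Longrightarrow> (\<And>z. z \<in> tube r U \<Longrightarrow> G' z = G z) \<Longrightarrow> reducible U G'"
  using reducible_cong congH_eq_on by blast

lemma reducible_lincomb:
  assumes "reducible U G" "reducible U G'" "f cholo_on U" "g cholo_on U"
  shows "reducible U (\<lambda>z. f (proj z) * G z + g (proj z) * G' z)"
proof -
  obtain w w' where w: "w \<in> log_fields U" "congH p q ix r U G (nff p q ix w)"
    "w' \<in> log_fields U" "congH p q ix r U G' (nff p q ix w')" using assms unfolding reducible_def by blast
  have "congH p q ix r U (\<lambda>z. f (proj z) * G z + g (proj z) * G' z)
    (\<lambda>z. f (proj z) * nff p q ix w z + g (proj z) * nff p q ix w' z)"
    by (intro congH_add congH_cmult w cholo_intros assms)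
  moreover have "congH p q ix r U (\<lambda>z. f (proj z) * nff p q ix w z + g (proj z) * nff p q ix w' z)
    (nff p q ix (\<lambda>\<beta>. cscale (f \<beta>) (w \<beta>) + cscale (g \<beta>) (w' \<beta>)))"
    by (rule congH_eq_on) (rule nff_lincomb[OF w(1,3) assms(3,4) U, symmetric])
  ultimately show ?thesis
    unfolding reducible_def using log_fields_lincomb[OF w(1,3) assms(3,4)] congH_trans by blast
qed

lemma reducible_add: "reducible U G \<Longrightarrow> reducible U G' \<Longrightarrow> reducible U (\<lambda>z. G z + G' z)"
  using reducible_lincomb[of G G' "\<lambda>_. 1" "\<lambda>_. 1"] by (simp add: cholo_const)

lemma reducible_base: "reducible U G \<Longrightarrow> f cholo_on U \<Longrightarrow> reducible U (\<lambda>z. f (proj z) * G z)"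
  using reducible_lincomb[of G G f "\<lambda>_. 0"] by (simp add: cholo_const)

lemma reducible_cmult: "reducible U G \<Longrightarrow> reducible U (\<lambda>z. c * G z)"
  using reducible_base[of G "\<lambda>_. c"] by (simp add: cholo_const)

lemma reducible_zero: "reducible U (\<lambda>z. 0)"
proof -
  have "(\<lambda>\<beta>. 0) \<in> log_fields U" by (auto simp: log_fields_def intro: cholo_const)
  from cholo_nff[OF this U]
  have "congH p q ix r U (\<lambda>z. 0) (nff p q ix (\<lambda>\<beta>. 0))"
    using nff_lincomb[OF \<open>(\<lambda>\<beta>. 0) \<in> log_fields U\<close> \<open>(\<lambda>\<beta>. 0) \<in> log_fields U\<close> cholo_const[of 0] cholo_const[of 0] U]
    by (intro congH_eq_on) simp
  then show ?thesis unfolding reducible_def using \<open>(\<lambda>\<beta>. 0) \<in> log_fields U\<close> by blast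
qed

lemma reducible_sum: "finite I \<Longrightarrow> (\<And>i. i \<in> I \<Longrightarrow> reducible U (G i)) \<Longrightarrow> reducible U (\<lambda>z. \<Sum>i\<in>I. G i z)"
  by (induction I rule: finite_induct) (auto intro: reducible_zero reducible_add)

lemma reducible_nfd:
  assumes "h cholo_on U" "\<And>i. i \<in> {1..<p} \<Longrightarrow> A i cholo_on U" "\<And>i. i \<in> {1..<q} \<Longrightarrow> B i cholo_on U" "c cholo_on U"
  shows "reducible U (nfd p q ix h A B c)"
  unfolding reducible_def
proof
  show "mkf p q ix h A B c \<in> log_fields U" by (rule mkf_log_fields) (auto intro: assms)
  show "congH p q ix r U (nfd p q ix h A B c) (nff p q ix (mkf p q ix h A B c))"
    by (intro congH_eq_on nff_mkf[OF U, symmetric]) (auto intro: assms)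
qed

lemma reducible_x_power: "i \<le> p \<Longrightarrow> reducible U (\<lambda>z. fst z ^ i)"
proof -
  assume "i \<le> p"
  then consider "i = 0" | "i \<in> {1..<p}" | "i = p" by fastforce
  then show ?thesis
  proof cases
    case 1
    have "reducible U (nfd p q ix (\<lambda>_. 0) (\<lambda>_ _. 0) (\<lambda>_ _. 0) (\<lambda>_. 1))" by (intro reducible_nfd cholo_const)
    then show ?thesis by (rule reducible_eq) (simp add: 1 nfd_def nform_def)
  next
    case 2
    have "reducible U (nfd p q ix (\<lambda>_. 0) (\<lambda>j _. if j = i then 1 else 0) (\<lambda>_ _. 0) (\<lambda>_. 0))"
      by (intro reducible_nfd cholo_const)
    then show ?thesis
      by (rule reducible_eq) (use 2 in \<open>simp add: nfd_def nform_def if_distrib[where f = "\<lambda>x. x * _"] cong: if_cong\<close>)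
  next
    case 3
    \<comment> \<open>Solves \<open>pol p a x\<close> for \<open>x ^ p\<close>, which is therefore
      itself a normal form.\<close>
    have "reducible U (nfd p q ix (\<lambda>_. 1 / of_nat p) (\<lambda>i \<beta>. - (of_nat i / of_nat p) * apar ix (snd \<beta>) i) (\<lambda>_ _. 0) (\<lambda>_. 0))"
      by (intro reducible_nfd cholo_intros)
    then show ?thesis
      by (rule reducible_eq) (use 3 p in \<open>simp add: nfd_def nform_def pol_def proj_eq add_divide_distrib sum_divide_distrib
          sum_negf distrib_left sum_distrib_left\<close>)
  qed
qed

lemma reducible_y_power: "i \<le> q \<Longrightarrow> reducible U (\<lambda>z. fst (snd z) ^ i)"
proof -
  assume "i \<le> q"
  then consider "i = 0" | "i \<in> {1..<q}" | "i = q" by fastforce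
  then show ?thesis
  proof cases
    case 1
    then show ?thesis using reducible_x_power[of 0] by simp
  next
    case 2
    have "reducible U (nfd p q ix (\<lambda>_. 0) (\<lambda>_ _. 0) (\<lambda>j _. if j = i then 1 else 0) (\<lambda>_. 0))"
      by (intro reducible_nfd cholo_const)
    then show ?thesis
      by (rule reducible_eq) (use 2 in \<open>simp add: nfd_def nform_def if_distrib[where f = "\<lambda>x. x * _"] cong: if_cong\<close>)
  next
    case 3
    let ?n = "nfd p q ix (\<lambda>_. 1 / of_nat q) (\<lambda>_ _. 0) (\<lambda>i \<beta>. - (of_nat i / of_nat q) * bpar ix (snd \<beta>) i) (\<lambda>_. 0)"
    have 1: "reducible U ?n" by (intro reducible_nfd cholo_intros)
    \<comment> \<open>Normal forms contain \<open>pol p a x\<close> but not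
      \<open>pol q b y\<close>, so solving for \<open>y ^ q\<close> costs a multiple of
      \<open>H\<close>.\<close>
    have "fst (snd z) ^ q = ?n z + Hdef p q ix z * (- 1 / of_nat q)" for z
    proof -
      let ?b = "bpar ix (snd (snd z))" and ?y = "fst (snd z)"
      let ?S = "\<Sum>i\<in>{1..<q}. of_nat i * ?b i * ?y ^ i"
      have "(\<Sum>i\<in>{1..<q}. - (of_nat i / of_nat q) * ?b i * ?y ^ i) = - (?S / of_nat q)"
        by (simp add: sum_divide_distrib sum_negf)
      then have "?n z + Hdef p q ix z * (- 1 / of_nat q) = (pol q ?b ?y - ?S) / of_nat q"
        by (simp add: nfd_def nform_def Hdef_eq[OF p q] proj_eq diff_divide_distrib)
      also have "pol q ?b ?y - ?S = of_nat q * ?y ^ q" by (simp add: pol_def)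
      finally show ?thesis using q by simp
    qed
    then have "congH p q ix r U (\<lambda>z. fst (snd z) ^ q) ?n"
      unfolding congH_def using cholo_const by blast
    from reducible_cong[OF 1 this] show ?thesis using 3 by simp
  qed
qed

text \<open>A factor \<open>x y\<close> is the function \<epsilon> of the base, so a mixed monomial
  drops to a lower pure power.\<close>

lemma reducible_xy:
  assumes "1 \<le> i"
  shows "i \<le> q \<Longrightarrow> reducible U (\<lambda>z. fst z * fst (snd z) ^ i)" "i \<le> p \<Longrightarrow> reducible U (\<lambda>z. fst (snd z) * fst z ^ i)"
proof -
  have f: "fst cholo_on U" using cholo_fst[OF cholo_id] .
  have e: "w ^ i = w * w ^ (i - 1)" for w :: complex using assms by (cases i) auto
  show "reducible U (\<lambda>z. fst z * fst (snd z) ^ i)" if "i \<le> q"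
    by (rule reducible_eq[OF reducible_base[OF reducible_y_power[of "i - 1"] f]]) (use that in \<open>auto simp: proj_eq e\<close>)
  show "reducible U (\<lambda>z. fst (snd z) * fst z ^ i)" if "i \<le> p"
    by (rule reducible_eq[OF reducible_base[OF reducible_x_power[of "i - 1"] f]]) (use that in \<open>auto simp: proj_eq e\<close>)
qed

lemma reducible_pol_mult:
  assumes "\<And>i. i \<in> {1..p} \<Longrightarrow> reducible U (\<lambda>z. fst z ^ i * M z)"
  shows "reducible U (\<lambda>z. pol p (apar ix (snd (snd z))) (fst z) * M z)"
proof -
  have "reducible U (\<lambda>z. of_nat p * (fst z ^ p * M z) +
      (\<Sum>i\<in>{1..<p}. (of_nat i * apar ix (snd (proj z)) i) * (fst z ^ i * M z)))"
    using p by (intro reducible_add reducible_cmult reducible_sum reducible_base[where f = "\<lambda>\<beta>. of_nat i * apar ix (snd \<beta>) i" for i]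
        assms cholo_intros) auto
  then show ?thesis
    by (rule reducible_eq) (simp add: pol_def proj_eq algebra_simps sum_distrib_left)
qed

text \<open>By linearity over the base, multiplication of a normal form by \<open>M\<close> has to
  be checked only on the generators.\<close>

lemma reducible_nff_mult:
  assumes w: "w \<in> log_fields U" and P: "reducible U (\<lambda>z. pol p (apar ix (snd (snd z))) (fst z) * M z)"
    and x: "\<And>i. i \<in> {1..<p} \<Longrightarrow> reducible U (\<lambda>z. fst z ^ i * M z)"
    and y: "\<And>i. i \<in> {1..<q} \<Longrightarrow> reducible U (\<lambda>z. fst (snd z) ^ i * M z)" and M: "reducible U M"
  shows "reducible U (\<lambda>z. nff p q ix w z * M z)"
proof -
  have wc: "(\<lambda>\<beta>. snd (w \<beta>)) cholo_on U" by (intro cholo_intros log_fields_cholo w)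
  have "reducible U (\<lambda>z. hco w (proj z) * (pol p (apar ix (snd (snd z))) (fst z) * M z) +
     (\<Sum>i\<in>{1..<p}. apar ix (snd (w (proj z))) i * (fst z ^ i * M z)) +
     (\<Sum>i\<in>{1..<q}. bpar ix (snd (w (proj z))) i * (fst (snd z) ^ i * M z)) +
     snd (w (proj z)) $ ix PC * M z)"
    by (intro reducible_add reducible_sum reducible_base[where f = "hco w"] reducible_base[where f = "\<lambda>\<beta>. apar ix (snd (w \<beta>)) i" for i]
        reducible_base[where f = "\<lambda>\<beta>. bpar ix (snd (w \<beta>)) i" for i] reducible_base[where f = "\<lambda>\<beta>. snd (w \<beta>) $ ix PC"]
        P x y M cholo_hco w U cholo_apar cholo_bpar cholo_nth wc) auto
  then show ?thesis
    by (rule reducible_eq) (simp add: nff_def nfd_def nform_def distrib_right sum_distrib_right mult.assoc)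
qed

lemma reducible_mult_x:
  assumes "reducible U G"
  shows "reducible U (\<lambda>z. fst z * G z)"
proof -
  obtain w where w: "w \<in> log_fields U" "congH p q ix r U G (nff p q ix w)"
    using assms unfolding reducible_def by blast
  \<comment> \<open>Prepares the critical generator \<open>x * pol p a x\<close>, which contains
    \<open>x ^ (p + 1)\<close>. Modulo \<open>H\<close> it equals \<open>x * pol q b y\<close>, and
    there each \<open>x * y ^ i\<close> is \<epsilon> times a lower power of
    \<open>y\<close>.\<close>
  have xQ: "reducible U (\<lambda>z. of_nat q * (fst z * fst (snd z) ^ q) +
      (\<Sum>i\<in>{1..<q}. (of_nat i * bpar ix (snd (proj z)) i) * (fst z * fst (snd z) ^ i)))"
    using q by (intro reducible_add reducible_cmult reducible_sum reducible_base[where f = "\<lambda>\<beta>. of_nat i * bpar ix (snd \<beta>) i" for i]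
        reducible_xy cholo_intros) auto
  have xP: "reducible U (\<lambda>z. pol p (apar ix (snd (snd z))) (fst z) * fst z)"
  proof (rule reducible_cong[OF xQ])
    have "pol p (apar ix (snd (snd z))) (fst z) * fst z = of_nat q * (fst z * fst (snd z) ^ q) +
      (\<Sum>i\<in>{1..<q}. (of_nat i * bpar ix (snd (proj z)) i) * (fst z * fst (snd z) ^ i)) + Hdef p q ix z * fst z" for z
      by (simp add: Hdef_eq[OF p q] pol_def[of q] proj_eq algebra_simps sum_distrib_left)
    then show "congH p q ix r U (\<lambda>z. pol p (apar ix (snd (snd z))) (fst z) * fst z)
       (\<lambda>z. of_nat q * (fst z * fst (snd z) ^ q) +
      (\<Sum>i\<in>{1..<q}. (of_nat i * bpar ix (snd (proj z)) i) * (fst z * fst (snd z) ^ i)))"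
      unfolding congH_def using cholo_fst[OF cholo_id] by blast
  qed
  have "reducible U (\<lambda>z. nff p q ix w z * fst z)"
  proof (rule reducible_nff_mult[OF w(1) xP])
    show "reducible U (\<lambda>z. fst z ^ i * fst z)" if "i \<in> {1..<p}" for i
      using reducible_x_power[of "Suc i"] that by (simp add: mult.commute)
    show "reducible U (\<lambda>z. fst (snd z) ^ i * fst z)" if "i \<in> {1..<q}" for i
      using reducible_xy(1)[of i] that by (simp add: mult.commute)
    show "reducible U fst" using reducible_x_power[of 1] p by simp
  qed
  then have "reducible U (\<lambda>z. fst z * nff p q ix w z)" by (simp add: mult.commute)
  then show ?thesis by (rule reducible_cong) (intro congH_cmult w cholo_intros)
qed

lemma reducible_mult_y:
  assumes "reducible U G"
  shows "reducible U (\<lambda>z. fst (snd z) * G z)"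
proof -
  obtain w where w: "w \<in> log_fields U" "congH p q ix r U G (nff p q ix w)"
    using assms unfolding reducible_def by blast
  have xy: "reducible U (\<lambda>z. fst z ^ i * fst (snd z))" if "i \<in> {1..p}" for i
    using reducible_xy(2)[of i] that by (simp add: mult.commute)
  have "reducible U (\<lambda>z. nff p q ix w z * fst (snd z))"
  proof (rule reducible_nff_mult[OF w(1) reducible_pol_mult[OF xy]])
    show "reducible U (\<lambda>z. fst z ^ i * fst (snd z))" if "i \<in> {1..<p}" for i using xy that by simp
    show "reducible U (\<lambda>z. fst (snd z) ^ i * fst (snd z))" if "i \<in> {1..<q}" for i
      using reducible_y_power[of "Suc i"] that by (simp add: mult.commute)
    show "reducible U (\<lambda>z. fst (snd z))" using reducible_y_power[of 1] q by simp
  qed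
  then have "reducible U (\<lambda>z. fst (snd z) * nff p q ix w z)" by (simp add: mult.commute)
  then show ?thesis by (rule reducible_cong) (intro congH_cmult w cholo_intros)
qed

lemma reducible_mult_powers: "reducible U G \<Longrightarrow> reducible U (\<lambda>z. fst z ^ i * G z)" "reducible U G \<Longrightarrow> reducible U (\<lambda>z. fst (snd z) ^ i * G z)"
proof -
  show "reducible U G \<Longrightarrow> reducible U (\<lambda>z. fst z ^ i * G z)"
    by (induction i) (auto dest: reducible_mult_x simp: mult.assoc)
  show "reducible U G \<Longrightarrow> reducible U (\<lambda>z. fst (snd z) ^ i * G z)"
    by (induction i) (auto dest: reducible_mult_y simp: mult.assoc)
qed

lemma reducible_mult_nff: "u \<in> log_fields U \<Longrightarrow> reducible U G \<Longrightarrow> reducible U (\<lambda>z. nff p q ix u z * G z)"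
  by (intro reducible_nff_mult reducible_pol_mult reducible_mult_powers)

lemma product_exists:
  assumes u: "u \<in> log_fields U" and v: "v \<in> log_fields U"
  shows "\<exists>w\<in>log_fields U. congH p q ix r U (\<lambda>z. nff p q ix u z * nff p q ix v z) (nff p q ix w)"
  using reducible_mult_nff[OF u, of "nff p q ix v"] v congH_refl unfolding reducible_def by blast

end

end

section \<open>Symmetry, holomorphy and linearity of the explicit form\<close>

lemma gram_commute: "gram p a A B = gram p a B A"
  unfolding gram_def by (subst sum.swap) (intro sum.cong refl, simp add: add.commute mult_ac)

lemma gram_lincomb:
  "gram p a (\<lambda>i. c * A i + d * B i) C = c * gram p a A C + d * gram p a B C"
  unfolding gram_def sum_distrib_left sum.distrib[symmetric]
  by (intro sum.cong refl) (simp add: algebra_simps)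

lemma gform_commute: "gform p q ix u v \<beta> = gform p q ix v u \<beta>"
  unfolding gform_def by (simp add: gram_commute algebra_simps)

lemma cholo_kap [cholo_intros]:
  fixes a :: "'a::cvec \<Rightarrow> nat \<Rightarrow> complex"
  assumes "\<And>i. i \<in> {1..<p} \<Longrightarrow> (\<lambda>z. a z i) cholo_on S"
  shows "(\<lambda>z. kap p (a z) m) cholo_on S"
proof (induction m rule: less_induct)
  case (less m)
  have "(\<lambda>z. if l \<le> m then of_nat (p - l) * a z (p - l) * kap p (a z) (m - l) else 0) cholo_on S"
    if "m \<noteq> 0" "l \<in> {1..<p}" for l
    using that less[of "m - l"] assms[of "p - l"] by (cases "l \<le> m") (auto intro!: cholo_intros)
  then show ?case
  proof (cases "m = 0")
    case False
    then show ?thesis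
      using \<open>\<And>l. _ \<Longrightarrow> _ \<Longrightarrow> _\<close>
      by (subst kap.simps, unfold if_not_P[OF False] divide_inverse) (intro cholo_intros)
  qed (simp add: kap_0 cholo_const)
qed

lemma cholo_gram [cholo_intros]:
  fixes a A B :: "'a::cvec \<Rightarrow> nat \<Rightarrow> complex"
  assumes "\<And>i. i \<in> {1..<p} \<Longrightarrow> (\<lambda>z. a z i) cholo_on S" "\<And>i. i \<in> {1..<p} \<Longrightarrow> (\<lambda>z. A z i) cholo_on S"
    "\<And>i. i \<in> {1..<p} \<Longrightarrow> (\<lambda>z. B z i) cholo_on S"
  shows "(\<lambda>z. gram p (a z) (A z) (B z)) cholo_on S"
proof -
  have "(\<lambda>z. if p \<le> i + j then kap p (a z) (i + j - p) else 0) cholo_on S" for i j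
    using assms(1) by (cases "p \<le> i + j") (auto intro!: cholo_intros)
  then show ?thesis unfolding gram_def by (intro cholo_intros assms)
qed

lemma cholo_gform:
  assumes "u \<in> log_fields U" "v \<in> log_fields U" "open U"
  shows "gform p q ix u v cholo_on U"
  unfolding gform_def[abs_def] by (intro cholo_intros cholo_hco log_fields_cholo assms)

lemma gform_lincomb:
  assumes "u \<in> log_fields U" "v \<in> log_fields U" "f cholo_on U" "g cholo_on U" "open U" "\<beta> \<in> U"
  shows "gform p q ix (\<lambda>\<beta>. cscale (f \<beta>) (u \<beta>) + cscale (g \<beta>) (v \<beta>)) w \<beta> =
    f \<beta> * gform p q ix u w \<beta> + g \<beta> * gform p q ix v w \<beta>"
proof -
  have e: "apar ix (snd (cscale (f \<beta>) (u \<beta>) + cscale (g \<beta>) (v \<beta>))) =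
      (\<lambda>i. f \<beta> * apar ix (snd (u \<beta>)) i + g \<beta> * apar ix (snd (v \<beta>)) i)"
    "bpar ix (snd (cscale (f \<beta>) (u \<beta>) + cscale (g \<beta>) (v \<beta>))) =
      (\<lambda>i. f \<beta> * bpar ix (snd (u \<beta>)) i + g \<beta> * bpar ix (snd (v \<beta>)) i)"
    by (simp_all add: fun_eq_iff apar_def bpar_def)
  show ?thesis
    unfolding gform_def hco_lincomb[OF assms] e gram_lincomb by (simp add: algebra_simps)
qed

section \<open>Algebra laws and properties of the pairing\<close>

context miniversal
begin

context
  fixes U :: "'m base set"
  assumes U: "open U" and UB: "U \<subseteq> ball 0 \<delta>"
begin

lemma is_star_iff:
  assumes u: "u \<in> log_fields U" and v: "v \<in> log_fields U"
  shows "is_star p q ix r U u v w \<longleftrightarrow>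
    w \<in> log_fields U \<and> congH p q ix r U (nff p q ix w) (\<lambda>z. nff p q ix u z * nff p q ix v z)"
proof (cases "w \<in> log_fields U")
  case True
  show ?thesis
    unfolding is_star_def tF_eq(1)[OF u U p q] tF_eq(1)[OF v U p q] tF_eq(1)[OF True U p q]
      jclass_mult[OF p q U cholo_nff[OF u U] cholo_nff[OF v U]]
    using jclass_eq_iff[OF p q U cholo_nff[OF True U] cholo_mult[OF cholo_nff[OF u U] cholo_nff[OF v U]]] True
    by blast
qed (simp add: is_star_def)

lemma is_star_exists:
  assumes u: "u \<in> log_fields U" and v: "v \<in> log_fields U"
  shows "\<exists>w. is_star p q ix r U u v w"
  using product_exists[OF U u v] congH_sym unfolding is_star_iff[OF u v] by blast

lemma star_spec:
  assumes u: "u \<in> log_fields U" and v: "v \<in> log_fields U"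
  shows "star p q ix r U u v \<in> log_fields U"
    and "congH p q ix r U (nff p q ix (star p q ix r U u v)) (\<lambda>z. nff p q ix u z * nff p q ix v z)"
  using someI_ex[OF is_star_exists[OF u v]] unfolding is_star_iff[OF u v] star_def by blast+

text \<open>Eliminates the choice operator in \<open>star\<close>; each algebra law then reduces to
  the same law for products of functions.\<close>

lemma star_eqI:
  assumes u: "u \<in> log_fields U" and v: "v \<in> log_fields U" and w: "w \<in> log_fields U"
    and c: "congH p q ix r U (nff p q ix w) (\<lambda>z. nff p q ix u z * nff p q ix v z)" and \<beta>: "\<beta> \<in> U"
  shows "star p q ix r U u v \<beta> = w \<beta>"
  by (rule nff_unique[OF U UB star_spec(1)[OF u v] w congH_trans[OF star_spec(2)[OF u v] congH_sym[OF c]] \<beta>])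

text \<open>The unit is \<open>\<partial>/\<partial>c\<close>, since \<open>c\<close> enters
  \<open>F\<close> as an additive constant.\<close>

lemma unit_field:
  obtains e where "e \<in> log_fields U" "\<And>z. z \<in> tube r U \<Longrightarrow> nff p q ix e z = 1"
proof
  let ?e = "mkf p q ix (\<lambda>_. 0) (\<lambda>_ _. 0) (\<lambda>_ _. 0) (\<lambda>_. 1)"
  show "?e \<in> log_fields U" by (intro mkf_log_fields cholo_const)
  show "nff p q ix ?e z = 1" if "z \<in> tube r U" for z
    by (subst nff_mkf[OF U _ _ _ _ that]) (auto intro: cholo_const simp: nfd_def nform_def)
qed

lemma tF_wd: "tF_well_defined p q ix r U"
  unfolding tF_well_defined_def
proof (intro ballI conjI allI impI)
  fix u assume u: "u \<in> log_fields U"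
  show "\<exists>ut. is_lift r U u ut" using is_lift_std[OF u U] by blast
  fix ut assume l: "is_lift r U u ut"
  show "lift_class p q ix r U ut \<in> carrier (jac_ring p q ix r U)"
    unfolding tF_eq(2)[OF u U p q l] by (rule jclass_carrier[OF p q U cholo_nff[OF u U]])
  show "lift_class p q ix r U ut = tF p q ix r U u"
    unfolding tF_eq(2)[OF u U p q l] tF_eq(1)[OF u U p q] ..
qed

lemma star_wd: "star_well_defined p q ix r U"
  unfolding star_well_defined_def
proof (intro conjI ballI allI impI)
  obtain e where e: "e \<in> log_fields U" "\<And>z. z \<in> tube r U \<Longrightarrow> nff p q ix e z = 1"
    using unit_field by blast
  have "tF p q ix r U e = \<one>\<^bsub>jac_ring p q ix r U\<^esub>"
    unfolding tF_eq(1)[OF e(1) U p q] jclass_one[OF p q U]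
    by (subst jclass_eq_iff[OF p q U cholo_nff[OF e(1) U] cholo_const]) (rule congH_eq_on, rule e)
  then show "\<exists>e\<in>log_fields U. tF p q ix r U e = \<one>\<^bsub>jac_ring p q ix r U\<^esub>" using e by blast
  fix u v assume uv: "u \<in> log_fields U" "v \<in> log_fields U"
  show "\<exists>w. is_star p q ix r U u v w" by (rule is_star_exists[OF uv])
  fix w w' \<beta> assume w: "is_star p q ix r U u v w \<and> is_star p q ix r U u v w'" and \<beta>: "\<beta> \<in> U"
  then show "w \<beta> = w' \<beta>" unfolding is_star_iff[OF uv] using star_eqI[OF uv _ _ \<beta>] by metis
qed

lemma comm_algebra: "comm_algebra_over U (star p q ix r U)"
  unfolding comm_algebra_over_def
proof (intro conjI ballI allI impI)
  let ?s = "star p q ix r U" and ?n = "nff p q ix" and ?c = "congH p q ix r U"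
  note n = cholo_nff[OF _ U]
  {
    fix u v assume uv: "u \<in> log_fields U" "v \<in> log_fields U"
    show "?s u v \<in> log_fields U" by (rule star_spec[OF uv])
    fix \<beta> assume \<beta>: "\<beta> \<in> U"
    show "?s u v \<beta> = ?s v u \<beta>"
      by (rule star_eqI[OF uv star_spec(1)[OF uv(2,1)] _ \<beta>])
        (use star_spec(2)[OF uv(2,1)] in \<open>simp add: mult.commute\<close>)
  next
    fix u v w \<beta> assume uv: "u \<in> log_fields U" "v \<in> log_fields U" and w: "w \<in> log_fields U" and \<beta>: "\<beta> \<in> U"
    have "?c (?n (?s u (?s v w))) (\<lambda>z. ?n u z * ?n (?s v w) z)"
      by (rule star_spec(2)[OF uv(1) star_spec(1)[OF uv(2) w]])
    moreover have "?c (\<lambda>z. ?n u z * ?n (?s v w) z) (\<lambda>z. ?n u z * (?n v z * ?n w z))"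
      by (rule congH_cmult[OF star_spec(2)[OF uv(2) w] n[OF uv(1)]])
    moreover have "?c (\<lambda>z. ?n u z * (?n v z * ?n w z)) (\<lambda>z. ?n (?s u v) z * ?n w z)"
      using congH_sym[OF congH_cmult[OF star_spec(2)[OF uv] n[OF w, of p q ix]]] by (simp add: mult_ac)
    ultimately have "?c (?n (?s u (?s v w))) (\<lambda>z. ?n (?s u v) z * ?n w z)" using congH_trans by blast
    then show "?s (?s u v) w \<beta> = ?s u (?s v w) \<beta>"
      by (rule star_eqI[OF star_spec(1)[OF uv] w star_spec(1)[OF uv(1) star_spec(1)[OF uv(2) w]] _ \<beta>])
  next
    obtain e where e: "e \<in> log_fields U" "\<And>z. z \<in> tube r U \<Longrightarrow> nff p q ix e z = 1"
      using unit_field by blast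
    have "?s e u \<beta> = u \<beta>" if u: "u \<in> log_fields U" and \<beta>: "\<beta> \<in> U" for u \<beta>
      by (rule star_eqI[OF e(1) u u _ \<beta>]) (rule congH_eq_on, simp add: e)
    then show "\<exists>e\<in>log_fields U. \<forall>u\<in>log_fields U. \<forall>\<beta>\<in>U. ?s e u \<beta> = u \<beta>" using e by blast
  next
    fix f g :: "'m base \<Rightarrow> complex" and u v w \<beta>
    assume u: "u \<in> log_fields U" and v: "v \<in> log_fields U" and w: "w \<in> log_fields U"
      and fg: "f cholo_on U \<and> g cholo_on U" and \<beta>: "\<beta> \<in> U"
    let ?l = "\<lambda>u v \<beta>. cscale (f \<beta>) (u \<beta>) + cscale (g \<beta>) (v \<beta>)"
    have f: "f cholo_on U" and g: "g cholo_on U" using fg by auto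
    note L = log_fields_lincomb[OF _ _ f g]
    note s = star_spec(1)[OF u w] star_spec(1)[OF v w]
    have "?c (?n (?l (?s u w) (?s v w))) (\<lambda>z. f (proj z) * ?n (?s u w) z + g (proj z) * ?n (?s v w) z)"
      by (rule congH_eq_on) (rule nff_lincomb[OF s f g U])
    moreover have "?c (\<lambda>z. f (proj z) * ?n (?s u w) z + g (proj z) * ?n (?s v w) z)
       (\<lambda>z. f (proj z) * (?n u z * ?n w z) + g (proj z) * (?n v z * ?n w z))"
      by (intro congH_add congH_cmult star_spec u v w cholo_intros f g)
    moreover have "?c (\<lambda>z. f (proj z) * (?n u z * ?n w z) + g (proj z) * (?n v z * ?n w z))
       (\<lambda>z. ?n (?l u v) z * ?n w z)"
      by (rule congH_eq_on) (simp add: nff_lincomb[OF u v f g U] algebra_simps)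
    ultimately have "?c (?n (?l (?s u w) (?s v w))) (\<lambda>z. ?n (?l u v) z * ?n w z)" using congH_trans by blast
    then show "?s (?l u v) w \<beta> = cscale (f \<beta>) (?s u w \<beta>) + cscale (g \<beta>) (?s v w \<beta>)"
      by (rule star_eqI[OF L[OF u v] w L[OF s] _ \<beta>])
  }
qed

text \<open>The residue is the same for every appropriate radius and every representative of the
  product class, so both choices in \<open>pairing\<close> are harmless.\<close>

lemma pairing_eq:
  assumes u: "u \<in> log_fields U" and v: "v \<in> log_fields U" and \<beta>: "\<beta> \<in> U"
  shows "pairing p q ix r U u v \<beta> = gform p q ix u v \<beta>"
    and "appropriate p q ix r \<beta> \<rho> \<Longrightarrow>
      G \<in> tF p q ix r U u \<otimes>\<^bsub>jac_ring p q ix r U\<^esub> tF p q ix r U v \<Longrightarrow>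
      residue_integral p q ix \<rho> G \<beta> = gform p q ix u v \<beta>"
proof -
  let ?P = "tF p q ix r U u \<otimes>\<^bsub>jac_ring p q ix r U\<^esub> tF p q ix r U v"
  let ?N = "\<lambda>z. nff p q ix u z * nff p q ix v z"
  have P: "?P = jclass p q ix r U ?N"
    unfolding tF_eq(1)[OF u U p q] tF_eq(1)[OF v U p q]
    by (rule jclass_mult[OF p q U cholo_nff[OF u U] cholo_nff[OF v U]])
  show *: "residue_integral p q ix \<rho> G \<beta> = gform p q ix u v \<beta>"
    if "appropriate p q ix r \<beta> \<rho>" "G \<in> ?P" for \<rho> G
    using residue_nff[OF U UB \<beta> that(1) u v mem_jclassD[OF that(2)[unfolded P]]] .
  have "restrict ?N (tube r U) \<in> ?P"
    unfolding P by (rule restrict_mem_jclass[OF U cholo_const[of 0]]) auto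
  then have "(SOME G. G \<in> ?P) \<in> ?P" by (rule someI[where P = "\<lambda>G. G \<in> ?P"])
  moreover have "appropriate p q ix r \<beta> (SOME \<rho>. appropriate p q ix r \<beta> \<rho>)"
    by (rule someI_ex[where P = "appropriate p q ix r \<beta>"], rule appropriate_ex) (use \<beta> UB in blast)
  ultimately show "pairing p q ix r U u v \<beta> = gform p q ix u v \<beta>"
    unfolding pairing_def by (intro *)
qed

lemma pairing_wd: "pairing_well_defined p q ix r U"
  unfolding pairing_well_defined_def
proof (intro conjI ballI allI impI)
  show "\<exists>\<rho>. appropriate p q ix r \<beta> \<rho>" if "\<beta> \<in> U" for \<beta>
    using that UB by (intro appropriate_ex) auto
  fix u v \<beta> \<rho> G
  assume u: "u \<in> log_fields U" and v: "v \<in> log_fields U" and \<beta>: "\<beta> \<in> U"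
    and G: "appropriate p q ix r \<beta> \<rho> \<and> G \<in> tF p q ix r U u \<otimes>\<^bsub>jac_ring p q ix r U\<^esub> tF p q ix r U v"
  show "residue_integral p q ix \<rho> G \<beta> = pairing p q ix r U u v \<beta>"
    unfolding pairing_eq(1)[OF u v \<beta>]
    by (rule pairing_eq(2)[OF u v \<beta> conjunct1[OF G] conjunct2[OF G]])
qed

lemma cholo_pairing:
  assumes u: "u \<in> log_fields U" and v: "v \<in> log_fields U"
  shows "pairing p q ix r U u v cholo_on U"
  by (rule cholo_on_cong[OF cholo_gform[OF u v U] U]) (simp add: pairing_eq[OF u v])

lemma symmetric_pairing: "symmetric_form_over U (pairing p q ix r U)"
  unfolding symmetric_form_over_def
proof (intro conjI ballI allI impI)
  fix u v assume uv: "u \<in> log_fields U" "v \<in> log_fields U"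
  show "pairing p q ix r U u v cholo_on U" by (rule cholo_pairing[OF uv])
  show "pairing p q ix r U u v \<beta> = pairing p q ix r U v u \<beta>" if "\<beta> \<in> U" for \<beta>
    unfolding pairing_eq(1)[OF uv that] pairing_eq(1)[OF uv(2,1) that] by (rule gform_commute)
next
  fix f h :: "'m base \<Rightarrow> complex" and u v w \<beta>
  assume u: "u \<in> log_fields U" and v: "v \<in> log_fields U" and w: "w \<in> log_fields U"
    and fh: "f cholo_on U \<and> h cholo_on U" and \<beta>: "\<beta> \<in> U"
  have f: "f cholo_on U" and h: "h cholo_on U" using fh by auto
  show "pairing p q ix r U (\<lambda>\<gamma>. cscale (f \<gamma>) (u \<gamma>) + cscale (h \<gamma>) (v \<gamma>)) w \<beta> =
     f \<beta> * pairing p q ix r U u w \<beta> + h \<beta> * pairing p q ix r U v w \<beta>"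
    unfolding pairing_eq(1)[OF log_fields_lincomb[OF u v f h] w \<beta>] pairing_eq(1)[OF u w \<beta>] pairing_eq(1)[OF v w \<beta>]
    by (rule gform_lincomb[OF u v f h U \<beta>])
qed

text \<open>Both sides are the residue of the triple product of the normal forms.\<close>

lemma pairing_invariant:
  assumes u: "u \<in> log_fields U" and v: "v \<in> log_fields U" and w: "w \<in> log_fields U" and \<beta>: "\<beta> \<in> U"
  shows "pairing p q ix r U (star p q ix r U u v) w \<beta> = pairing p q ix r U u (star p q ix r U v w) \<beta>"
proof -
  let ?s = "star p q ix r U" and ?n = "nff p q ix" and ?c = "congH p q ix r U"
  obtain \<rho> where \<rho>: "appropriate p q ix r \<beta> \<rho>" using appropriate_ex \<beta> UB by blast
  have "?c (\<lambda>z. ?n w z * (?n u z * ?n v z)) (\<lambda>z. ?n w z * ?n (?s u v) z)"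
    by (rule congH_cmult[OF congH_sym[OF star_spec(2)[OF u v]] cholo_nff[OF w U]])
  then have "?c (\<lambda>z. ?n u z * ?n v z * ?n w z) (\<lambda>z. ?n (?s u v) z * ?n w z)"
    by (simp add: mult.commute)
  from residue_nff[OF U UB \<beta> \<rho> star_spec(1)[OF u v] w this]
  have 1: "gform p q ix (?s u v) w \<beta> = residue_integral p q ix \<rho> (\<lambda>z. ?n u z * ?n v z * ?n w z) \<beta>" by simp
  have "?c (\<lambda>z. ?n u z * (?n v z * ?n w z)) (\<lambda>z. ?n u z * ?n (?s v w) z)"
    by (rule congH_cmult[OF congH_sym[OF star_spec(2)[OF v w]] cholo_nff[OF u U]])
  then have "?c (\<lambda>z. ?n u z * ?n v z * ?n w z) (\<lambda>z. ?n u z * ?n (?s v w) z)"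
    by (simp add: mult.assoc)
  from residue_nff[OF U UB \<beta> \<rho> u star_spec(1)[OF v w] this]
  show ?thesis
    unfolding pairing_eq(1)[OF star_spec(1)[OF u v] w \<beta>] pairing_eq(1)[OF u star_spec(1)[OF v w] \<beta>] 1 .
qed

lemma pairing_nondegenerate:
  assumes u: "u \<in> log_fields U" and \<beta>: "\<beta> \<in> U" and nz: "u \<beta> \<noteq> 0"
  shows "\<exists>v\<in>log_fields U. pairing p q ix r U u v \<beta> \<noteq> 0"
  using log_field_zero_at[OF u U \<beta>] nz pairing_eq(1)[OF u _ \<beta>] by metis

end

lemma restriction_star:
  assumes U: "open U" "U \<subseteq> ball 0 \<delta>"
  shows "restriction_compatible U (star p q ix r)"
  unfolding restriction_compatible_def
proof (intro allI impI ballI)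
  fix V u v \<beta> assume "open V \<and> V \<subseteq> U" and u: "u \<in> log_fields U" and v: "v \<in> log_fields U" and \<beta>: "\<beta> \<in> V"
  then have V: "open V" "V \<subseteq> U" "V \<subseteq> ball 0 \<delta>" using U by auto
  have "u \<in> log_fields V" "v \<in> log_fields V" "star p q ix r U u v \<in> log_fields V"
    using log_fields_subset V(2) u v star_spec(1)[OF U u v] by blast+
  then show "star p q ix r V u v \<beta> = star p q ix r U u v \<beta>"
    by (rule star_eqI[OF V(1,3) _ _ _ congH_subset[OF star_spec(2)[OF U u v] V(2)] \<beta>])
qed

lemma restriction_pairing:
  assumes U: "open U" "U \<subseteq> ball 0 \<delta>"
  shows "restriction_compatible U (pairing p q ix r)"
  unfolding restriction_compatible_def
proof (intro allI impI ballI)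
  fix V u v \<beta> assume V: "open V \<and> V \<subseteq> U" and u: "u \<in> log_fields U" and v: "v \<in> log_fields U" and \<beta>: "\<beta> \<in> V"
  have "u \<in> log_fields V" "v \<in> log_fields V" using log_fields_subset V u v by blast+
  then show "pairing p q ix r V u v \<beta> = pairing p q ix r U u v \<beta>"
    using pairing_eq(1)[of V u v \<beta>] pairing_eq(1)[OF U u v, of \<beta>] V U \<beta> by fastforce
qed

end

section \<open>The Euler field\<close>

text \<open>A directional derivative that includes complex differentiability. \<open>V\<close> is a
  single vector, so that computations on the base and on the total space can be compared
  pointwise.\<close>

definition hasv :: "'a::cvec \<Rightarrow> ('a \<Rightarrow> complex) \<Rightarrow> complex \<Rightarrow> 'a \<Rightarrow> bool" where
  "hasv V f c z \<longleftrightarrow> (\<exists>D. has_cderiv f D z \<and> D V = c)"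

lemma hasvI: "has_cderiv f D z \<Longrightarrow> D V = c \<Longrightarrow> hasv V f c z"
  unfolding hasv_def by blast

lemma hasv_eq: "hasv V f c z \<Longrightarrow> c = c' \<Longrightarrow> hasv V f c' z"
  by simp

lemma hasv_vderiv: "hasv (V z) f c z \<Longrightarrow> vderiv V f z = c"
  unfolding hasv_def vderiv_def using has_cderiv_frechet by metis

lemma hasv_cholo: "f cholo_on S \<Longrightarrow> z \<in> S \<Longrightarrow> hasv (V z) f (vderiv V f z) z"
  unfolding hasv_def vderiv_def using cholo_on_has_cderiv by blast

lemma hasv_const: "hasv V (\<lambda>z. k) 0 z"
  unfolding hasv_def using has_cderiv_const by blast

lemma hasv_add: "hasv V f c z \<Longrightarrow> hasv V g d z \<Longrightarrow> hasv V (\<lambda>z. f z + g z) (c + d) z"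
  unfolding hasv_def using has_cderiv_add by blast

lemma hasv_diff: "hasv V f c z \<Longrightarrow> hasv V g d z \<Longrightarrow> hasv V (\<lambda>z. f z - g z) (c - d) z"
  unfolding hasv_def using has_cderiv_diff by blast

lemma hasv_mult: "hasv V f c z \<Longrightarrow> hasv V g d z \<Longrightarrow> hasv V (\<lambda>z. f z * g z) (f z * d + c * g z) z"
  unfolding hasv_def using has_cderiv_mult by blast

lemma hasv_cmult: "hasv V f c z \<Longrightarrow> hasv V (\<lambda>z. k * f z) (k * c) z"
  using hasv_mult[OF hasv_const] by fastforce

lemma hasv_sum:
  assumes "\<And>i. i \<in> I \<Longrightarrow> hasv V (f i) (c i) z"
  shows "hasv V (\<lambda>z. \<Sum>i\<in>I. f i z) (\<Sum>i\<in>I. c i) z"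
proof -
  obtain D where "\<And>i. i \<in> I \<Longrightarrow> has_cderiv (f i) (D i) z \<and> D i V = c i"
    using assms unfolding hasv_def by metis
  then show ?thesis unfolding hasv_def using has_cderiv_sum[of I f D z] by (auto intro!: sum.cong)
qed

lemma hasv_power: "hasv V f (k * f z) z \<Longrightarrow> hasv V (\<lambda>z. f z ^ n) (of_nat n * k * f z ^ n) z"
proof (induction n)
  case 0
  then show ?case using hasv_const[of V 1 z] by simp
next
  case (Suc n)
  show ?case using hasv_mult[OF Suc.prems Suc.IH[OF Suc.prems]] by (simp add: algebra_simps)
qed

lemma hasv_cong: "hasv V f c z \<Longrightarrow> open S \<Longrightarrow> z \<in> S \<Longrightarrow> (\<And>x. x \<in> S \<Longrightarrow> f x = g x) \<Longrightarrow> hasv V g c z"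
  unfolding hasv_def using has_cderiv_transform by metis

lemma hasv_compose_map:
  assumes "has_cderiv g D z" "hasv (D V) f c (g z)"
  shows "hasv V (\<lambda>z. f (g z)) c z"
  using assms has_cderiv_compose unfolding hasv_def by blast

lemma vderiv_components:
  fixes u :: "'a::cvec \<Rightarrow> 'b::cvec \<times> (complex ^ 'n)"
  assumes "u cholo_on S" "z \<in> S"
  shows "vderiv V (\<lambda>z. fst (u z)) z = fst (vderiv V u z)"
    and "vderiv V (\<lambda>z. snd (u z) $ k) z = snd (vderiv V u z) $ k"
  unfolding vderiv_def
  using has_cderiv_frechet[OF has_cderiv_compose[OF cholo_on_has_cderiv[OF assms] has_cderiv_fst]]
    has_cderiv_frechet[OF has_cderiv_compose[OF has_cderiv_compose[OF cholo_on_has_cderiv[OF assms] has_cderiv_snd] has_cderiv_nth]]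
  by simp_all

text \<open>If \<open>a_i\<close> has weight \<open>(p - i) / p\<close>, then \<open>kap\<close> of
  index \<open>m\<close> has weight \<open>m / p\<close>: in the recursion the weights
  \<open>l / p\<close> and \<open>(m - l) / p\<close> add up.\<close>

lemma hasv_kap:
  fixes a :: "'a::cvec \<Rightarrow> nat \<Rightarrow> complex"
  assumes p: "p \<ge> 1" and a: "\<And>i. i \<in> {1..<p} \<Longrightarrow> hasv V (\<lambda>z. a z i) (of_nat (p - i) / of_nat p * a z i) z"
  shows "hasv V (\<lambda>z. kap p (a z) m) (of_nat m / of_nat p * kap p (a z) m) z"
proof (induction m rule: less_induct)
  case (less m)
  show ?case
  proof (cases "m = 0")
    case True
    then show ?thesis using hasv_const by (simp add: kap_0)
  next
    case False
    let ?f = "\<lambda>l z. if l \<le> m then of_nat (p - l) * a z (p - l) * kap p (a z) (m - l) else 0"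
    have "hasv V (?f l) (of_nat m / of_nat p * ?f l z) z" if l: "l \<in> {1..<p}" for l
    proof (cases "l \<le> m")
      case True
      have l': "p - l \<in> {1..<p}" and "p - (p - l) = l" using l by auto
      then have 1: "hasv V (\<lambda>z. a z (p - l)) (of_nat l / of_nat p * a z (p - l)) z"
        using a[OF l'] by simp
      have 2: "hasv V (\<lambda>z. kap p (a z) (m - l)) (of_nat (m - l) / of_nat p * kap p (a z) (m - l)) z"
        using l False by (intro less) auto
      have "of_nat m / of_nat p = (of_nat (m - l) / of_nat p + of_nat l / of_nat p :: complex)"
        using True by (simp add: add_divide_distrib[symmetric] of_nat_add[symmetric] del: of_nat_add)
      moreover have "x * b * (w2 * k) + x * (w1 * b) * k = (w2 + w1) * (x * b * k)" for x b k w1 w2 :: complex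
        by (simp add: algebra_simps)
      ultimately have "hasv V (\<lambda>z. of_nat (p - l) * a z (p - l) * kap p (a z) (m - l))
          (of_nat m / of_nat p * (of_nat (p - l) * a z (p - l) * kap p (a z) (m - l))) z"
        using hasv_mult[OF hasv_cmult[OF 1, of "of_nat (p - l)"] 2] by (simp only:)
      then show ?thesis using True by simp
    qed (simp add: hasv_const)
    then have h: "hasv V (\<lambda>z. - 1 / of_nat p * (\<Sum>l\<in>{1..<p}. ?f l z))
        (- 1 / of_nat p * (\<Sum>l\<in>{1..<p}. of_nat m / of_nat p * ?f l z)) z"
      by (intro hasv_cmult hasv_sum)
    have k: "kap p (a z) m = - 1 / of_nat p * (\<Sum>l\<in>{1..<p}. ?f l z)" for z
      using False by (subst kap.simps) simp
    show ?thesis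
      unfolding k by (rule hasv_eq[OF h]) (simp add: sum_distrib_left mult_ac)
  qed
qed

text \<open>With \<open>w_i = (p - i) / p\<close>, the coefficient \<open>kap\<close> of index
  \<open>i + j - p\<close> has weight \<open>1 - w_i - w_j\<close>. Moving \<open>w_i\<close> and
  \<open>w_j\<close> to the two arguments leaves one copy of the form and the expressions
  \<open>dA i - w_i A i\<close>, which are components of a bracket with the Euler field.\<close>

lemma hasv_gram:
  fixes a A B :: "'a::cvec \<Rightarrow> nat \<Rightarrow> complex"
  assumes p: "p \<ge> 1" and a: "\<And>i. i \<in> {1..<p} \<Longrightarrow> hasv V (\<lambda>z. a z i) (of_nat (p - i) / of_nat p * a z i) z"
    and A: "\<And>i. i \<in> {1..<p} \<Longrightarrow> hasv V (\<lambda>z. A z i) (dA i) z"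
    and B: "\<And>i. i \<in> {1..<p} \<Longrightarrow> hasv V (\<lambda>z. B z i) (dB i) z"
  shows "hasv V (\<lambda>z. gram p (a z) (A z) (B z))
    (gram p (a z) (A z) (B z) + gram p (a z) (\<lambda>i. dA i - of_nat (p - i) / of_nat p * A z i) (B z)
      + gram p (a z) (A z) (\<lambda>i. dB i - of_nat (p - i) / of_nat p * B z i)) z"
proof -
  let ?k = "\<lambda>i j z. if p \<le> i + j then kap p (a z) (i + j - p) else 0"
  let ?w = "\<lambda>i. of_nat (p - i) / of_nat p :: complex"
  have k: "hasv V (?k i j) ((1 - ?w i - ?w j) * ?k i j z) z" if "i \<in> {1..<p}" "j \<in> {1..<p}" for i j
  proof (cases "p \<le> i + j")
    case True
    have "(1 - ?w i - ?w j) = of_nat (i + j - p) / of_nat p"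
      using that True p by (simp add: of_nat_diff field_simps)
    then show ?thesis using hasv_kap[of p V a z "i + j - p", OF p a] True by simp
  qed (simp add: hasv_const)
  have "hasv V (\<lambda>z. \<Sum>i\<in>{1..<p}. \<Sum>j\<in>{1..<p}. ?k i j z * A z i * B z j)
    (\<Sum>i\<in>{1..<p}. \<Sum>j\<in>{1..<p}. ?k i j z * A z i * dB j +
      (?k i j z * dA i + (1 - ?w i - ?w j) * ?k i j z * A z i) * B z j) z"
    by (intro hasv_sum hasv_mult k A B)
  then show ?thesis
    unfolding gram_def
    by (rule hasv_eq) (simp add: sum.distrib[symmetric] algebra_simps)
qed

section \<open>The Euler field, its lift and its brackets\<close>

definition wt :: "nat \<Rightarrow> nat \<Rightarrow> param \<Rightarrow> complex" where
  "wt p q l = (case l of PA i \<Rightarrow> of_nat (p - i) / of_nat p | PB i \<Rightarrow> of_nat (q - i) / of_nat q | PC \<Rightarrow> 1)"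

text \<open>With weights \<open>1 / p\<close> for \<open>x\<close> and \<open>1 / q\<close> for
  \<open>y\<close>, weight one of \<open>F\<close> forces the weights \<open>wt\<close> of the
  parameters, and \<open>\<epsilon> = x y\<close> gets the sum of the weights of \<open>x\<close>
  and \<open>y\<close>.\<close>

definition euler :: "nat \<Rightarrow> nat \<Rightarrow> (param \<Rightarrow> 'm::finite) \<Rightarrow> 'm base \<Rightarrow> 'm base" where
  "euler p q ix \<beta> = ((1 / of_nat p + 1 / of_nat q) * fst \<beta>,
     \<chi> k. wt p q (inv_into (params p q) ix k) * snd \<beta> $ k)"

definition euler_lift :: "nat \<Rightarrow> nat \<Rightarrow> (param \<Rightarrow> 'm::finite) \<Rightarrow> 'm total \<Rightarrow> 'm total" where
  "euler_lift p q ix z = (1 / of_nat p * fst z, 1 / of_nat q * fst (snd z),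
     \<chi> k. wt p q (inv_into (params p q) ix k) * snd (snd z) $ k)"

lemma cholo_euler: "euler p q ix cholo_on S"
  unfolding euler_def[abs_def] by (intro cholo_intros)

lemma cholo_euler_lift: "euler_lift p q ix cholo_on S"
  unfolding euler_lift_def[abs_def] by (intro cholo_intros)

lemma has_cderiv_euler: "has_cderiv (euler p q ix) (euler p q ix) \<beta>"
proof (rule has_cderiv_clinear)
  show "bounded_linear (euler p q ix)"
    unfolding linear_conv_bounded_linear[symmetric]
    by (rule linearI) (simp_all add: euler_def vec_eq_iff scaleR_conv_of_real algebra_simps add_divide_distrib)
qed (simp add: euler_def vec_eq_iff mult_ac)

lemma log_fields_euler: "euler p q ix \<in> log_fields U"
  by (rule log_fieldsI[where h = "\<lambda>_. 1 / of_nat p + 1 / of_nat q"]) (auto simp: cholo_euler euler_def)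

text \<open>The Euler field is linear, hence its own differential.\<close>

lemma bracket_euler: "bracket (euler p q ix) u \<beta> = vderiv (euler p q ix) u \<beta> - euler p q ix (u \<beta>)"
  unfolding bracket_def vderiv_def has_cderiv_frechet[OF has_cderiv_euler] ..

lemma has_cderiv_proj:
  "has_cderiv proj (\<lambda>v. (fst z * fst (snd v) + fst v * fst (snd z), snd (snd v))) z"
proof -
  have "frechet_derivative proj (at z) = (\<lambda>v. (fst z * fst (snd v) + fst v * fst (snd z), snd (snd v)))"
    by (rule ext) (rule frechet_proj)
  then show ?thesis using cholo_on_has_cderiv[OF cholo_proj, of z UNIV] by simp
qed

context miniversal
begin

lemma euler_par:
  "i \<in> {1..<p} \<Longrightarrow> apar ix (snd (euler p q ix \<beta>)) i = of_nat (p - i) / of_nat p * apar ix (snd \<beta>) i"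
  "i \<in> {1..<q} \<Longrightarrow> bpar ix (snd (euler p q ix \<beta>)) i = of_nat (q - i) / of_nat q * bpar ix (snd \<beta>) i"
  "snd (euler p q ix \<beta>) $ ix PC = snd \<beta> $ ix PC"
  by (simp_all add: euler_def apar_def bpar_def inv_ix params_mem wt_def)

lemma vderiv_coords:
  assumes u: "u cholo_on U" and \<beta>: "\<beta> \<in> U"
  shows "hasv (euler p q ix \<beta>) (\<lambda>\<beta>. apar ix (snd (u \<beta>)) i) (apar ix (snd (vderiv (euler p q ix) u \<beta>)) i) \<beta>"
    and "hasv (euler p q ix \<beta>) (\<lambda>\<beta>. bpar ix (snd (u \<beta>)) i) (bpar ix (snd (vderiv (euler p q ix) u \<beta>)) i) \<beta>"
    and "hasv (euler p q ix \<beta>) (\<lambda>\<beta>. snd (u \<beta>) $ k) (snd (vderiv (euler p q ix) u \<beta>) $ k) \<beta>"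
    and "hasv (euler p q ix \<beta>) (\<lambda>\<beta>. fst (u \<beta>)) (fst (vderiv (euler p q ix) u \<beta>)) \<beta>"
proof -
  show 1: "hasv (euler p q ix \<beta>) (\<lambda>\<beta>. snd (u \<beta>) $ k) (snd (vderiv (euler p q ix) u \<beta>) $ k) \<beta>" for k
    using hasv_cholo[of "\<lambda>\<beta>. snd (u \<beta>) $ k" U \<beta> "euler p q ix"] vderiv_components(2)[OF u \<beta>] u \<beta>
    by (simp add: cholo_intros)
  show "hasv (euler p q ix \<beta>) (\<lambda>\<beta>. fst (u \<beta>)) (fst (vderiv (euler p q ix) u \<beta>)) \<beta>"
    using hasv_cholo[of "\<lambda>\<beta>. fst (u \<beta>)" U \<beta> "euler p q ix"] vderiv_components(1)[OF u \<beta>] u \<beta>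
    by (simp add: cholo_intros)
  show "hasv (euler p q ix \<beta>) (\<lambda>\<beta>. apar ix (snd (u \<beta>)) i) (apar ix (snd (vderiv (euler p q ix) u \<beta>)) i) \<beta>"
    "hasv (euler p q ix \<beta>) (\<lambda>\<beta>. bpar ix (snd (u \<beta>)) i) (bpar ix (snd (vderiv (euler p q ix) u \<beta>)) i) \<beta>"
    unfolding apar_def bpar_def by (rule 1)+
qed

lemma cholo_bracket:
  assumes u: "u cholo_on U" and U: "open U"
  shows "bracket (euler p q ix) u cholo_on U"
proof -
  have "(\<lambda>\<beta>. (vderiv (euler p q ix) (\<lambda>\<beta>. fst (u \<beta>)) \<beta>, \<chi> k. vderiv (euler p q ix) (\<lambda>\<beta>. snd (u \<beta>) $ k) \<beta>)
      - euler p q ix (u \<beta>)) cholo_on U"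
    by (intro cholo_diff cholo_Pair cholo_vec cholo_vderiv cholo_euler U cholo_fst cholo_nth cholo_snd u
        cholo_compose[OF cholo_euler u UNIV_I])
  then show ?thesis
    by (rule cholo_on_cong[OF _ U])
      (simp add: bracket_euler vderiv_components[OF u] prod_eq_iff vec_eq_iff)
qed

text \<open>With \<open>d\<epsilon>(u) = \<epsilon> h\<close>, the weight of \<epsilon> cancels in
  the bracket, so that \<open>h\<close> is replaced by its Euler derivative without any
  shift.\<close>

lemma bracket_euler_log:
  assumes u: "u \<in> log_fields U" and U: "open U"
  shows "bracket (euler p q ix) u \<in> log_fields U"
    and "\<beta> \<in> U \<Longrightarrow> hco (bracket (euler p q ix) u) \<beta> = vderiv (euler p q ix) (hco u) \<beta>"
proof -
  let ?E = "euler p q ix"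
  note uc = log_fields_cholo[OF u]
  have hc: "vderiv ?E (hco u) cholo_on U" by (intro cholo_vderiv cholo_hco u U cholo_euler)
  have f: "fst (bracket ?E u \<beta>) = fst \<beta> * vderiv ?E (hco u) \<beta>" if \<beta>: "\<beta> \<in> U" for \<beta>
  proof -
    have h: "hasv (?E \<beta>) (hco u) (vderiv ?E (hco u) \<beta>) \<beta>" by (rule hasv_cholo[OF cholo_hco[OF u U] \<beta>])
    have e: "hasv (?E \<beta>) fst (fst (?E \<beta>)) \<beta>" unfolding hasv_def using has_cderiv_fst by blast
    have "hasv (?E \<beta>) (\<lambda>\<beta>. fst (u \<beta>)) (fst \<beta> * vderiv ?E (hco u) \<beta> + fst (?E \<beta>) * hco u \<beta>) \<beta>"
      by (rule hasv_cong[OF hasv_mult[OF e h] U \<beta>]) (rule hco_mult[OF u])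
    then have "fst (vderiv ?E u \<beta>) = fst \<beta> * vderiv ?E (hco u) \<beta> + fst (?E \<beta>) * hco u \<beta>"
      using hasv_vderiv vderiv_components(1)[OF uc \<beta>] by metis
    moreover have "fst (?E (u \<beta>)) = fst (?E \<beta>) * hco u \<beta>"
      using hco_mult[OF u \<beta>] by (simp add: euler_def mult.assoc)
    ultimately show ?thesis by (simp add: bracket_euler)
  qed
  show L: "bracket ?E u \<in> log_fields U" by (rule log_fieldsI[OF cholo_bracket[OF uc U] f])
  show "hco (bracket ?E u) \<beta> = vderiv ?E (hco u) \<beta>" if "\<beta> \<in> U"
    by (rule hco_unique[OF L U hc _ that]) (simp add: f)
qed

lemma hasv_euler_lift:
  shows "hasv (euler_lift p q ix z) fst (1 / of_nat p * fst z) z"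
    and "hasv (euler_lift p q ix z) (\<lambda>z. fst (snd z)) (1 / of_nat q * fst (snd z)) z"
    and "i \<in> {1..<p} \<Longrightarrow> hasv (euler_lift p q ix z) (\<lambda>z. apar ix (snd (snd z)) i)
      (of_nat (p - i) / of_nat p * apar ix (snd (snd z)) i) z"
    and "i \<in> {1..<q} \<Longrightarrow> hasv (euler_lift p q ix z) (\<lambda>z. bpar ix (snd (snd z)) i)
      (of_nat (q - i) / of_nat q * bpar ix (snd (snd z)) i) z"
    and "hasv (euler p q ix (proj z)) f c (proj z) \<Longrightarrow> hasv (euler_lift p q ix z) (\<lambda>z. f (proj z)) c z"
proof -
  show "hasv (euler_lift p q ix z) fst (1 / of_nat p * fst z) z"
    by (rule hasvI[OF has_cderiv_fst]) (simp add: euler_lift_def)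
  show "hasv (euler_lift p q ix z) (\<lambda>z. fst (snd z)) (1 / of_nat q * fst (snd z)) z"
    by (rule hasvI[OF has_cderiv_compose[OF has_cderiv_snd has_cderiv_fst]]) (simp add: euler_lift_def)
  show "i \<in> {1..<p} \<Longrightarrow> hasv (euler_lift p q ix z) (\<lambda>z. apar ix (snd (snd z)) i)
      (of_nat (p - i) / of_nat p * apar ix (snd (snd z)) i) z"
    unfolding apar_def
    by (rule hasvI[OF has_cderiv_compose[OF has_cderiv_compose[OF has_cderiv_snd has_cderiv_snd] has_cderiv_nth]])
      (simp add: euler_lift_def inv_ix params_mem wt_def)
  show "i \<in> {1..<q} \<Longrightarrow> hasv (euler_lift p q ix z) (\<lambda>z. bpar ix (snd (snd z)) i)
      (of_nat (q - i) / of_nat q * bpar ix (snd (snd z)) i) z"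
    unfolding bpar_def
    by (rule hasvI[OF has_cderiv_compose[OF has_cderiv_compose[OF has_cderiv_snd has_cderiv_snd] has_cderiv_nth]])
      (simp add: euler_lift_def inv_ix params_mem wt_def)
  \<comment> \<open>The lift covers the Euler field, so functions pulled back from the base are
    differentiated on the base.\<close>
  have "(fst z * fst (snd (euler_lift p q ix z)) + fst (euler_lift p q ix z) * fst (snd z), snd (snd (euler_lift p q ix z)))
      = euler p q ix (proj z)"
    by (simp add: euler_lift_def euler_def proj_eq algebra_simps)
  then show "hasv (euler p q ix (proj z)) f c (proj z) \<Longrightarrow> hasv (euler_lift p q ix z) (\<lambda>z. f (proj z)) c z"
    by (intro hasv_compose_map[OF has_cderiv_proj]) simp
qed

lemma hasv_monomial:
  shows "hasv (euler_lift p q ix z) (\<lambda>z. fst z ^ i) (of_nat i / of_nat p * fst z ^ i) z"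
    and "hasv (euler_lift p q ix z) (\<lambda>z. fst (snd z) ^ i) (of_nat i / of_nat q * fst (snd z) ^ i) z"
  using hasv_power[OF hasv_euler_lift(1), of z i] hasv_power[OF hasv_euler_lift(2), of z i] by simp_all

lemma weights: "i \<in> {1..<n} \<Longrightarrow> of_nat (n - i) / of_nat n + of_nat i / of_nat n = (1 :: complex)"
  by (simp add: add_divide_distrib[symmetric] of_nat_diff)

lemma hasv_pol:
  shows "hasv (euler_lift p q ix z) (\<lambda>z. pol p (apar ix (snd (snd z))) (fst z)) (pol p (apar ix (snd (snd z))) (fst z)) z"
    and "hasv (euler_lift p q ix z) (\<lambda>z. pol q (bpar ix (snd (snd z))) (fst (snd z))) (pol q (bpar ix (snd (snd z))) (fst (snd z))) z"
proof -
  have 1: "of_nat i * a * (of_nat i / of_nat n * x) + of_nat i * (of_nat (n - i) / of_nat n * a) * x = of_nat i * a * x"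
    if "i \<in> {1..<n}" for i n and a x :: complex
  proof -
    have "of_nat i * a * (of_nat i / of_nat n * x) + of_nat i * (of_nat (n - i) / of_nat n * a) * x =
      (of_nat (n - i) / of_nat n + of_nat i / of_nat n) * (of_nat i * a * x)" by (simp add: algebra_simps)
    then show ?thesis unfolding weights[OF that] by simp
  qed
  have "hasv (euler_lift p q ix z) (\<lambda>z. pol p (apar ix (snd (snd z))) (fst z))
    (of_nat p * (of_nat p / of_nat p * fst z ^ p) +
     (\<Sum>i\<in>{1..<p}. of_nat i * apar ix (snd (snd z)) i * (of_nat i / of_nat p * fst z ^ i) +
        of_nat i * (of_nat (p - i) / of_nat p * apar ix (snd (snd z)) i) * fst z ^ i)) z"
    unfolding pol_def by (intro hasv_add hasv_sum hasv_mult hasv_cmult hasv_monomial hasv_euler_lift)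
  then show "hasv (euler_lift p q ix z) (\<lambda>z. pol p (apar ix (snd (snd z))) (fst z)) (pol p (apar ix (snd (snd z))) (fst z)) z"
    by (rule hasv_eq, unfold pol_def, intro arg_cong2[where f = "(+)"] sum.cong refl 1) (use p in auto)
  have "hasv (euler_lift p q ix z) (\<lambda>z. pol q (bpar ix (snd (snd z))) (fst (snd z)))
    (of_nat q * (of_nat q / of_nat q * fst (snd z) ^ q) +
     (\<Sum>i\<in>{1..<q}. of_nat i * bpar ix (snd (snd z)) i * (of_nat i / of_nat q * fst (snd z) ^ i) +
        of_nat i * (of_nat (q - i) / of_nat q * bpar ix (snd (snd z)) i) * fst (snd z) ^ i)) z"
    unfolding pol_def by (intro hasv_add hasv_sum hasv_mult hasv_cmult hasv_monomial hasv_euler_lift)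
  then show "hasv (euler_lift p q ix z) (\<lambda>z. pol q (bpar ix (snd (snd z))) (fst (snd z))) (pol q (bpar ix (snd (snd z))) (fst (snd z))) z"
    by (rule hasv_eq, unfold pol_def, intro arg_cong2[where f = "(+)"] sum.cong refl 1) (use q in auto)
qed

lemma hasv_Hdef: "hasv (euler_lift p q ix z) (Hdef p q ix) (Hdef p q ix z) z"
proof -
  have "Hdef p q ix = (\<lambda>z. pol p (apar ix (snd (snd z))) (fst z) - pol q (bpar ix (snd (snd z))) (fst (snd z)))"
    by (rule ext) (rule Hdef_eq[OF p q])
  then show ?thesis using hasv_diff[OF hasv_pol] by simp
qed

text \<open>\<open>F\<close> has weight one for the Euler field; on normal forms, the bracket with it is therefore the
  Euler derivative minus the identity.\<close>

lemma hasv_nff: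
  assumes u: "u \<in> log_fields U" and U: "open U" and z: "z \<in> tube r U"
  shows "hasv (euler_lift p q ix z) (nff p q ix u) (nff p q ix (bracket (euler p q ix) u) z + nff p q ix u z) z"
proof -
  let ?E = "euler p q ix" and ?\<beta> = "proj z"
  have \<beta>: "?\<beta> \<in> U" by (rule proj_tube[OF z])
  note uc = log_fields_cholo[OF u]
  note vc = vderiv_coords[OF uc \<beta>]
  have h: "hasv (?E ?\<beta>) (hco u) (hco (bracket ?E u) ?\<beta>) ?\<beta>"
    using hasv_cholo[OF cholo_hco[OF u U] \<beta>, of ?E] bracket_euler_log(2)[OF u U \<beta>] by simp
  have bA: "apar ix (snd (vderiv ?E u ?\<beta>)) i = apar ix (snd (bracket ?E u ?\<beta>)) i + of_nat (p - i) / of_nat p * apar ix (snd (u ?\<beta>)) i"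
    if "i \<in> {1..<p}" for i
    using euler_par(1)[OF that, of "u ?\<beta>"] by (simp add: bracket_euler apar_def)
  have bB: "bpar ix (snd (vderiv ?E u ?\<beta>)) i = bpar ix (snd (bracket ?E u ?\<beta>)) i + of_nat (q - i) / of_nat q * bpar ix (snd (u ?\<beta>)) i"
    if "i \<in> {1..<q}" for i
    using euler_par(2)[OF that, of "u ?\<beta>"] by (simp add: bracket_euler bpar_def)
  have bc: "snd (vderiv ?E u ?\<beta>) $ ix PC = snd (bracket ?E u ?\<beta>) $ ix PC + snd (u ?\<beta>) $ ix PC"
    using euler_par(3)[of "u ?\<beta>"] by (simp add: bracket_euler)
  have 1: "a * (of_nat i / of_nat n * x) + (b + of_nat (n - i) / of_nat n * a) * x = b * x + a * x"
    if "i \<in> {1..<n}" for i n and a b x :: complex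
  proof -
    have "a * (of_nat i / of_nat n * x) + (b + of_nat (n - i) / of_nat n * a) * x =
      b * x + (of_nat (n - i) / of_nat n + of_nat i / of_nat n) * (a * x)" by (simp add: algebra_simps)
    then show ?thesis unfolding weights[OF that] by simp
  qed
  have SA: "(\<Sum>i\<in>{1..<p}. apar ix (snd (u ?\<beta>)) i * (of_nat i / of_nat p * fst z ^ i) + apar ix (snd (vderiv ?E u ?\<beta>)) i * fst z ^ i) =
      (\<Sum>i\<in>{1..<p}. apar ix (snd (bracket ?E u ?\<beta>)) i * fst z ^ i) + (\<Sum>i\<in>{1..<p}. apar ix (snd (u ?\<beta>)) i * fst z ^ i)"
    unfolding sum.distrib[symmetric] by (rule sum.cong[OF refl]) (simp only: bA 1)
  have SB: "(\<Sum>i\<in>{1..<q}. bpar ix (snd (u ?\<beta>)) i * (of_nat i / of_nat q * fst (snd z) ^ i) + bpar ix (snd (vderiv ?E u ?\<beta>)) i * fst (snd z) ^ i) =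
      (\<Sum>i\<in>{1..<q}. bpar ix (snd (bracket ?E u ?\<beta>)) i * fst (snd z) ^ i) + (\<Sum>i\<in>{1..<q}. bpar ix (snd (u ?\<beta>)) i * fst (snd z) ^ i)"
    unfolding sum.distrib[symmetric] by (rule sum.cong[OF refl]) (simp only: bB 1)
  have "hasv (euler_lift p q ix z) (\<lambda>z. hco u (proj z) * pol p (apar ix (snd (snd z))) (fst z) +
       (\<Sum>i\<in>{1..<p}. apar ix (snd (u (proj z))) i * fst z ^ i) +
       (\<Sum>i\<in>{1..<q}. bpar ix (snd (u (proj z))) i * fst (snd z) ^ i) + snd (u (proj z)) $ ix PC)
     (hco u (proj z) * pol p (apar ix (snd (snd z))) (fst z) + hco (bracket ?E u) ?\<beta> * pol p (apar ix (snd (snd z))) (fst z) +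
       (\<Sum>i\<in>{1..<p}. apar ix (snd (u (proj z))) i * (of_nat i / of_nat p * fst z ^ i) + apar ix (snd (vderiv ?E u ?\<beta>)) i * fst z ^ i) +
       (\<Sum>i\<in>{1..<q}. bpar ix (snd (u (proj z))) i * (of_nat i / of_nat q * fst (snd z) ^ i) + bpar ix (snd (vderiv ?E u ?\<beta>)) i * fst (snd z) ^ i)
       + snd (vderiv ?E u ?\<beta>) $ ix PC) z"
    by (intro hasv_add hasv_sum hasv_mult hasv_monomial hasv_pol hasv_euler_lift(5)[OF h]
        hasv_euler_lift(5)[OF vc(1)] hasv_euler_lift(5)[OF vc(2)] hasv_euler_lift(5)[OF vc(3)])
  then show ?thesis
    unfolding nff_def nfd_def[abs_def] nform_def bc SA SB by (rule hasv_eq) (simp add: add_ac)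
qed

text \<open>Differentiates \<open>nff w = nff u * nff v + H K\<close>, for the product
  \<open>w\<close>, along the lifted Euler field. The term \<open>H K\<close> stays in the ideal
  because \<open>H\<close> has weight one. By \<open>hasv_nff\<close> the left side gains one copy
  of the product and the right side two; the surplus copy is the claim.\<close>

lemma Lie_star:
  assumes U: "open U" "U \<subseteq> ball 0 \<delta>" and u: "u \<in> log_fields U" and v: "v \<in> log_fields U" and \<beta>: "\<beta> \<in> U"
  shows "Lie_mult (euler p q ix) (star p q ix r U) u v \<beta> = star p q ix r U u v \<beta>"
proof -
  let ?E = "euler p q ix" and ?Et = "euler_lift p q ix" and ?s = "star p q ix r U" and ?n = "nff p q ix"
  let ?H = "Hdef p q ix" and ?w = "?s u v"
  note T = open_tube[OF U(1), of r]
  note bu = bracket_euler_log(1)[OF u U(1)] and bv = bracket_euler_log(1)[OF v U(1)]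
  note w = star_spec[OF U u v]
  note w1 = star_spec[OF U bu v] and w2 = star_spec[OF U u bv]
  note bw = bracket_euler_log(1)[OF w(1) U(1)]
  obtain K where K: "K cholo_on tube r U" "\<And>z. z \<in> tube r U \<Longrightarrow> ?n ?w z = ?n u z * ?n v z + ?H z * K z"
    using w(2) unfolding congH_def by blast
  obtain K1 where K1: "K1 cholo_on tube r U"
    "\<And>z. z \<in> tube r U \<Longrightarrow> ?n (?s (bracket ?E u) v) z = ?n (bracket ?E u) z * ?n v z + ?H z * K1 z"
    using w1(2) unfolding congH_def by blast
  obtain K2 where K2: "K2 cholo_on tube r U"
    "\<And>z. z \<in> tube r U \<Longrightarrow> ?n (?s u (bracket ?E v)) z = ?n u z * ?n (bracket ?E v) z + ?H z * K2 z"
    using w2(2) unfolding congH_def by blast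
  let ?X1 = "\<lambda>\<beta>. bracket ?E ?w \<beta> - ?s (bracket ?E u) v \<beta>"
  let ?X = "\<lambda>\<beta>. ?X1 \<beta> - ?s u (bracket ?E v) \<beta>"
  have X1: "?X1 \<in> log_fields U" by (rule log_fields_diff[OF bw w1(1)])
  have X: "?X \<in> log_fields U" by (rule log_fields_diff[OF X1 w2(1)])
  have "?n ?X z = ?n ?w z + ?H z * (vderiv ?Et K z - K1 z - K2 z - K z)" if z: "z \<in> tube r U" for z
  proof -
    have "hasv (?Et z) (\<lambda>z. ?n u z * ?n v z + ?H z * K z)
       ((?n u z * (?n (bracket ?E v) z + ?n v z) + (?n (bracket ?E u) z + ?n u z) * ?n v z) +
        (?H z * vderiv ?Et K z + ?H z * K z)) z"
      by (intro hasv_add hasv_mult hasv_nff[OF u U(1) z] hasv_nff[OF v U(1) z] hasv_Hdef hasv_cholo[OF K(1) z])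
    then have "hasv (?Et z) (?n ?w)
       ((?n u z * (?n (bracket ?E v) z + ?n v z) + (?n (bracket ?E u) z + ?n u z) * ?n v z) +
        (?H z * vderiv ?Et K z + ?H z * K z)) z"
      by (rule hasv_cong[OF _ T z]) (simp add: K(2))
    then have "?n (bracket ?E ?w) z + ?n ?w z = (?n u z * (?n (bracket ?E v) z + ?n v z) + (?n (bracket ?E u) z + ?n u z) * ?n v z) +
        (?H z * vderiv ?Et K z + ?H z * K z)"
      using hasv_nff[OF w(1) U(1) z] hasv_vderiv[of ?Et z "?n ?w"] by metis
    moreover have "?n ?X z = ?n (bracket ?E ?w) z - ?n (?s (bracket ?E u) v) z - ?n (?s u (bracket ?E v)) z"
      using nff_diff[OF X1 w2(1) U(1) z] nff_diff[OF bw w1(1) U(1) z] by simp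
    ultimately show ?thesis using K(2)[OF z] K1(2)[OF z] K2(2)[OF z] by (simp add: algebra_simps)
  qed
  moreover have "(\<lambda>z. vderiv ?Et K z - K1 z - K2 z - K z) cholo_on tube r U"
    by (intro cholo_intros cholo_vderiv K K1 K2 T cholo_euler_lift)
  ultimately have "congH p q ix r U (?n ?X) (?n ?w)" unfolding congH_def by blast
  from nff_unique[OF U X w(1) this \<beta>] show ?thesis by (simp add: Lie_mult_def)
qed

text \<open>A count on the explicit form: the coefficient \<open>hco\<close> is not shifted by the
  bracket, the \<open>c\<close>-component is shifted by one, and \<open>hasv_gram\<close> accounts
  for the Gram parts. Each summand is left with one extra copy of itself.\<close>

lemma Lie_pairing:
  assumes U: "open U" "U \<subseteq> ball 0 \<delta>" and u: "u \<in> log_fields U" and v: "v \<in> log_fields U" and \<beta>: "\<beta> \<in> U"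
  shows "Lie_form (euler p q ix) (pairing p q ix r U) u v \<beta> = pairing p q ix r U u v \<beta>"
proof -
  let ?E = "euler p q ix"
  note bu = bracket_euler_log(1)[OF u U(1)] and bv = bracket_euler_log(1)[OF v U(1)]
  note vu = vderiv_coords[OF log_fields_cholo[OF u] \<beta>] and vv = vderiv_coords[OF log_fields_cholo[OF v] \<beta>]
  note vi = vderiv_coords[OF cholo_id[of U] \<beta>]
  have id: "vderiv ?E (\<lambda>\<beta>. \<beta>) \<beta> = ?E \<beta>" by (simp add: vderiv_def)
  have hu: "hasv (?E \<beta>) (hco u) (hco (bracket ?E u) \<beta>) \<beta>"
    using hasv_cholo[OF cholo_hco[OF u U(1)] \<beta>, of ?E] bracket_euler_log(2)[OF u U(1) \<beta>] by simp
  have hv: "hasv (?E \<beta>) (hco v) (hco (bracket ?E v) \<beta>) \<beta>"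
    using hasv_cholo[OF cholo_hco[OF v U(1)] \<beta>, of ?E] bracket_euler_log(2)[OF v U(1) \<beta>] by simp
  have a: "hasv (?E \<beta>) (\<lambda>\<beta>. apar ix (snd \<beta>) i) (of_nat (p - i) / of_nat p * apar ix (snd \<beta>) i) \<beta>" if "i \<in> {1..<p}" for i
    using vi(1)[of i] euler_par(1)[OF that, of \<beta>] unfolding id by simp
  have b: "hasv (?E \<beta>) (\<lambda>\<beta>. bpar ix (snd \<beta>) i) (of_nat (q - i) / of_nat q * bpar ix (snd \<beta>) i) \<beta>" if "i \<in> {1..<q}" for i
    using vi(2)[of i] euler_par(2)[OF that, of \<beta>] unfolding id by simp
  have bA: "apar ix (snd (bracket ?E w \<beta>)) i = apar ix (snd (vderiv ?E w \<beta>)) i - of_nat (p - i) / of_nat p * apar ix (snd (w \<beta>)) i"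
    if "i \<in> {1..<p}" for i w
    using euler_par(1)[OF that, of "w \<beta>"] by (simp add: bracket_euler apar_def)
  have bB: "bpar ix (snd (bracket ?E w \<beta>)) i = bpar ix (snd (vderiv ?E w \<beta>)) i - of_nat (q - i) / of_nat q * bpar ix (snd (w \<beta>)) i"
    if "i \<in> {1..<q}" for i w
    using euler_par(2)[OF that, of "w \<beta>"] by (simp add: bracket_euler bpar_def)
  have bc: "snd (bracket ?E w \<beta>) $ ix PC = snd (vderiv ?E w \<beta>) $ ix PC - snd (w \<beta>) $ ix PC" for w
    using euler_par(3)[of "w \<beta>"] by (simp add: bracket_euler)
  let ?ga = "gram p (apar ix (snd \<beta>))" and ?gb = "gram q (bpar ix (snd \<beta>))"
  let ?A = "\<lambda>w. apar ix (snd (w \<beta>))" and ?B = "\<lambda>w. bpar ix (snd (w \<beta>))"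
  have ga: "?ga (?A (bracket ?E w)) C = ?ga (\<lambda>i. apar ix (snd (vderiv ?E w \<beta>)) i - of_nat (p - i) / of_nat p * ?A w i) C"
    for w C by (rule gram_cong) (auto simp: bA)
  have gb: "?gb (?B (bracket ?E w)) C = ?gb (\<lambda>i. bpar ix (snd (vderiv ?E w \<beta>)) i - of_nat (q - i) / of_nat q * ?B w i) C"
    for w C by (rule gram_cong) (auto simp: bB)
  have "hasv (?E \<beta>) (gform p q ix u v) (2 * of_real pi * \<i> *
     ((hco u \<beta> * snd (vderiv ?E v \<beta>) $ ix PC + hco (bracket ?E u) \<beta> * snd (v \<beta>) $ ix PC) +
      (snd (u \<beta>) $ ix PC * hco (bracket ?E v) \<beta> + snd (vderiv ?E u \<beta>) $ ix PC * hco v \<beta>) +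
      (?ga (?A u) (?A v) + ?ga (\<lambda>i. apar ix (snd (vderiv ?E u \<beta>)) i - of_nat (p - i) / of_nat p * ?A u i) (?A v)
        + ?ga (?A u) (\<lambda>i. apar ix (snd (vderiv ?E v \<beta>)) i - of_nat (p - i) / of_nat p * ?A v i)) +
      (?gb (?B u) (?B v) + ?gb (\<lambda>i. bpar ix (snd (vderiv ?E u \<beta>)) i - of_nat (q - i) / of_nat q * ?B u i) (?B v)
        + ?gb (?B u) (\<lambda>i. bpar ix (snd (vderiv ?E v \<beta>)) i - of_nat (q - i) / of_nat q * ?B v i)))) \<beta>"
    unfolding gform_def[abs_def]
    by (intro hasv_cmult hasv_add hasv_mult hasv_gram hu hv vu vv a b p q)
  then have d: "hasv (?E \<beta>) (pairing p q ix r U u v) (gform p q ix u v \<beta> + gform p q ix (bracket ?E u) v \<beta> +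
      gform p q ix u (bracket ?E v) \<beta>) \<beta>"
  proof (rule hasv_eq[OF hasv_cong[OF _ U(1) \<beta>]])
    show "gform p q ix u v \<gamma> = pairing p q ix r U u v \<gamma>" if "\<gamma> \<in> U" for \<gamma>
      by (rule pairing_eq(1)[OF U u v that, symmetric])
  qed (simp add: gform_def ga gb bc gram_commute[of _ _ _ "?A (bracket ?E v)"] gram_commute[of _ _ _ "?B (bracket ?E v)"]
      gram_commute[of _ _ "?A u"] gram_commute[of _ _ "?B u"] algebra_simps)
  show ?thesis
    unfolding Lie_form_def hasv_vderiv[where V = "euler p q ix", OF d] pairing_eq(1)[OF U u v \<beta>] pairing_eq(1)[OF U bu v \<beta>]
      pairing_eq(1)[OF U u bv \<beta>] by simp
qed

end

section \<open>Flat coordinates\<close>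

lemma ecoef_eq:
  assumes "n \<noteq> 0"
  shows "ecoef p t c n = 1 / of_nat n * (c * (\<Sum>k=1..n. of_nat k * ((if k < p then t k else 0) * ecoef p t c (n - k))))"
  using ecoef_rec[of n p t c] assms by (simp add: field_simps)

lemma cholo_ecoef [cholo_intros]:
  fixes t :: "'a::cvec \<Rightarrow> nat \<Rightarrow> complex"
  assumes t: "\<And>k. k \<in> {1..<p} \<Longrightarrow> (\<lambda>z. t z k) cholo_on S"
  shows "(\<lambda>z. ecoef p (t z) c n) cholo_on S"
proof (induction n rule: less_induct)
  case (less n)
  show ?case
  proof (cases "n = 0")
    case False
    have "(\<lambda>z. if k < p then t z k else 0) cholo_on S" if "k \<in> {1..n}" for k
      using t[of k] that by (cases "k < p") (auto intro: cholo_const)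
    then show ?thesis
      unfolding ecoef_eq[OF False] by (intro cholo_intros less) auto
  qed (simp add: cholo_const)
qed

text \<open>The coefficient of \<open>z ^ n\<close> in \<open>c (\<delta>T) exp (c T)\<close>, the
  first variation of \<open>exp (c T)\<close> when the coefficients of \<open>T\<close> move with
  velocity \<open>dt\<close>.\<close>

definition variation :: "nat \<Rightarrow> (nat \<Rightarrow> complex) \<Rightarrow> (nat \<Rightarrow> complex) \<Rightarrow> complex \<Rightarrow> nat \<Rightarrow> complex" where
  "variation p t dt c n = c * (\<Sum>k=1..n. (if k < p then dt k else 0) * ecoef p t c (n - k))"

text \<open>Both sides are coefficients of the derivative of \<open>c (\<delta>T) exp (c T)\<close>.\<close>

lemma variation_rec:
  assumes "n \<ge> 1"
  shows "of_nat n * variation p t dt c n = c * (\<Sum>k=1..n. of_nat k *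
    ((if k < p then t k else 0) * variation p t dt c (n - k) + (if k < p then dt k else 0) * ecoef p t c (n - k)))"
proof -
  obtain m where n: "n = Suc m" using assms by (cases n) auto
  let ?T = "Abs_fps (\<lambda>k. if 1 \<le> k \<and> k < p then t k else 0)"
  let ?dT = "Abs_fps (\<lambda>k. if 1 \<le> k \<and> k < p then dt k else 0)"
  let ?D = "fps_const c * (?dT * expT p t c)"
  have D: "fps_nth ?D k = variation p t dt c k" for k
  proof -
    have "fps_nth ?D k = c * (\<Sum>i=0..k. fps_nth ?dT i * ecoef p t c (k - i))"
      unfolding fps_mult_left_const_nth unfolding fps_mult_nth ecoef_def ..
    also have "(\<Sum>i=0..k. fps_nth ?dT i * ecoef p t c (k - i)) =
       (\<Sum>i=1..k. (if i < p then dt i else 0) * ecoef p t c (k - i))"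
      by (rule sum.mono_neutral_cong_right) auto
    finally show ?thesis by (simp add: variation_def)
  qed
  have e: "fps_deriv ?D = fps_const c * (fps_deriv ?T * ?D + fps_deriv ?dT * expT p t c)"
    by (simp add: fps_deriv_expT algebra_simps)
  have "of_nat n * variation p t dt c n = fps_nth (fps_deriv ?D) m"
    by (simp only: fps_deriv_nth D n Suc_eq_plus1)
  also have "\<dots> = c * (fps_nth (fps_deriv ?T * ?D) m + fps_nth (fps_deriv ?dT * expT p t c) m)"
    by (simp only: e fps_mult_left_const_nth fps_add_nth)
  also have "fps_nth (fps_deriv ?T * ?D) m = (\<Sum>k=0..m. of_nat (Suc k) * ((if Suc k < p then t (Suc k) else 0) * variation p t dt c (n - Suc k)))"
    unfolding fps_mult_nth[of "fps_deriv ?T" ?D] D by (simp add: n mult.assoc)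
  also have "fps_nth (fps_deriv ?dT * expT p t c) m = (\<Sum>k=0..m. of_nat (Suc k) * ((if Suc k < p then dt (Suc k) else 0) * ecoef p t c (n - Suc k)))"
    unfolding fps_mult_nth[of "fps_deriv ?dT"] by (simp add: n ecoef_def mult.assoc)
  also have "c * ((\<Sum>k=0..m. of_nat (Suc k) * ((if Suc k < p then t (Suc k) else 0) * variation p t dt c (n - Suc k))) +
       (\<Sum>k=0..m. of_nat (Suc k) * ((if Suc k < p then dt (Suc k) else 0) * ecoef p t c (n - Suc k)))) =
     c * (\<Sum>k=0..m. of_nat (Suc k) * ((if Suc k < p then t (Suc k) else 0) * variation p t dt c (n - Suc k) +
         (if Suc k < p then dt (Suc k) else 0) * ecoef p t c (n - Suc k)))"
    by (simp only: sum.distrib[symmetric] distrib_left)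
  also have "(\<Sum>k=0..m. of_nat (Suc k) * ((if Suc k < p then t (Suc k) else 0) * variation p t dt c (n - Suc k) +
         (if Suc k < p then dt (Suc k) else 0) * ecoef p t c (n - Suc k))) =
     (\<Sum>k=Suc 0..Suc m. of_nat k * ((if k < p then t k else 0) * variation p t dt c (n - k) +
         (if k < p then dt k else 0) * ecoef p t c (n - k)))"
    by (rule sum.shift_bounds_cl_Suc_ivl[symmetric])
  finally show ?thesis by (simp only: n One_nat_def)
qed

text \<open>Differentiating \<open>ecoef_rec\<close> gives a recursion for the derivative, and
  \<open>variation_rec\<close> says that \<open>variation\<close> satisfies the same one.\<close>

lemma hasv_ecoef:
  fixes t :: "'a::cvec \<Rightarrow> nat \<Rightarrow> complex"
  assumes t: "\<And>k. k \<in> {1..<p} \<Longrightarrow> hasv V (\<lambda>z. t z k) (dt k) z"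
  shows "hasv V (\<lambda>z. ecoef p (t z) c n) (variation p (t z) dt c n) z"
proof (induction n rule: less_induct)
  case (less n)
  show ?case
  proof (cases "n = 0")
    case True
    then show ?thesis using hasv_const by (simp add: variation_def)
  next
    case False
    have "hasv V (\<lambda>z. if k < p then t z k else 0) (if k < p then dt k else 0) z" if "k \<in> {1..n}" for k
      using t[of k] that by (cases "k < p") (auto intro: hasv_const)
    then have "hasv V (\<lambda>z. ecoef p (t z) c n) (1 / of_nat n * (c * (\<Sum>k=1..n. of_nat k *
       ((if k < p then t z k else 0) * variation p (t z) dt c (n - k) + (if k < p then dt k else 0) * ecoef p (t z) c (n - k))))) z"
      unfolding ecoef_eq[OF False] by (intro hasv_cmult hasv_sum hasv_mult less) auto
    then show ?thesis
      by (rule hasv_eq) (use False variation_rec[of n p "t z" dt c] in \<open>simp add: field_simps\<close>)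
  qed
qed

lemma hasv_acoef:
  fixes t :: "'a::cvec \<Rightarrow> nat \<Rightarrow> complex"
  assumes t: "\<And>k. k \<in> {1..<p} \<Longrightarrow> hasv V (\<lambda>z. t z k) (dt k) z" and i: "i \<in> {1..<p}"
  shows "hasv V (\<lambda>z. acoef p (t z) i) (\<Sum>k\<in>{1..<p}. dt k * dacoef p (t z) k i) z"
proof -
  have "hasv V (\<lambda>z. acoef p (t z) i) (of_nat p / of_nat i * variation p (t z) dt (of_nat i) (p - i)) z"
    unfolding acoef_def by (intro hasv_cmult hasv_ecoef t)
  \<comment> \<open>The factor \<open>i\<close> produced by differentiating \<open>exp (i T)\<close>
    cancels the denominator in \<open>acoef\<close>.\<close>
  moreover have "of_nat p / of_nat i * variation p (t z) dt (of_nat i) (p - i) =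
      (\<Sum>k=1..p - i. dt k * (of_nat p * ecoef p (t z) (of_nat i) (p - i - k)))"
    unfolding variation_def sum_distrib_left using i by (intro sum.cong) auto
  moreover have "\<dots> = (\<Sum>k\<in>{1..<p}. dt k * dacoef p (t z) k i)"
    using i by (intro sum.mono_neutral_cong_left) (auto simp: dacoef_def)
  ultimately show ?thesis by simp
qed

section \<open>Inversion of the coordinate change between a and t\<close>

lemma acoef_cong: "(\<And>k. k \<in> {1..<p} \<Longrightarrow> t k = t' k) \<Longrightarrow> acoef p t i = acoef p t' i"
  unfolding acoef_def by (intro arg_cong2[where f = "(*)"] refl ecoef_cong) auto

text \<open>Solves \<open>acoef p t (p - n) = a (p - n)\<close> for \<open>t n\<close>, using
  \<open>ecoef_top\<close>; variables not yet determined are set to zero, which makes the recursion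
  well-founded.\<close>

fun flat_coord :: "nat \<Rightarrow> (nat \<Rightarrow> complex) \<Rightarrow> nat \<Rightarrow> complex" where
  "flat_coord p a n = a (p - n) / of_nat p - ecoef p (\<lambda>k. if k < n then flat_coord p a k else 0) (of_nat (p - n)) n / of_nat (p - n)"

declare flat_coord.simps [simp del]

lemma acoef_flat_coord:
  assumes "i \<in> {1..<p}"
  shows "acoef p (flat_coord p a) i = a i"
proof -
  define n where "n = p - i"
  have n: "n \<ge> 1" "n < p" "p - n = i" using assms by (auto simp: n_def)
  have "ecoef p (flat_coord p a) (of_nat i) n = of_nat i * flat_coord p a n + ecoef p ((flat_coord p a)(n := 0)) (of_nat i) n"
    by (rule ecoef_top[OF n(1,2)])
  also have "ecoef p ((flat_coord p a)(n := 0)) (of_nat i) n = ecoef p (\<lambda>k. if k < n then flat_coord p a k else 0) (of_nat i) n"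
    by (rule ecoef_cong) auto
  also have "flat_coord p a n = a i / of_nat p - ecoef p (\<lambda>k. if k < n then flat_coord p a k else 0) (of_nat i) n / of_nat i"
    by (subst flat_coord.simps) (simp add: n)
  finally show ?thesis
    using assms unfolding acoef_def n_def[symmetric] by (simp add: field_simps)
qed

lemma flat_coord_acoef: "n \<in> {1..<p} \<Longrightarrow> flat_coord p (acoef p t) n = t n"
proof (induction n rule: less_induct)
  case (less n)
  define i where "i = p - n"
  have i: "i \<ge> 1" "p - i = n" using less.prems by (auto simp: i_def)
  have "ecoef p (\<lambda>k. if k < n then flat_coord p (acoef p t) k else 0) (of_nat i) n = ecoef p (t(n := 0)) (of_nat i) n"
    by (rule ecoef_cong) (use less in auto)
  moreover have "ecoef p t (of_nat i) n = of_nat i * t n + ecoef p (t(n := 0)) (of_nat i) n"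
    using less.prems by (intro ecoef_top) auto
  ultimately show ?case
    using i less.prems by (subst flat_coord.simps) (simp add: i_def[symmetric] acoef_def field_simps)
qed

lemma flat_coord_cong:
  assumes "\<And>i. i \<in> {1..<p} \<Longrightarrow> a i = a' i"
  shows "n \<in> {1..<p} \<Longrightarrow> flat_coord p a n = flat_coord p a' n"
proof (induction n rule: less_induct)
  case (less n)
  have "ecoef p (\<lambda>k. if k < n then flat_coord p a k else 0) (of_nat (p - n)) n = ecoef p (\<lambda>k. if k < n then flat_coord p a' k else 0) (of_nat (p - n)) n"
    by (rule ecoef_cong) (use less in auto)
  then show ?case using less.prems assms[of "p - n"] by (subst (1 2) flat_coord.simps) auto
qed

lemma cholo_flat_coord:
  fixes a :: "'a::cvec \<Rightarrow> nat \<Rightarrow> complex"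
  assumes a: "\<And>i. i \<in> {1..<p} \<Longrightarrow> (\<lambda>z. a z i) cholo_on S"
  shows "n \<in> {1..<p} \<Longrightarrow> (\<lambda>z. flat_coord p (a z) n) cholo_on S"
proof (induction n rule: less_induct)
  case (less n)
  have "(\<lambda>z. if k < n then flat_coord p (a z) k else 0) cholo_on S" if "k \<in> {1..<p}" for k
    using less.IH[of k] that by (cases "k < n") (auto intro: cholo_const)
  moreover have "(\<lambda>z. a z (p - n)) cholo_on S" using less.prems by (intro a) auto
  ultimately show ?case
    using less.prems by (subst flat_coord.simps) (intro cholo_intros, auto)
qed

section \<open>The Gram matrix in the coordinates t\<close>

lemma kap_cong:
  assumes "\<And>i. i \<in> {1..<p} \<Longrightarrow> a i = a' i"
  shows "kap p a m = kap p a' m"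
proof (induction m rule: less_induct)
  case (less m)
  have "(\<Sum>l\<in>{1..<p}. if l \<le> m then of_nat (p - l) * a (p - l) * kap p a (m - l) else 0) =
    (\<Sum>l\<in>{1..<p}. if l \<le> m then of_nat (p - l) * a' (p - l) * kap p a' (m - l) else 0)" if "m \<noteq> 0"
  proof (rule sum.cong[OF refl])
    fix l assume l: "l \<in> {1..<p}"
    then have "p - l \<in> {1..<p}" by auto
    then show "(if l \<le> m then of_nat (p - l) * a (p - l) * kap p a (m - l) else 0) =
       (if l \<le> m then of_nat (p - l) * a' (p - l) * kap p a' (m - l) else 0)"
      using assms[of "p - l"] less[of "m - l"] l that by simp
  qed
  then show ?case by (cases "m = 0") (simp_all add: kap_0 kap.simps[of _ _ m])
qed

lemma gram_cong_par:
  assumes "\<And>i. i \<in> {1..<p} \<Longrightarrow> a i = a' i"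
  shows "gram p a A B = gram p a' A B"
proof -
  have "kap p a = kap p a'" by (rule ext) (rule kap_cong[OF assms])
  then show ?thesis by (simp only: gram_def)
qed

lemma gram_sum_left: "gram p a (\<lambda>i. \<Sum>k\<in>I. x k * f k i) B = (\<Sum>k\<in>I. x k * gram p a (f k) B)"
proof -
  have "gram p a (\<lambda>i. \<Sum>k\<in>I. x k * f k i) B = (\<Sum>i\<in>{1..<p}. \<Sum>j\<in>{1..<p}. \<Sum>k\<in>I.
      x k * ((if p \<le> i + j then kap p a (i + j - p) else 0) * f k i * B j))"
    unfolding gram_def by (intro sum.cong refl) (simp add: sum_distrib_left sum_distrib_right mult_ac)
  also have "\<dots> = (\<Sum>i\<in>{1..<p}. \<Sum>k\<in>I. \<Sum>j\<in>{1..<p}.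
      x k * ((if p \<le> i + j then kap p a (i + j - p) else 0) * f k i * B j))"
    by (intro sum.cong refl sum.swap)
  also have "\<dots> = (\<Sum>k\<in>I. \<Sum>i\<in>{1..<p}. \<Sum>j\<in>{1..<p}.
      x k * ((if p \<le> i + j then kap p a (i + j - p) else 0) * f k i * B j))"
    by (rule sum.swap)
  finally show ?thesis by (simp add: gram_def sum_distrib_left)
qed

text \<open>In the frame of the \<open>t_k\<close> the Gram matrix is constant, with entries
  \<open>p\<close> on the antidiagonal \<open>k + l = p\<close>.\<close>

lemma gram_flat:
  assumes p: "p \<ge> 1"
  shows "gram p (acoef p t) (\<lambda>i. \<Sum>k\<in>{1..<p}. x k * dacoef p t k i) (\<lambda>i. \<Sum>k\<in>{1..<p}. y k * dacoef p t k i) =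
    (\<Sum>k\<in>{1..<p}. x k * (\<Sum>l\<in>{1..<p}. y l * (if l + k = p then of_nat p else 0)))"
proof -
  have f: "gram p (acoef p t) (dacoef p t k) (dacoef p t l) = (if k + l = p then of_nat p else 0)"
    if "k \<in> {1..<p}" "l \<in> {1..<p}" for k l
    using flat_pairing[OF p, of k l t] that by (simp add: gram_def)
  have "gram p (acoef p t) (dacoef p t k) (\<lambda>i. \<Sum>l\<in>{1..<p}. y l * dacoef p t l i) =
      (\<Sum>l\<in>{1..<p}. y l * (if l + k = p then of_nat p else 0))" if k: "k \<in> {1..<p}" for k
  proof -
    have "gram p (acoef p t) (dacoef p t k) (\<lambda>i. \<Sum>l\<in>{1..<p}. y l * dacoef p t l i) =
        gram p (acoef p t) (\<lambda>i. \<Sum>l\<in>{1..<p}. y l * dacoef p t l i) (dacoef p t k)"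
      by (rule gram_commute)
    also have "\<dots> = (\<Sum>l\<in>{1..<p}. y l * gram p (acoef p t) (dacoef p t l) (dacoef p t k))"
      by (rule gram_sum_left)
    finally show ?thesis using f k by simp
  qed
  then show ?thesis
    unfolding gram_sum_left by simp
qed

section \<open>The flat chart\<close>

context miniversal
begin

definition pvec :: "(nat \<Rightarrow> complex) \<Rightarrow> (nat \<Rightarrow> complex) \<Rightarrow> complex \<Rightarrow> complex ^ 'm" where
  "pvec A B c = (\<chi> k. case inv_into (params p q) ix k of PA i \<Rightarrow> A i | PB i \<Rightarrow> B i | PC \<Rightarrow> c)"

lemma pvec_par:
  "i \<in> {1..<p} \<Longrightarrow> apar ix (pvec A B c) i = A i"
  "i \<in> {1..<q} \<Longrightarrow> bpar ix (pvec A B c) i = B i"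
  "pvec A B c $ ix PC = c"
  by (simp_all add: pvec_def apar_def bpar_def inv_ix params_mem)

lemma vec_eq_par:
  assumes "v $ ix PC = w $ ix PC" "\<And>i. i \<in> {1..<p} \<Longrightarrow> apar ix v i = apar ix w i"
    "\<And>i. i \<in> {1..<q} \<Longrightarrow> bpar ix v i = bpar ix w i"
  shows "v = w"
  using vec_eq_zero[of "v - w"] assms by (simp add: apar_def bpar_def)

lemma cholo_pvec:
  fixes A B :: "'a::cvec \<Rightarrow> nat \<Rightarrow> complex"
  assumes "\<And>i. i \<in> {1..<p} \<Longrightarrow> (\<lambda>z. A z i) cholo_on S" "\<And>i. i \<in> {1..<q} \<Longrightarrow> (\<lambda>z. B z i) cholo_on S" "c cholo_on S"
  shows "(\<lambda>z. pvec (A z) (B z) (c z)) cholo_on S"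
proof -
  have "(\<lambda>z. case inv_into (params p q) ix k of PA i \<Rightarrow> A z i | PB i \<Rightarrow> B z i | PC \<Rightarrow> c z) cholo_on S" for k
  proof -
    obtain l where "l \<in> params p q" "k = ix l" using ix_cases by blast
    then have "inv_into (params p q) ix k = l" using inv_ix by simp
    then show ?thesis using assms \<open>l \<in> params p q\<close> by (auto simp: params_def)
  qed
  then show ?thesis unfolding pvec_def by (rule cholo_vec)
qed

text \<open>\<open>\<epsilon>0\<close> is the base point of the chart: division by it keeps the
  argument of \<open>Ln\<close> near \<open>1\<close>, away from the cut. The logarithm enters
  because its coordinate field is \<epsilon> \<partial>/\<partial>\<epsilon>, whose coefficient
  \<open>hco\<close> is constant.\<close>

definition flat_map :: "complex \<Rightarrow> 'm base \<Rightarrow> 'm base" where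
  "flat_map \<epsilon>0 \<beta> = (Ln (fst \<beta> / \<epsilon>0),
     pvec (flat_coord p (apar ix (snd \<beta>))) (flat_coord q (bpar ix (snd \<beta>))) (snd \<beta> $ ix PC))"

definition flat_inv :: "complex \<Rightarrow> 'm base \<Rightarrow> 'm base" where
  "flat_inv \<epsilon>0 t = (\<epsilon>0 * exp (fst t),
     pvec (acoef p (apar ix (snd t))) (acoef q (bpar ix (snd t))) (snd t $ ix PC))"

lemma cholo_flat_inv: "flat_inv \<epsilon>0 cholo_on S"
proof -
  have "(\<lambda>t. exp (fst t)) cholo_on (S :: 'm base set)"
    by (rule cholo_field[OF cholo_fst[OF cholo_id]]) (rule DERIV_exp)
  then show ?thesis
    unfolding flat_inv_def[abs_def] acoef_def[abs_def]
    by (intro cholo_Pair cholo_pvec cholo_mult cholo_const cholo_ecoef cholo_apar cholo_bpar cholo_nth cholo_snd cholo_id)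
qed

lemma cholo_flat_map:
  assumes "\<And>\<beta>. \<beta> \<in> S \<Longrightarrow> 0 < Re (fst \<beta> / \<epsilon>0)" "\<epsilon>0 \<noteq> 0"
  shows "flat_map \<epsilon>0 cholo_on S"
proof -
  have "(\<lambda>\<beta>. fst \<beta> / \<epsilon>0) cholo_on S" using assms(2) by (intro cholo_intros)
  then have "(\<lambda>\<beta>. Ln (fst \<beta> / \<epsilon>0)) cholo_on S"
  proof (rule cholo_field)
    fix \<beta> assume "\<beta> \<in> S"
    then have "fst \<beta> / \<epsilon>0 \<notin> \<real>\<^sub>\<le>\<^sub>0" using assms(1)[of \<beta>] by (auto simp: complex_nonpos_Reals_iff)
    then show "(Ln has_field_derivative inverse (fst \<beta> / \<epsilon>0)) (at (fst \<beta> / \<epsilon>0))" by (rule has_field_derivative_Ln)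
  qed
  then show ?thesis
    unfolding flat_map_def[abs_def]
    by (intro cholo_Pair cholo_pvec cholo_flat_coord cholo_apar cholo_bpar cholo_nth cholo_snd cholo_id)
qed

lemma flat_inv_map:
  assumes "fst \<beta> \<noteq> 0" "\<epsilon>0 \<noteq> 0"
  shows "flat_inv \<epsilon>0 (flat_map \<epsilon>0 \<beta>) = \<beta>"
proof -
  have a: "acoef p (apar ix (snd (flat_map \<epsilon>0 \<beta>))) i = apar ix (snd \<beta>) i" if "i \<in> {1..<p}" for i
  proof -
    have "acoef p (apar ix (snd (flat_map \<epsilon>0 \<beta>))) i = acoef p (flat_coord p (apar ix (snd \<beta>))) i"
      by (rule acoef_cong) (simp add: flat_map_def pvec_par)
    then show ?thesis using acoef_flat_coord[OF that] by simp
  qed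
  have b: "acoef q (bpar ix (snd (flat_map \<epsilon>0 \<beta>))) i = bpar ix (snd \<beta>) i" if "i \<in> {1..<q}" for i
  proof -
    have "acoef q (bpar ix (snd (flat_map \<epsilon>0 \<beta>))) i = acoef q (flat_coord q (bpar ix (snd \<beta>))) i"
      by (rule acoef_cong) (simp add: flat_map_def pvec_par)
    then show ?thesis using acoef_flat_coord[OF that] by simp
  qed
  have "snd (flat_inv \<epsilon>0 (flat_map \<epsilon>0 \<beta>)) = snd \<beta>"
    by (rule vec_eq_par) (simp_all add: flat_inv_def pvec_par a b, simp add: flat_map_def pvec_par)
  moreover have "fst (flat_inv \<epsilon>0 (flat_map \<epsilon>0 \<beta>)) = fst \<beta>"
    using assms by (simp add: flat_inv_def flat_map_def)
  ultimately show ?thesis by (simp add: prod_eq_iff)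
qed

lemma flat_map_inv:
  assumes "\<bar>Im (fst t)\<bar> < pi" "\<epsilon>0 \<noteq> 0"
  shows "flat_map \<epsilon>0 (flat_inv \<epsilon>0 t) = t"
proof -
  have a: "flat_coord p (apar ix (snd (flat_inv \<epsilon>0 t))) i = apar ix (snd t) i" if "i \<in> {1..<p}" for i
  proof -
    have "flat_coord p (apar ix (snd (flat_inv \<epsilon>0 t))) i = flat_coord p (acoef p (apar ix (snd t))) i"
      by (rule flat_coord_cong[OF _ that]) (simp add: flat_inv_def pvec_par)
    then show ?thesis using flat_coord_acoef[OF that] by simp
  qed
  have b: "flat_coord q (bpar ix (snd (flat_inv \<epsilon>0 t))) i = bpar ix (snd t) i" if "i \<in> {1..<q}" for i
  proof -
    have "flat_coord q (bpar ix (snd (flat_inv \<epsilon>0 t))) i = flat_coord q (acoef q (bpar ix (snd t))) i"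
      by (rule flat_coord_cong[OF _ that]) (simp add: flat_inv_def pvec_par)
    then show ?thesis using flat_coord_acoef[OF that] by simp
  qed
  have "snd (flat_map \<epsilon>0 (flat_inv \<epsilon>0 t)) = snd t"
    by (rule vec_eq_par) (simp_all add: flat_map_def pvec_par a b, simp add: flat_inv_def pvec_par)
  moreover have "fst (flat_map \<epsilon>0 (flat_inv \<epsilon>0 t)) = fst t"
    using assms by (simp add: flat_inv_def flat_map_def Ln_exp abs_less_iff)
  ultimately show ?thesis by (simp add: prod_eq_iff)
qed

text \<open>The coordinate fields of the flat chart in the original coordinates, which determine
  their normal form coefficients.\<close>

lemma frechet_flat_inv:
  fixes e t :: "'m base" and \<epsilon>0 :: complex
  defines "w \<equiv> frechet_derivative (flat_inv \<epsilon>0) (at t) e"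
  shows "fst w = \<epsilon>0 * exp (fst t) * fst e"
    and "i \<in> {1..<p} \<Longrightarrow> apar ix (snd w) i = (\<Sum>k\<in>{1..<p}. apar ix (snd e) k * dacoef p (apar ix (snd t)) k i)"
    and "i \<in> {1..<q} \<Longrightarrow> bpar ix (snd w) i = (\<Sum>k\<in>{1..<q}. bpar ix (snd e) k * dacoef q (bpar ix (snd t)) k i)"
    and "snd w $ ix PC = snd e $ ix PC"
proof -
  note c = vderiv_components[OF cholo_flat_inv UNIV_I, where V = "\<lambda>_. e", unfolded vderiv_def[of _ "flat_inv _"]]
  have f: "fst w = c" if "hasv e (\<lambda>t. fst (flat_inv \<epsilon>0 t)) c t" for c
    using c(1) hasv_vderiv[where V = "\<lambda>_. e", OF that] unfolding w_def by metis
  have s: "snd w $ k = c" if "hasv e (\<lambda>t. snd (flat_inv \<epsilon>0 t) $ k) c t" for c k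
    using c(2) hasv_vderiv[where V = "\<lambda>_. e", OF that] unfolding w_def by metis
  have he: "hasv e fst (fst e) t" by (rule hasvI[OF has_cderiv_fst]) simp
  have hk: "hasv e (\<lambda>t. snd t $ k) (snd e $ k) t" for k
    by (rule hasvI[OF has_cderiv_compose[OF has_cderiv_snd has_cderiv_nth]]) simp
  have "has_cderiv (\<lambda>t. exp (fst t)) (\<lambda>v. exp (fst t) * fst v) t"
    by (rule has_cderiv_field[OF has_cderiv_fst DERIV_exp])
  then have "hasv e (\<lambda>t. exp (fst t)) (exp (fst t) * fst e) t" by (rule hasvI) simp
  from hasv_cmult[OF this, of \<epsilon>0] show "fst w = \<epsilon>0 * exp (fst t) * fst e"
    by (intro f) (simp add: flat_inv_def mult.assoc)
  have ha: "hasv e (\<lambda>t. apar ix (snd t) k) (apar ix (snd e) k) t" for k unfolding apar_def by (rule hk)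
  have hb: "hasv e (\<lambda>t. bpar ix (snd t) k) (bpar ix (snd e) k) t" for k unfolding bpar_def by (rule hk)
  show "apar ix (snd w) i = (\<Sum>k\<in>{1..<p}. apar ix (snd e) k * dacoef p (apar ix (snd t)) k i)" if i: "i \<in> {1..<p}"
  proof -
    have "(\<lambda>t. snd (flat_inv \<epsilon>0 t) $ ix (PA i)) = (\<lambda>t. acoef p (apar ix (snd t)) i)"
      using pvec_par(1)[OF i] by (simp add: flat_inv_def apar_def)
    then show ?thesis
      unfolding apar_def[of ix "snd w"] using hasv_acoef[OF ha i] by (intro s) simp
  qed
  show "bpar ix (snd w) i = (\<Sum>k\<in>{1..<q}. bpar ix (snd e) k * dacoef q (bpar ix (snd t)) k i)" if i: "i \<in> {1..<q}"
  proof -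
    have "(\<lambda>t. snd (flat_inv \<epsilon>0 t) $ ix (PB i)) = (\<lambda>t. acoef q (bpar ix (snd t)) i)"
      using pvec_par(2)[OF i] by (simp add: flat_inv_def bpar_def)
    then show ?thesis
      unfolding bpar_def[of ix "snd w"] using hasv_acoef[OF hb i] by (intro s) simp
  qed
  show "snd w $ ix PC = snd e $ ix PC"
    using hk[of "ix PC"] by (intro s) (simp add: flat_inv_def pvec_par)
qed

lemma flat_chart:
  assumes W: "open W" "W \<subseteq> ball 0 \<delta>" "\<And>\<beta>. \<beta> \<in> W \<Longrightarrow> fst \<beta> \<noteq> 0" and \<beta>0: "\<beta>0 \<in> W"
  shows "\<exists>U V \<phi> \<psi>. \<beta>0 \<in> U \<and> U \<subseteq> W \<and> holo_chart U V \<phi> \<psi> \<and>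
        (\<forall>e e'. \<exists>k. \<forall>\<beta>\<in>U. pairing p q ix r U (coord_field \<phi> \<psi> e) (coord_field \<phi> \<psi> e') \<beta> = k)"
proof -
  define \<epsilon>0 where "\<epsilon>0 = fst \<beta>0"
  have \<epsilon>0: "\<epsilon>0 \<noteq> 0" using W(3)[OF \<beta>0] by (simp add: \<epsilon>0_def)
  let ?\<phi> = "flat_map \<epsilon>0" and ?\<psi> = "flat_inv \<epsilon>0"
  \<comment> \<open>The half plane keeps \<open>Ln\<close> holomorphic, with imaginary part below
    \<open>pi / 2\<close> in absolute value.\<close>
  define U where "U = W \<inter> {\<beta>. 0 < Re (fst \<beta> / \<epsilon>0)}"
  \<comment> \<open>On this strip \<open>Ln\<close> inverts \<open>exp\<close>, so
    \<open>?\<phi>\<close> and \<open>?\<psi>\<close> are inverse to each other.\<close>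
  define V where "V = {t. \<bar>Im (fst t)\<bar> < pi} \<inter> ?\<psi> -` U"
  have U: "open U" unfolding U_def
    by (intro open_Int W open_Collect_less continuous_intros) (use \<epsilon>0 in auto)
  have "open (?\<psi> -` U)" by (rule open_vimage[OF U cholo_on_continuous_on[OF cholo_flat_inv]])
  moreover have "open {t :: 'm base. \<bar>Im (fst t)\<bar> < pi}"
    by (intro open_Collect_less continuous_intros)
  ultimately have V: "open V" unfolding V_def by (rule open_Int[rotated])
  have UW: "U \<subseteq> W" "\<beta>0 \<in> U" using \<beta>0 \<epsilon>0 by (auto simp: U_def \<epsilon>0_def)
  have U0: "fst \<beta> \<noteq> 0" if "\<beta> \<in> U" for \<beta> using that W(3) UW by blast
  have UB: "U \<subseteq> ball 0 \<delta>" using UW W by blast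
  have \<phi>: "?\<phi> cholo_on U" by (rule cholo_flat_map) (auto simp: U_def \<epsilon>0)
  have inv: "?\<psi> (?\<phi> \<beta>) = \<beta>" if "\<beta> \<in> U" for \<beta> by (rule flat_inv_map[OF U0[OF that] \<epsilon>0])
  have \<phi>V: "?\<phi> \<beta> \<in> V" if \<beta>: "\<beta> \<in> U" for \<beta>
  proof -
    have "\<bar>Im (Ln (fst \<beta> / \<epsilon>0))\<bar> < pi / 2"
      using \<beta> U0[OF \<beta>] \<epsilon>0 by (subst Re_Ln_pos_lt) (auto simp: U_def)
    then have "\<bar>Im (fst (?\<phi> \<beta>))\<bar> < pi" by (simp add: flat_map_def)
    then show ?thesis using inv[OF \<beta>] \<beta> by (simp add: V_def)
  qed
  have chart: "holo_chart U V ?\<phi> ?\<psi>"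
    unfolding holo_chart_def using U V \<phi> cholo_flat_inv inv \<phi>V flat_map_inv[OF _ \<epsilon>0] by (auto simp: V_def)
  let ?X = "\<lambda>e. coord_field ?\<phi> ?\<psi> e"
  let ?ta = "\<lambda>\<beta>. apar ix (snd (?\<phi> \<beta>))" and ?tb = "\<lambda>\<beta>. bpar ix (snd (?\<phi> \<beta>))"
  have X: "fst (?X e \<beta>) = fst \<beta> * fst e"
      "i \<in> {1..<p} \<Longrightarrow> apar ix (snd (?X e \<beta>)) i = (\<Sum>k\<in>{1..<p}. apar ix (snd e) k * dacoef p (?ta \<beta>) k i)"
      "j \<in> {1..<q} \<Longrightarrow> bpar ix (snd (?X e \<beta>)) j = (\<Sum>k\<in>{1..<q}. bpar ix (snd e) k * dacoef q (?tb \<beta>) k j)"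
      "snd (?X e \<beta>) $ ix PC = snd e $ ix PC" if \<beta>: "\<beta> \<in> U" for e \<beta> i j
    unfolding coord_field_def frechet_flat_inv(1,4)
    using frechet_flat_inv(2)[of i \<epsilon>0 "?\<phi> \<beta>" e] frechet_flat_inv(3)[of j \<epsilon>0 "?\<phi> \<beta>" e] \<epsilon>0 U0[OF \<beta>]
    by (auto simp: flat_map_def)
  have par: "i \<in> {1..<p} \<Longrightarrow> apar ix (snd \<beta>) i = acoef p (?ta \<beta>) i"
      "j \<in> {1..<q} \<Longrightarrow> bpar ix (snd \<beta>) j = acoef q (?tb \<beta>) j" if \<beta>: "\<beta> \<in> U" for \<beta> i j
    using inv[OF \<beta>] pvec_par by (metis flat_inv_def snd_conv)+
  \<comment> \<open>Holomorphy is read off from the explicit components; tangency is vacuous because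
    \<open>U\<close> misses the discriminant.\<close>
  have Xlog: "?X e \<in> log_fields U" for e
  proof -
    have "(\<lambda>\<beta>. frechet_derivative ?\<psi> (at (?\<phi> \<beta>)) e) cholo_on U"
    proof -
      have "(\<lambda>\<beta>. (fst \<beta> * fst e, pvec (\<lambda>i. \<Sum>k\<in>{1..<p}. apar ix (snd e) k * dacoef p (?ta \<beta>) k i)
          (\<lambda>i. \<Sum>k\<in>{1..<q}. bpar ix (snd e) k * dacoef q (?tb \<beta>) k i) (snd e $ ix PC))) cholo_on U"
      proof (intro cholo_Pair cholo_pvec cholo_sum cholo_mult cholo_const cholo_fst cholo_id)
        show "(\<lambda>\<beta>. dacoef p (?ta \<beta>) k i) cholo_on U" for k i
          unfolding dacoef_def by (cases "k \<le> p - i") (auto intro!: cholo_intros \<phi>)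
        show "(\<lambda>\<beta>. dacoef q (?tb \<beta>) k i) cholo_on U" for k i
          unfolding dacoef_def by (cases "k \<le> q - i") (auto intro!: cholo_intros \<phi>)
      qed
      then show ?thesis
      proof (rule cholo_on_cong[OF _ U])
        fix \<beta> assume \<beta>: "\<beta> \<in> U"
        show "(fst \<beta> * fst e, pvec (\<lambda>i. \<Sum>k\<in>{1..<p}. apar ix (snd e) k * dacoef p (?ta \<beta>) k i)
          (\<lambda>i. \<Sum>k\<in>{1..<q}. bpar ix (snd e) k * dacoef q (?tb \<beta>) k i) (snd e $ ix PC)) =
          frechet_derivative ?\<psi> (at (?\<phi> \<beta>)) e"
          unfolding coord_field_def[symmetric]
          by (auto intro!: vec_eq_par simp: prod_eq_iff X[OF \<beta>] pvec_par)
      qed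
    qed
    then show ?thesis
      unfolding log_fields_def coord_field_def discr_def using U0 by auto
  qed
  have const: "pairing p q ix r U (?X e) (?X e') \<beta> = 2 * of_real pi * \<i> *
     (fst e * snd e' $ ix PC + snd e $ ix PC * fst e' +
      (\<Sum>k\<in>{1..<p}. apar ix (snd e) k * (\<Sum>l\<in>{1..<p}. apar ix (snd e') l * (if l + k = p then of_nat p else 0))) +
      (\<Sum>k\<in>{1..<q}. bpar ix (snd e) k * (\<Sum>l\<in>{1..<q}. bpar ix (snd e') l * (if l + k = q then of_nat q else 0))))"
    if \<beta>: "\<beta> \<in> U" for e e' \<beta>
  proof -
    \<comment> \<open>The \<epsilon>-component of a coordinate field is \<epsilon> times a constant,
      so its logarithmic coefficient is that constant.\<close>
    have h: "hco (?X e) \<beta> = fst e" for e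
      using U0[OF \<beta>] X(1)[OF \<beta>] by (simp add: hco_def div_fst_def)
    have ga: "gram p (apar ix (snd \<beta>)) (apar ix (snd (?X e \<beta>))) (apar ix (snd (?X e' \<beta>))) =
       (\<Sum>k\<in>{1..<p}. apar ix (snd e) k * (\<Sum>l\<in>{1..<p}. apar ix (snd e') l * (if l + k = p then of_nat p else 0)))"
      unfolding gram_flat[OF p, of "?ta \<beta>", symmetric]
      by (subst gram_cong_par[OF par(1)[OF \<beta>]]) (auto intro!: gram_cong simp: X(2)[OF \<beta>])
    have gb: "gram q (bpar ix (snd \<beta>)) (bpar ix (snd (?X e \<beta>))) (bpar ix (snd (?X e' \<beta>))) =
       (\<Sum>k\<in>{1..<q}. bpar ix (snd e) k * (\<Sum>l\<in>{1..<q}. bpar ix (snd e') l * (if l + k = q then of_nat q else 0)))"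
      unfolding gram_flat[OF q, of "?tb \<beta>", symmetric]
      by (subst gram_cong_par[OF par(2)[OF \<beta>]]) (auto intro!: gram_cong simp: X(3)[OF \<beta>])
    show ?thesis
      unfolding pairing_eq(1)[OF U UB Xlog Xlog \<beta>] gform_def h ga gb X(4)[OF \<beta>] ..
  qed
  show ?thesis
    by (intro exI[of _ U] exI[of _ V] exI[of _ ?\<phi>] exI[of _ ?\<psi>] conjI UW chart) (use const in blast)
qed

lemma flat_metric:
  assumes W: "open W" "W \<subseteq> ball 0 \<delta>" "\<And>\<beta>. \<beta> \<in> W \<Longrightarrow> fst \<beta> \<noteq> 0"
  shows "flat_metric_on W (pairing p q ix r)"
  unfolding flat_metric_on_def
proof (intro conjI allI impI ballI)
  fix U assume "open U \<and> U \<subseteq> W"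
  then have U: "open U" "U \<subseteq> ball 0 \<delta>" using W by auto
  show "symmetric_form_over U (pairing p q ix r U)" by (rule symmetric_pairing[OF U])
  fix u \<beta> assume "u \<in> log_fields U" "\<beta> \<in> U" "u \<beta> \<noteq> 0"
  then show "\<exists>v\<in>log_fields U. pairing p q ix r U u v \<beta> \<noteq> 0" by (rule pairing_nondegenerate[OF U])
next
  fix \<beta>0 assume "\<beta>0 \<in> W"
  from flat_chart[OF W this]
  show "\<exists>U V \<phi> \<psi>. \<beta>0 \<in> U \<and> U \<subseteq> W \<and> holo_chart U V \<phi> \<psi> \<and>
        (\<forall>e\<in>coord_vectors. \<forall>e'\<in>coord_vectors. \<exists>k. \<forall>\<beta>\<in>U.
           pairing p q ix r U (coord_field \<phi> \<psi> e) (coord_field \<phi> \<psi> e') \<beta> = k)"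
    by meson
qed

end

theorem theorem1p2:
  fixes p q :: nat and ix :: "param \<Rightarrow> 'm::finite"
  assumes "p \<ge> 1" and "q \<ge> 1"
    and "bij_betw ix (params p q) UNIV"
  shows "\<forall>r>0. \<exists>\<delta>0>0. \<forall>\<delta>. 0 < \<delta> \<and> \<delta> \<le> \<delta>0 \<longrightarrow>
    (let B = ball (0 :: 'm base) \<delta>;
         m = star p q ix r;
         g = pairing p q ix r
     in
       (\<forall>U. open U \<and> U \<subseteq> B \<longrightarrow>
          tF_well_defined p q ix r U \<and>
          star_well_defined p q ix r U \<and>
          comm_algebra_over U (m U) \<and>
          restriction_compatible U m \<and>
          pairing_well_defined p q ix r U \<and>
          symmetric_form_over U (g U) \<and>
          restriction_compatible U g \<and>
          (\<forall>u\<in>log_fields U. \<forall>v\<in>log_fields U. \<forall>w\<in>log_fields U. \<forall>\<beta>\<in>U.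
             g U (m U u v) w \<beta> = g U u (m U v w) \<beta>)) \<and>
       flat_metric_on (B - discr) g \<and>
       (\<exists>E\<in>log_fields B. \<forall>U. open U \<and> U \<subseteq> B \<longrightarrow>
          (\<forall>u\<in>log_fields U. \<forall>v\<in>log_fields U. \<forall>\<beta>\<in>U.
             Lie_mult E (m U) u v \<beta> = m U u v \<beta> \<and>
             Lie_form E (g U) u v \<beta> = g U u v \<beta>)))"
proof (intro allI impI, goal_cases)
  case (1 r)
  then obtain \<delta>0 where \<delta>0: "\<delta>0 > 0" "miniversal p q ix r \<delta>0"
    using miniversal_exists[OF assms] by blast
  interpret miniversal p q ix r \<delta>0 by (rule \<delta>0)
  \<comment> \<open>Everything is proved for arbitrary open subsets of the ball of radius
    \<open>\<delta>0\<close>, so each smaller ball inherits it.\<close>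
  have sub: "U \<subseteq> ball 0 \<delta>0" if "0 < \<delta> \<and> \<delta> \<le> \<delta>0" "U \<subseteq> ball (0 :: 'm base) \<delta>" for U \<delta>
    using that subset_ball[of \<delta> \<delta>0 "0 :: 'm base"] by blast
  have flat: "flat_metric_on (ball 0 \<delta> - discr) (pairing p q ix r)" if \<delta>: "0 < \<delta> \<and> \<delta> \<le> \<delta>0" for \<delta>
  proof (rule flat_metric)
    have "ball 0 \<delta> - discr = ball 0 \<delta> \<inter> {\<beta> :: 'm base. fst \<beta> \<noteq> 0}" by (auto simp: discr_def)
    then show "open (ball 0 \<delta> - discr :: 'm base set)"
      by (auto intro!: open_Int open_Collect_neq continuous_intros)
    show "ball 0 \<delta> - discr \<subseteq> ball (0 :: 'm base) \<delta>0" by (rule sub[OF \<delta>]) auto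
  qed (auto simp: discr_def)
  show ?case
    unfolding Let_def
    by (intro exI[of _ \<delta>0] conjI allI impI ballI bexI[OF _ log_fields_euler[of p q ix]] \<delta>0(1) flat
        tF_wd star_wd comm_algebra restriction_star pairing_wd symmetric_pairing restriction_pairing
        pairing_invariant Lie_star Lie_pairing)
      (assumption | erule conjunct1 conjunct2 | erule sub, erule conjunct2)+
qed

end
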